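(* Let - (MPC): $(\exists\Delta^3)(\forall\varphi^2)(\forall f^1,g^1\le_11)[\overline f\Delta(\varphi,f)=\overline g\Delta(\varphi,f)\to\varphi(f)=\varphi(g)]$; - (PC$^*$): $(\forall^{\mathrm{st}}\varphi^2,f^1\le_11)(\exists^{\mathrm{st}}k^0)(\forall g^1\le_11)[\overline fk=\overline gk\to\varphi(f)=\varphi(g)]$; - ($\mathfrak{PC}$): $(\forall^{\mathrm{st}}\varphi^2,f^1\le_11)(\forall g^1\le_11)[f\approx_1g\to\varphi(f)=\varphi(g)]$. Then $\mathrm{RCA}_0^\Omega$ proves $\mathrm{MPC}\leftrightarrow\mathrm{PC}^*\leftrightarrow\mathfrak{PC}\leftrightarrow\mathrm{MPC}^{\mathrm{st}}$.
   Context: Types: $0$ is the type of natural numbers, $\sigma\to\tau$ that of functionals from type $\sigma$ to type $\tau$; $1:=0\to0$, $2:=1\to0$, $3:=2\to0$. Superscripts indicate types; finitely many arguments or values are combined by standard currying/coding (so a functional taking arguments of type $2$ and $1$ to type $0$ is also given type $3$). For $f,g$ of type $1$, $f\le_1g$ means $(\forall n^0)(f(n)\le g(n))$; `$f\le_11$' says that $f$ is a $0/1$-sequence (an element of Cantor space); $\overline fn$ is (the code of) $\langle f(0),\dots,f(n-1)\rangle$; $\sigma*00\dots$ extends the finite sequence $\sigma$ by zeros. $\mathrm{RCA}_0^\omega$ (Kohlenbach) is $\mathrm{E\text{-}PRA}^\omega+\mathrm{QF\text{-}AC}^{1,0}$. Here $\mathrm{E\text{-}PRA}^\omega$ is classical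 arithmetic in all finite types with primitive equality $=_0$ only at type $0$ (at higher type, $x=_\tau y$ is defined as $xz_1\dots z_k=_0yz_1\dots z_k$ for all $z_i$), constants for zero, successor, the combinators and primitive recursion with values of type $0$, quantifier-free induction, and the extensionality axiom $x=_\rho y\to\varphi(x)=_\tau\varphi(y)$ for all $\varphi^{\rho\to\tau}$. $\mathrm{QF\text{-}AC}^{\sigma,0}$ is the schema $(\forall x^\sigma)(\exists n^0)A_0(x,n)\to(\exists F^{\sigma\to0})(\forall x^\sigma)A_0(x,F(x))$ for quantifier-free $A_0$. $\mathrm{RCA}_0^\Omega$ is $\mathrm{E\text{-}PRA}^{\omega*}_{\mathrm{st}}+\mathrm{QF\text{-}AC}^{1,0}+\mathrm I+\mathrm{HAC}_{\mathrm{int}}+\mathrm{PF\text{-}TP}_\forall$ plus the constant axioms below. The language adds a type $\sigma^*$ of finite sequences of objects of type $\sigma$ and, for each type, a predicate $\mathrm{st}(x)$ (`$x$ is standard'). $(\forall^{\mathrm{st}}x)\Phi$ is $(\forall x)(\mathrm{st}(x)\to\Phi)$ and $(\exists^{\mathrm{st}}x)\Phi$ is $(\exists x)(\mathrm{st}(x)\wedge\Phi)$. A formula is internal if `st' does not occur in it; $A^{\mathrm{st}}$ is obtained from $A$ by appending `st' to all quantifiers except bounded number quantifiers. For $f,g$ of type $1$, $f\approx_1g$ means $(\forall^{\mathrm{st}}n^0)(f(n)=g(n))$. Basic axioms of $\mathrm{E\text{-}PRA}^{\omega*}_{\mathrm{st}}$: $\mathrm{st}(x)\wedge x=y\to\mathrm{st}(y)$;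 $\mathrm{st}(t)$ for closed terms $t$; $\mathrm{st}(f)\wedge\mathrm{st}(x)\to\mathrm{st}(f(x))$; numbers below a standard number are standard. I (for internal $\varphi$): $(\forall^{\mathrm{st}}x^{\sigma^*})(\exists y^\tau)(\forall z^\sigma\in x)\varphi(z,y)\to(\exists y^\tau)(\forall^{\mathrm{st}}x^\sigma)\varphi(x,y)$. $\mathrm{HAC}_{\mathrm{int}}$ (for internal $\varphi$): $(\forall^{\mathrm{st}}x^\rho)(\exists^{\mathrm{st}}y^\tau)\varphi(x,y)\to(\exists^{\mathrm{st}}F^{\rho\to\tau^*})(\forall^{\mathrm{st}}x^\rho)(\exists y^\tau\in F(x))\varphi(x,y)$. $\mathrm{PF\text{-}TP}_\forall$: $(\forall^{\mathrm{st}}x^\tau)\varphi(x)\to(\forall x^\tau)\varphi(x)$ for internal $\varphi(x)$ with no parameters other than $x$. Constant axioms: (i) there is a constant $\Omega_0$ with $\mathrm{st}(\Omega_0)\wedge(\forall^{\mathrm{st}}\Xi^3)[M^{\mathrm{st}}(\Xi)\to(\forall^{\mathrm{st}}\varphi^2)(\Omega_0(\varphi)=\Xi(\varphi))]$, where $M(\Xi)$ says that for all $\varphi^2$, $\Xi(\varphi)$ is the least $n$ with $(\forall f,g\le_11)(\overline fn=\overline gn\to\varphi(f)=\varphi(g))$; and analogous constants and axioms for other functionals uniquely defined by a parameter-free internal formula; (ii) there is a constant $\Lambda_0^3$ with $\mathrm{st}(\Lambda_0)$ and $(\forall^{\mathrm{st}}\Upsilon^3)[K^{\mathrm{st}}(\Upsilon)\to(\forall^{\mathrm{st}}\varphi^2,f^1\le_11)(\Xi(\varphi,\Upsilon(\varphi,\cdot))(\overline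 f\Lambda_0(\varphi,f))=\varphi(f)+1)]$, where $K(\Upsilon)$ is $(\forall\varphi^2,f^1,g^1\le_11)(\overline f\Upsilon(\varphi,f)=\overline g\Upsilon(\varphi,f)\to\varphi(f)=\varphi(g))$ and $\Xi(\varphi,\omega)$ is the associate of $\varphi$ computed from a modulus $\omega$: $\Xi(\varphi,\omega)(\sigma)=\varphi(\sigma*00\dots)+1$ if $\omega(\sigma*00\dots)\le|\sigma|$, and $0$ otherwise. *)

theory Defs
  imports Main
begin

section \<open>Syntax\<close>

datatype ty =
    TNat
  | TFun ty ty  (infixr "\<Rrightarrow>" 65)
  | TSeq ty

type_synonym vname = string

text \<open>
  A variable is a name together with a type.  The constants \<open>Tab\<close>, \<open>Len\<close>, \<open>Nth\<close> present
  \<open>\<sigma>\<^sup>*\<close> as a definitional extension by pairs of a length and a function \<open>0 \<rightarrow> \<sigma>\<close>: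
  \<open>Tab \<alpha> n\<close> is \<open>\<langle>\<alpha>(0), \<dots>, \<alpha>(n-1)\<rangle>\<close>.  Empty sequence, adjunction, concatenation and recursion
  along a sequence with values of type 0 are definable from them.

  \<open>UDef x \<rho> \<tau> A\<close> is the constant for the functional of type \<open>\<rho> \<rightarrow> \<tau>\<close> that is uniquely
  defined by \<open>A\<close>, whose only free variable is \<open>x\<close> of type \<open>\<rho> \<rightarrow> \<tau>\<close>.  If \<open>A\<close> is not of that kind,
  the constant is just a further closed term without an axiom of its own.
\<close>

datatype cnst =
    Zero
  | Succ
  | CK ty ty
  | CS ty ty ty
  | Rec
  | Tab ty
  | Len ty
  | Nth ty
  | Omega0
  | Lambda0
  | UDef vname ty ty fm
and tm =
    Var vname ty
  | Cn cnst
  | App tm tm  (infixl "\<cdot>" 90)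
and fm =
    Eq tm tm  (infix "\<^bold>=" 55)
  | St tm
  | Bot
  | Imp fm fm  (infixr "\<^bold>\<longrightarrow>" 45)
  | Forall vname ty fm
  | BForall vname tm fm  \<comment> \<open>\<open>BForall x t A\<close> is the bounded number quantifier \<open>(\<forall>x\<^sup>0 < t) A\<close>\<close>

abbreviation ty1 :: ty where "ty1 \<equiv> TNat \<Rrightarrow> TNat"
abbreviation ty2 :: ty where "ty2 \<equiv> ty1 \<Rrightarrow> TNat"
abbreviation ty3 :: ty where "ty3 \<equiv> ty2 \<Rrightarrow> TNat"
text \<open>The curried form of type 3 for functionals with arguments of types 2 and 1.\<close>
abbreviation ty21 :: ty where "ty21 \<equiv> ty2 \<Rrightarrow> ty1 \<Rrightarrow> TNat"

fun ty_cn :: "cnst \<Rightarrow> ty" where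
  "ty_cn Zero = TNat"
| "ty_cn Succ = TNat \<Rrightarrow> TNat"
| "ty_cn (CK \<sigma> \<tau>) = \<sigma> \<Rrightarrow> \<tau> \<Rrightarrow> \<sigma>"
| "ty_cn (CS \<rho> \<sigma> \<tau>) = (\<rho> \<Rrightarrow> \<sigma> \<Rrightarrow> \<tau>) \<Rrightarrow> (\<rho> \<Rrightarrow> \<sigma>) \<Rrightarrow> \<rho> \<Rrightarrow> \<tau>"
| "ty_cn Rec = TNat \<Rrightarrow> (TNat \<Rrightarrow> TNat \<Rrightarrow> TNat) \<Rrightarrow> TNat \<Rrightarrow> TNat"
| "ty_cn (Tab \<sigma>) = (TNat \<Rrightarrow> \<sigma>) \<Rrightarrow> TNat \<Rrightarrow> TSeq \<sigma>"
| "ty_cn (Len \<sigma>) = TSeq \<sigma> \<Rrightarrow> TNat"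
| "ty_cn (Nth \<sigma>) = TSeq \<sigma> \<Rrightarrow> TNat \<Rrightarrow> \<sigma>"
| "ty_cn Omega0 = ty3"
| "ty_cn Lambda0 = ty21"
| "ty_cn (UDef x \<rho> \<tau> A) = \<rho> \<Rrightarrow> \<tau>"

text \<open>\<open>ty_of\<close> is meaningful only for well-typed terms.\<close>

fun ty_of :: "tm \<Rightarrow> ty" where
  "ty_of (Var x \<sigma>) = \<sigma>"
| "ty_of (Cn c) = ty_cn c"
| "ty_of (s \<cdot> t) = (case ty_of s of \<sigma> \<Rrightarrow> \<tau> \<Rightarrow> \<tau> | _ \<Rightarrow> TNat)"

fun wt :: "tm \<Rightarrow> bool" where
  "wt (Var x \<sigma>) = True"
| "wt (Cn c) = True"
| "wt (s \<cdot> t) = (wt s \<and> wt t \<and> (\<exists>\<tau>. ty_of s = ty_of t \<Rrightarrow> \<tau>))"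

definition has_ty :: "tm \<Rightarrow> ty \<Rightarrow> bool"  (infix "\<^bold>:" 50) where
  "t \<^bold>: \<sigma> \<longleftrightarrow> wt t \<and> ty_of t = \<sigma>"

fun fvt :: "tm \<Rightarrow> (vname \<times> ty) set" where
  "fvt (Var x \<sigma>) = {(x, \<sigma>)}"
| "fvt (Cn c) = {}"
| "fvt (s \<cdot> t) = fvt s \<union> fvt t"

fun wff :: "fm \<Rightarrow> bool" where
  "wff (s \<^bold>= t) = (s \<^bold>: TNat \<and> t \<^bold>: TNat)"
| "wff (St t) = wt t"
| "wff Bot = True"
| "wff (A \<^bold>\<longrightarrow> B) = (wff A \<and> wff B)"
| "wff (Forall x \<sigma> A) = wff A"
| "wff (BForall x t A) = (t \<^bold>: TNat \<and> (x, TNat) \<notin> fvt t \<and> wff A)"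

fun fv :: "fm \<Rightarrow> (vname \<times> ty) set" where
  "fv (s \<^bold>= t) = fvt s \<union> fvt t"
| "fv (St t) = fvt t"
| "fv Bot = {}"
| "fv (A \<^bold>\<longrightarrow> B) = fv A \<union> fv B"
| "fv (Forall x \<sigma> A) = fv A - {(x, \<sigma>)}"
| "fv (BForall x t A) = fvt t \<union> (fv A - {(x, TNat)})"

fun subst_tm :: "vname \<Rightarrow> ty \<Rightarrow> tm \<Rightarrow> tm \<Rightarrow> tm" where
  "subst_tm x \<sigma> u (Var y \<tau>) = (if x = y \<and> \<sigma> = \<tau> then u else Var y \<tau>)"
| "subst_tm x \<sigma> u (Cn c) = Cn c"
| "subst_tm x \<sigma> u (s \<cdot> t) = subst_tm x \<sigma> u s \<cdot> subst_tm x \<sigma> u t"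

text \<open>\<open>subst x \<sigma> u A\<close> does not rename bound variables; it is used only when \<open>free_for x \<sigma> u A\<close>.\<close>

fun subst :: "vname \<Rightarrow> ty \<Rightarrow> tm \<Rightarrow> fm \<Rightarrow> fm" where
  "subst x \<sigma> u (s \<^bold>= t) = (subst_tm x \<sigma> u s \<^bold>= subst_tm x \<sigma> u t)"
| "subst x \<sigma> u (St t) = St (subst_tm x \<sigma> u t)"
| "subst x \<sigma> u Bot = Bot"
| "subst x \<sigma> u (A \<^bold>\<longrightarrow> B) = (subst x \<sigma> u A \<^bold>\<longrightarrow> subst x \<sigma> u B)"
| "subst x \<sigma> u (Forall y \<tau> A) =
     Forall y \<tau> (if x = y \<and> \<sigma> = \<tau> then A else subst x \<sigma> u A)"
| "subst x \<sigma> u (BForall y t A) =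
     BForall y (subst_tm x \<sigma> u t) (if x = y \<and> \<sigma> = TNat then A else subst x \<sigma> u A)"

fun free_for :: "vname \<Rightarrow> ty \<Rightarrow> tm \<Rightarrow> fm \<Rightarrow> bool" where
  "free_for x \<sigma> u (s \<^bold>= t) = True"
| "free_for x \<sigma> u (St t) = True"
| "free_for x \<sigma> u Bot = True"
| "free_for x \<sigma> u (A \<^bold>\<longrightarrow> B) = (free_for x \<sigma> u A \<and> free_for x \<sigma> u B)"
| "free_for x \<sigma> u (Forall y \<tau> A) =
     ((x, \<sigma>) \<notin> fv (Forall y \<tau> A) \<or> (y, \<tau>) \<notin> fvt u \<and> free_for x \<sigma> u A)"
| "free_for x \<sigma> u (BForall y t A) =
     ((x, \<sigma>) \<notin> fv (BForall y t A) \<or> (y, TNat) \<notin> fvt u \<and> free_for x \<sigma> u A)"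

abbreviation Neg :: "fm \<Rightarrow> fm"  ("\<^bold>\<not> _" [60] 60) where
  "\<^bold>\<not> A \<equiv> A \<^bold>\<longrightarrow> Bot"
abbreviation Conj :: "fm \<Rightarrow> fm \<Rightarrow> fm"  (infixr "\<^bold>\<and>" 50) where
  "A \<^bold>\<and> B \<equiv> \<^bold>\<not> (A \<^bold>\<longrightarrow> \<^bold>\<not> B)"
abbreviation Iff :: "fm \<Rightarrow> fm \<Rightarrow> fm"  (infix "\<^bold>\<longleftrightarrow>" 44) where
  "A \<^bold>\<longleftrightarrow> B \<equiv> (A \<^bold>\<longrightarrow> B) \<^bold>\<and> (B \<^bold>\<longrightarrow> A)"
abbreviation Exists :: "vname \<Rightarrow> ty \<Rightarrow> fm \<Rightarrow> fm" where
  "Exists x \<sigma> A \<equiv> \<^bold>\<not> (Forall x \<sigma> (\<^bold>\<not> A))"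
abbreviation BExists :: "vname \<Rightarrow> tm \<Rightarrow> fm \<Rightarrow> fm" where
  "BExists x t A \<equiv> \<^bold>\<not> (BForall x t (\<^bold>\<not> A))"
abbreviation Forall_st :: "vname \<Rightarrow> ty \<Rightarrow> fm \<Rightarrow> fm" where
  "Forall_st x \<sigma> A \<equiv> Forall x \<sigma> (St (Var x \<sigma>) \<^bold>\<longrightarrow> A)"
abbreviation Exists_st :: "vname \<Rightarrow> ty \<Rightarrow> fm \<Rightarrow> fm" where
  "Exists_st x \<sigma> A \<equiv> Exists x \<sigma> (St (Var x \<sigma>) \<^bold>\<and> A)"

fun internal :: "fm \<Rightarrow> bool" where
  "internal (s \<^bold>= t) = True"
| "internal (St t) = False"
| "internal Bot = True"
| "internal (A \<^bold>\<longrightarrow> B) = (internal A \<and> internal B)"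
| "internal (Forall x \<sigma> A) = internal A"
| "internal (BForall x t A) = internal A"

fun qfree :: "fm \<Rightarrow> bool" where
  "qfree (s \<^bold>= t) = True"
| "qfree (St t) = False"
| "qfree Bot = True"
| "qfree (A \<^bold>\<longrightarrow> B) = (qfree A \<and> qfree B)"
| "qfree (Forall x \<sigma> A) = False"
| "qfree (BForall x t A) = False"

text \<open>\<open>strel A\<close> is \<open>A\<^sup>s\<^sup>t\<close>.  Number quantifiers inside defined notions, such as the one in
  \<open>f \<le>\<^sub>1 g\<close>, are relativized as well unless they are bounded.\<close>

fun strel :: "fm \<Rightarrow> fm" where
  "strel (s \<^bold>= t) = (s \<^bold>= t)"
| "strel (St t) = St t"
| "strel Bot = Bot"
| "strel (A \<^bold>\<longrightarrow> B) = (strel A \<^bold>\<longrightarrow> strel B)"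
| "strel (Forall x \<sigma> A) = Forall_st x \<sigma> (strel A)"
| "strel (BForall x t A) = BForall x t (strel A)"


section \<open>Derivability\<close>

abbreviation "zero \<equiv> Cn Zero"
abbreviation suc :: "tm \<Rightarrow> tm" where "suc t \<equiv> Cn Succ \<cdot> t"

text \<open>
  \<open>monus s t\<close> is truncated subtraction, by recursion on \<open>t\<close> with step function \<open>\<lambda>n m. pred m\<close>,
  where \<open>pred\<close> is \<open>Rec 0 (\<lambda>n m. n)\<close>.
\<close>

definition pred :: tm where
  "pred = Cn Rec \<cdot> zero \<cdot> Cn (CK TNat TNat)"
definition monus :: "tm \<Rightarrow> tm \<Rightarrow> tm" where
  "monus s t = Cn Rec \<cdot> s \<cdot> (Cn (CK ty1 TNat) \<cdot> pred) \<cdot> t"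
definition le :: "tm \<Rightarrow> tm \<Rightarrow> fm"  (infix "\<^bold>\<le>" 55) where
  "s \<^bold>\<le> t = (monus s t \<^bold>= zero)"
definition lt :: "tm \<Rightarrow> tm \<Rightarrow> fm"  (infix "\<^bold><" 55) where
  "s \<^bold>< t = (suc s \<^bold>\<le> t)"

text \<open>Classical natural deduction from the set \<open>T\<close> of axioms, whose free variables are read as
  universally quantified: \<open>allI\<close> restricts only the free variables of the hypotheses \<open>\<Gamma>\<close>.\<close>

inductive nd :: "fm set \<Rightarrow> fm set \<Rightarrow> fm \<Rightarrow> bool" for T :: "fm set" where
  ax: "A \<in> T \<Longrightarrow> nd T \<Gamma> A"
| hyp: "A \<in> \<Gamma> \<Longrightarrow> wff A \<Longrightarrow> nd T \<Gamma> A"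
| weaken: "nd T \<Gamma> A \<Longrightarrow> \<Gamma> \<subseteq> \<Delta> \<Longrightarrow> nd T \<Delta> A"
| impI: "wff A \<Longrightarrow> nd T (insert A \<Gamma>) B \<Longrightarrow> nd T \<Gamma> (A \<^bold>\<longrightarrow> B)"
| impE: "nd T \<Gamma> (A \<^bold>\<longrightarrow> B) \<Longrightarrow> nd T \<Gamma> A \<Longrightarrow> nd T \<Gamma> B"
| contr: "wff A \<Longrightarrow> nd T (insert (\<^bold>\<not> A) \<Gamma>) Bot \<Longrightarrow> nd T \<Gamma> A"
| allI: "nd T \<Gamma> A \<Longrightarrow> \<forall>B\<in>\<Gamma>. (x, \<sigma>) \<notin> fv B \<Longrightarrow> nd T \<Gamma> (Forall x \<sigma> A)"
| allE: "nd T \<Gamma> (Forall x \<sigma> A) \<Longrightarrow> t \<^bold>: \<sigma> \<Longrightarrow> free_for x \<sigma> t A \<Longrightarrow> nd T \<Gamma> (subst x \<sigma> t A)"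
| ballI: "nd T \<Gamma> (Forall x TNat (Var x TNat \<^bold>< t \<^bold>\<longrightarrow> A)) \<Longrightarrow> (x, TNat) \<notin> fvt t
    \<Longrightarrow> nd T \<Gamma> (BForall x t A)"
| ballE: "nd T \<Gamma> (BForall x t A) \<Longrightarrow> nd T \<Gamma> (Forall x TNat (Var x TNat \<^bold>< t \<^bold>\<longrightarrow> A))"

definition provable :: "fm set \<Rightarrow> fm \<Rightarrow> bool"  (infix "\<turnstile>" 40) where
  "T \<turnstile> A \<longleftrightarrow> nd T {} A"


section \<open>Defined notions\<close>

text \<open>\<open>fresh s t\<close> is longer than every variable name in \<open>s\<close> and \<open>t\<close>, hence occurs in neither.\<close>

fun nlen :: "tm \<Rightarrow> nat" where
  "nlen (Var x \<sigma>) = length x"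
| "nlen (Cn c) = 0"
| "nlen (s \<cdot> t) = max (nlen s) (nlen t)"

definition fresh :: "tm \<Rightarrow> tm \<Rightarrow> vname" where
  "fresh s t = replicate (Suc (max (nlen s) (nlen t))) (CHR ''z'')"

text \<open>\<open>eqf \<sigma> s t\<close> is \<open>s =\<^sub>\<sigma> t\<close>.  Equality of finite sequences is equality of the lengths and of
  the entries.\<close>

fun eqf :: "ty \<Rightarrow> tm \<Rightarrow> tm \<Rightarrow> fm" where
  "eqf TNat s t = (s \<^bold>= t)"
| "eqf (\<sigma> \<Rrightarrow> \<tau>) s t =
     (let z = fresh s t in Forall z \<sigma> (eqf \<tau> (s \<cdot> Var z \<sigma>) (t \<cdot> Var z \<sigma>)))"
| "eqf (TSeq \<sigma>) s t =
     (let i = fresh s t in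
        (Cn (Len \<sigma>) \<cdot> s \<^bold>= Cn (Len \<sigma>) \<cdot> t) \<^bold>\<and>
        BForall i (Cn (Len \<sigma>) \<cdot> s)
          (eqf \<sigma> (Cn (Nth \<sigma>) \<cdot> s \<cdot> Var i TNat) (Cn (Nth \<sigma>) \<cdot> t \<cdot> Var i TNat)))"

text \<open>\<open>elem \<sigma> z s\<close> is \<open>z\<^sup>\<sigma> \<in> s\<close> for a finite sequence \<open>s\<close>.\<close>

definition elem :: "ty \<Rightarrow> tm \<Rightarrow> tm \<Rightarrow> fm" where
  "elem \<sigma> z s = (let i = fresh z s in
     BExists i (Cn (Len \<sigma>) \<cdot> s) (eqf \<sigma> z (Cn (Nth \<sigma>) \<cdot> s \<cdot> Var i TNat)))"

definition le1 :: "tm \<Rightarrow> tm \<Rightarrow> fm"  (infix "\<^bold>\<le>\<^sub>1" 55) where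
  "f \<^bold>\<le>\<^sub>1 g = (let n = fresh f g in Forall n TNat (f \<cdot> Var n TNat \<^bold>\<le> g \<cdot> Var n TNat))"

definition one1 :: tm where
  "one1 = Cn (CK TNat TNat) \<cdot> suc zero"

definition approx1 :: "tm \<Rightarrow> tm \<Rightarrow> fm"  (infix "\<^bold>\<approx>\<^sub>1" 55) where
  "f \<^bold>\<approx>\<^sub>1 g = (let n = fresh f g in Forall_st n TNat (f \<cdot> Var n TNat \<^bold>= g \<cdot> Var n TNat))"

text \<open>Initial segments \<open>\<langle>f(0), \<dots>, f(n-1)\<rangle>\<close> are taken in type \<open>0\<^sup>*\<close> rather than coded in type 0.\<close>

definition seg :: "tm \<Rightarrow> tm \<Rightarrow> tm" where
  "seg f n = Cn (Tab TNat) \<cdot> f \<cdot> n"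

definition eq_upto :: "tm \<Rightarrow> tm \<Rightarrow> tm \<Rightarrow> fm" where
  "eq_upto f g n = eqf (TSeq TNat) (seg f n) (seg g n)"

text \<open>Bracket abstraction: \<open>lam x \<sigma> t\<close> is the combinator term for \<open>\<lambda>x\<^sup>\<sigma>. t\<close>.\<close>

fun lam :: "vname \<Rightarrow> ty \<Rightarrow> tm \<Rightarrow> tm" where
  "lam x \<sigma> (Var y \<tau>) =
     (if x = y \<and> \<sigma> = \<tau> then Cn (CS \<sigma> (\<sigma> \<Rrightarrow> \<sigma>) \<sigma>) \<cdot> Cn (CK \<sigma> (\<sigma> \<Rrightarrow> \<sigma>)) \<cdot> Cn (CK \<sigma> \<sigma>)
      else Cn (CK \<tau> \<sigma>) \<cdot> Var y \<tau>)"
| "lam x \<sigma> (Cn c) = Cn (CK (ty_cn c) \<sigma>) \<cdot> Cn c"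
| "lam x \<sigma> (s \<cdot> t) = Cn (CS \<sigma> (ty_of t) (ty_of (s \<cdot> t))) \<cdot> lam x \<sigma> s \<cdot> lam x \<sigma> t"

text \<open>\<open>cond c a b\<close> is \<open>a\<close> if \<open>c = 0\<close> and \<open>b\<close> otherwise (all of type 0).\<close>

definition cond :: "tm \<Rightarrow> tm \<Rightarrow> tm \<Rightarrow> tm" where
  "cond c a b = Cn Rec \<cdot> a \<cdot> (Cn (CK ty1 TNat) \<cdot> (Cn (CK TNat TNat) \<cdot> b)) \<cdot> c"

text \<open>\<open>pad0 s\<close> is \<open>s * 00\<dots>\<close> for \<open>s\<close> of type \<open>0\<^sup>*\<close>.\<close>

definition pad0 :: "tm \<Rightarrow> tm" where
  "pad0 s = (let i = fresh s s in
     lam i TNat (cond (monus (suc (Var i TNat)) (Cn (Len TNat) \<cdot> s))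
       (Cn (Nth TNat) \<cdot> s \<cdot> Var i TNat) zero))"

text \<open>\<open>assoc \<phi> \<omega> s\<close> is the value \<open>\<Xi>(\<phi>, \<omega>)(s)\<close> of the associate of \<open>\<phi>\<close> computed from
  the modulus \<open>\<omega>\<close>.\<close>

definition assoc :: "tm \<Rightarrow> tm \<Rightarrow> tm \<Rightarrow> tm" where
  "assoc \<phi> \<omega> s =
     cond (monus (\<omega> \<cdot> pad0 s) (Cn (Len TNat) \<cdot> s)) (suc (\<phi> \<cdot> pad0 s)) zero"

abbreviation "vphi \<equiv> Var ''phi'' ty2"
abbreviation "vf \<equiv> Var ''f'' ty1"
abbreviation "vg \<equiv> Var ''g'' ty1"

abbreviation Forall01 :: "vname \<Rightarrow> fm \<Rightarrow> fm" where
  "Forall01 x A \<equiv> Forall x ty1 (Var x ty1 \<^bold>\<le>\<^sub>1 one1 \<^bold>\<longrightarrow> A)"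
abbreviation Forall01_st :: "vname \<Rightarrow> fm \<Rightarrow> fm" where
  "Forall01_st x A \<equiv> Forall_st x ty1 (Var x ty1 \<^bold>\<le>\<^sub>1 one1 \<^bold>\<longrightarrow> A)"

definition unif_mod :: "tm \<Rightarrow> fm" where
  "unif_mod n = Forall01 ''f'' (Forall01 ''g''
     (eq_upto vf vg n \<^bold>\<longrightarrow> vphi \<cdot> vf \<^bold>= vphi \<cdot> vg))"

text \<open>\<open>fan_M\<close> and \<open>fan_K\<close> are the formulas \<open>M(\<Xi>)\<close> and \<open>K(\<Upsilon>)\<close> for a term in which
  none of the variables bound below occurs.\<close>

definition fan_M :: "tm \<Rightarrow> fm" where
  "fan_M \<Xi> = Forall ''phi'' ty2
     (unif_mod (\<Xi> \<cdot> vphi) \<^bold>\<and>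
      BForall ''m'' (\<Xi> \<cdot> vphi) (\<^bold>\<not> unif_mod (Var ''m'' TNat)))"

definition fan_K :: "tm \<Rightarrow> fm" where
  "fan_K \<Upsilon> = Forall ''phi'' ty2 (Forall01 ''f'' (Forall01 ''g''
     (eq_upto vf vg (\<Upsilon> \<cdot> vphi \<cdot> vf) \<^bold>\<longrightarrow> vphi \<cdot> vf \<^bold>= vphi \<cdot> vg)))"


section \<open>Axiom systems\<close>

text \<open>\<open>E-PRA\<^sup>\<omega>\<^sup>*\<close>, that is \<open>E-PRA\<^sup>\<omega>\<close> with types of finite sequences.  Axioms containing arbitrary
  terms amount to the universal closures of their instances with variables.\<close>

inductive_set epra :: "fm set" where
  eq_refl: "t \<^bold>: TNat \<Longrightarrow> (t \<^bold>= t) \<in> epra"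
| eq_sym: "s \<^bold>: TNat \<Longrightarrow> t \<^bold>: TNat \<Longrightarrow> (s \<^bold>= t \<^bold>\<longrightarrow> t \<^bold>= s) \<in> epra"
| eq_trans: "r \<^bold>: TNat \<Longrightarrow> s \<^bold>: TNat \<Longrightarrow> t \<^bold>: TNat
    \<Longrightarrow> (r \<^bold>= s \<^bold>\<longrightarrow> s \<^bold>= t \<^bold>\<longrightarrow> r \<^bold>= t) \<in> epra"
| suc_nonzero: "t \<^bold>: TNat \<Longrightarrow> \<^bold>\<not> (suc t \<^bold>= zero) \<in> epra"
| suc_inject: "s \<^bold>: TNat \<Longrightarrow> t \<^bold>: TNat \<Longrightarrow> (suc s \<^bold>= suc t \<^bold>\<longrightarrow> s \<^bold>= t) \<in> epra"
| comb_K: "s \<^bold>: \<sigma> \<Longrightarrow> t \<^bold>: \<tau> \<Longrightarrow> eqf \<sigma> (Cn (CK \<sigma> \<tau>) \<cdot> s \<cdot> t) s \<in> epra"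
| comb_S: "r \<^bold>: \<rho> \<Rrightarrow> \<sigma> \<Rrightarrow> \<tau> \<Longrightarrow> s \<^bold>: \<rho> \<Rrightarrow> \<sigma> \<Longrightarrow> t \<^bold>: \<rho>
    \<Longrightarrow> eqf \<tau> (Cn (CS \<rho> \<sigma> \<tau>) \<cdot> r \<cdot> s \<cdot> t) (r \<cdot> t \<cdot> (s \<cdot> t)) \<in> epra"
| rec_zero: "a \<^bold>: TNat \<Longrightarrow> h \<^bold>: TNat \<Rrightarrow> TNat \<Rrightarrow> TNat
    \<Longrightarrow> (Cn Rec \<cdot> a \<cdot> h \<cdot> zero \<^bold>= a) \<in> epra"
| rec_suc: "a \<^bold>: TNat \<Longrightarrow> h \<^bold>: TNat \<Rrightarrow> TNat \<Rrightarrow> TNat \<Longrightarrow> t \<^bold>: TNat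
    \<Longrightarrow> (Cn Rec \<cdot> a \<cdot> h \<cdot> suc t \<^bold>= h \<cdot> t \<cdot> (Cn Rec \<cdot> a \<cdot> h \<cdot> t)) \<in> epra"
| seq_len: "f \<^bold>: TNat \<Rrightarrow> \<sigma> \<Longrightarrow> n \<^bold>: TNat
    \<Longrightarrow> (Cn (Len \<sigma>) \<cdot> (Cn (Tab \<sigma>) \<cdot> f \<cdot> n) \<^bold>= n) \<in> epra"
| seq_nth: "f \<^bold>: TNat \<Rrightarrow> \<sigma> \<Longrightarrow> n \<^bold>: TNat \<Longrightarrow> i \<^bold>: TNat
    \<Longrightarrow> (i \<^bold>< n \<^bold>\<longrightarrow> eqf \<sigma> (Cn (Nth \<sigma>) \<cdot> (Cn (Tab \<sigma>) \<cdot> f \<cdot> n) \<cdot> i) (f \<cdot> i)) \<in> epra"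
| extensionality: "f \<^bold>: \<rho> \<Rrightarrow> \<tau> \<Longrightarrow> s \<^bold>: \<rho> \<Longrightarrow> t \<^bold>: \<rho>
    \<Longrightarrow> (eqf \<rho> s t \<^bold>\<longrightarrow> eqf \<tau> (f \<cdot> s) (f \<cdot> t)) \<in> epra"
| qf_induction: "wff A \<Longrightarrow> qfree A
    \<Longrightarrow> (subst n TNat zero A \<^bold>\<longrightarrow>
         Forall n TNat (A \<^bold>\<longrightarrow> subst n TNat (suc (Var n TNat)) A) \<^bold>\<longrightarrow>
         Forall n TNat A) \<in> epra"

inductive_set qfac10 :: "fm set" where
  "wff A \<Longrightarrow> qfree A \<Longrightarrow> (F, ty2) \<notin> fv A
    \<Longrightarrow> (Forall x ty1 (Exists n TNat A) \<^bold>\<longrightarrow>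
         Exists F ty2 (Forall x ty1 (subst n TNat (Var F ty2 \<cdot> Var x ty1) A))) \<in> qfac10"

definition rca0_omega :: "fm set" where
  "rca0_omega = epra \<union> qfac10"

inductive_set st_basic :: "fm set" where
  st_eq: "s \<^bold>: \<sigma> \<Longrightarrow> t \<^bold>: \<sigma> \<Longrightarrow> (St s \<^bold>\<and> eqf \<sigma> s t \<^bold>\<longrightarrow> St t) \<in> st_basic"
| st_closed: "wt t \<Longrightarrow> fvt t = {} \<Longrightarrow> St t \<in> st_basic"
| st_app: "f \<^bold>: \<sigma> \<Rrightarrow> \<tau> \<Longrightarrow> s \<^bold>: \<sigma> \<Longrightarrow> (St f \<^bold>\<and> St s \<^bold>\<longrightarrow> St (f \<cdot> s)) \<in> st_basic"
| st_below: "m \<^bold>: TNat \<Longrightarrow> n \<^bold>: TNat \<Longrightarrow> (St n \<^bold>\<and> m \<^bold>< n \<^bold>\<longrightarrow> St m) \<in> st_basic"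

text \<open>In the next two schemata \<open>\<phi>\<close> may have parameters, and the bound variables \<open>s\<close> and \<open>F\<close> are
  automatically different from those of types \<open>\<sigma>\<close>, \<open>\<rho>\<close> and \<open>\<tau>\<close> unless excluded explicitly.\<close>

inductive_set idealization :: "fm set" where
  "wff \<phi> \<Longrightarrow> internal \<phi> \<Longrightarrow> (x, \<sigma>) \<noteq> (y, \<tau>) \<Longrightarrow> (s, TSeq \<sigma>) \<noteq> (y, \<tau>) \<Longrightarrow> (s, TSeq \<sigma>) \<notin> fv \<phi>
    \<Longrightarrow> (Forall_st s (TSeq \<sigma>) (Exists y \<tau>
           (Forall x \<sigma> (elem \<sigma> (Var x \<sigma>) (Var s (TSeq \<sigma>)) \<^bold>\<longrightarrow> \<phi>))) \<^bold>\<longrightarrow>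
         Exists y \<tau> (Forall_st x \<sigma> \<phi>)) \<in> idealization"

inductive_set hac_int :: "fm set" where
  "wff \<phi> \<Longrightarrow> internal \<phi> \<Longrightarrow> (x, \<rho>) \<noteq> (y, \<tau>) \<Longrightarrow> (F, \<rho> \<Rrightarrow> TSeq \<tau>) \<notin> fv \<phi>
    \<Longrightarrow> (Forall_st x \<rho> (Exists_st y \<tau> \<phi>) \<^bold>\<longrightarrow>
         Exists_st F (\<rho> \<Rrightarrow> TSeq \<tau>) (Forall_st x \<rho> (Exists y \<tau>
           (elem \<tau> (Var y \<tau>) (Var F (\<rho> \<Rrightarrow> TSeq \<tau>) \<cdot> Var x \<rho>) \<^bold>\<and> \<phi>)))) \<in> hac_int"

inductive_set pf_tp :: "fm set" where
  "wff \<phi> \<Longrightarrow> internal \<phi> \<Longrightarrow> fv \<phi> \<subseteq> {(x, \<tau>)}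
    \<Longrightarrow> (Forall_st x \<tau> \<phi> \<^bold>\<longrightarrow> Forall x \<tau> \<phi>) \<in> pf_tp"

text \<open>In \<open>unique_ax\<close> the formula \<open>A\<close> provably (in \<open>rca0_omega\<close>) has at most one solution.
  The relativized equality of type \<open>\<rho> \<rightarrow> \<tau>\<close> says that the constant agrees with the solution
  on all standard arguments, just as in \<open>omega_ax\<close>.\<close>

inductive_set const_ax :: "fm set" where
  omega_ax:
    "(St (Cn Omega0) \<^bold>\<and>
      Forall_st ''Xi'' ty3 (strel (fan_M (Var ''Xi'' ty3)) \<^bold>\<longrightarrow>
        Forall_st ''phi'' ty2 (Cn Omega0 \<cdot> vphi \<^bold>= Var ''Xi'' ty3 \<cdot> vphi))) \<in> const_ax"
| unique_ax:
    "wff A \<Longrightarrow> internal A \<Longrightarrow> fv A \<subseteq> {(x, \<rho> \<Rrightarrow> \<tau>)} \<Longrightarrow>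
     x \<noteq> y \<Longrightarrow> free_for x (\<rho> \<Rrightarrow> \<tau>) (Var y (\<rho> \<Rrightarrow> \<tau>)) A \<Longrightarrow>
     rca0_omega \<turnstile> Forall x (\<rho> \<Rrightarrow> \<tau>) (Forall y (\<rho> \<Rrightarrow> \<tau>)
       (A \<^bold>\<and> subst x (\<rho> \<Rrightarrow> \<tau>) (Var y (\<rho> \<Rrightarrow> \<tau>)) A \<^bold>\<longrightarrow>
        eqf (\<rho> \<Rrightarrow> \<tau>) (Var x (\<rho> \<Rrightarrow> \<tau>)) (Var y (\<rho> \<Rrightarrow> \<tau>)))) \<Longrightarrow>
     (St (Cn (UDef x \<rho> \<tau> A)) \<^bold>\<and>
      Forall_st x (\<rho> \<Rrightarrow> \<tau>) (strel A \<^bold>\<longrightarrow>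
        strel (eqf (\<rho> \<Rrightarrow> \<tau>) (Cn (UDef x \<rho> \<tau> A)) (Var x (\<rho> \<Rrightarrow> \<tau>))))) \<in> const_ax"
| lambda_ax:
    "(St (Cn Lambda0) \<^bold>\<and>
      Forall_st ''Upsilon'' ty21 (strel (fan_K (Var ''Upsilon'' ty21)) \<^bold>\<longrightarrow>
        Forall_st ''phi'' ty2 (Forall01_st ''f''
          (assoc vphi (Var ''Upsilon'' ty21 \<cdot> vphi) (seg vf (Cn Lambda0 \<cdot> vphi \<cdot> vf))
             \<^bold>= suc (vphi \<cdot> vf))))) \<in> const_ax"

definition rca0_Omega :: "fm set" where
  "rca0_Omega = rca0_omega \<union> st_basic \<union> idealization \<union> hac_int \<union> pf_tp \<union> const_ax"


section \<open>The four principles\<close>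

definition MPC :: fm where
  "MPC = Exists ''Delta'' ty21
     (Forall ''phi'' ty2 (Forall01 ''f'' (Forall01 ''g''
       (eq_upto vf vg (Var ''Delta'' ty21 \<cdot> vphi \<cdot> vf) \<^bold>\<longrightarrow> vphi \<cdot> vf \<^bold>= vphi \<cdot> vg))))"

definition PC_star :: fm where
  "PC_star = Forall_st ''phi'' ty2 (Forall01_st ''f'' (Exists_st ''k'' TNat
     (Forall01 ''g'' (eq_upto vf vg (Var ''k'' TNat) \<^bold>\<longrightarrow> vphi \<cdot> vf \<^bold>= vphi \<cdot> vg))))"

definition PC_frak :: fm where
  "PC_frak = Forall_st ''phi'' ty2 (Forall01_st ''f'' (Forall01 ''g''
     (vf \<^bold>\<approx>\<^sub>1 vg \<^bold>\<longrightarrow> vphi \<cdot> vf \<^bold>= vphi \<cdot> vg)))"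

end

theory Submission
  imports Defs "HOL-Library.Countable"
begin

text \<open>
  The four principles are closed formulas, so by a completeness theorem for the calculus it
  suffices to compare them in structures.  There the argument is that of nonstandard analysis,
  with the axioms of the theory read as properties of one structure.

  \<^item> \<open>MPC\<close> implies \<open>PC_star\<close>: that there is a modulus functional is expressed without
    parameters, so transfer yields a standard one, and its value at a standard
    \<open>(\<phi>, f)\<close> is a standard number (\<open>modulus_imp_cont\<close>).
  \<^item> \<open>PC_star\<close> implies \<open>PC_frak\<close>: all numbers below a standard number are standard
    (\<open>cont_imp_infinitesimal\<close>).  Conversely, if no standard \<open>k\<close> works at \<open>(\<phi>, f)\<close>, then any standard
    finite list of candidates is refuted by one single \<open>g\<close>, namely the one that refutes a standard
    bound of the list; idealization turns these into one \<open>g \<approx> f\<close> with \<open>\<phi>(f) \<noteq> \<phi>(g)\<close>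
    (\<open>infinitesimal_imp_cont\<close>).
  \<^item> \<open>PC_star\<close> implies \<open>MPC\<^sup>s\<^sup>t\<close>: \<open>HAC\<^sub>i\<^sub>n\<^sub>t\<close> provides a standard
    finite list of candidates for \<open>k\<close>, and a bound of the list is a modulus
    (\<open>cont_imp_st_modulus\<close>).  In \<open>MPC\<^sup>s\<^sup>t\<close> the condition \<open>f \<le>\<^sub>1 1\<close> is only required at standard
    arguments, whereas \<open>PC_star\<close> is about true 0/1-sequences.  The gap is closed by
    \<open>clip_cong\<close>: a standard \<open>\<phi>\<close> takes the same value at a standard \<open>f\<close> and at its truncation to a
    0/1-sequence, since both are values of one standard functional at infinitely close points of
    Cantor space.
  \<^item> \<open>MPC\<^sup>s\<^sup>t\<close> implies \<open>MPC\<close>: transfer allows no parameters, hence it cannot be applied to a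
    given standard modulus.  The axiom on the constant \<open>\<Lambda>\<^sub>0\<close> removes the parameter: it makes
    \<open>\<Lambda>\<^sub>0\<close> itself a modulus on standard arguments, and transfer extends this to all arguments
    (\<open>st_modulus_imp_modulus\<close>).

  Completeness is obtained by a Henkin construction (\<open>completeness\<close>).  Since equality is
  primitive at type 0 only, the term model is then divided by hereditary extensional equality;
  the extensionality axiom makes this a congruence and the axiom \<open>st(x) \<and> x = y \<rightarrow> st(y)\<close> makes
  standardness well defined.  The result (\<open>ext_completeness\<close>) is that only extensional structures
  need be considered, in which equality at every type is identity.
\<close>

section \<open>Parameters and parallel substitution\<close>

instance ty :: countable by countable_datatype
instance cnst and tm and fm :: countable by countable_datatype

text \<open>
  Following Gentzen, variables are divided into parameters, which will serve as names of the
  elements of the term model, and the remaining ones.  As long as only remaining variables are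
  bound, substituting terms built from parameters never leads to a capture, and no renaming
  of bound variables is needed.
\<close>

fun param :: "vname \<Rightarrow> bool" where
  "param [] = False"
| "param (c # _) = (c = CHR ''#'')"

fun clean :: "fm \<Rightarrow> bool" where
  "clean (A \<^bold>\<longrightarrow> B) = (clean A \<and> clean B)"
| "clean (Forall x \<sigma> A) = (\<not> param x \<and> clean A)"
| "clean (BForall x t A) = (\<not> param x \<and> clean A)"
| "clean _ = True"

fun psubst_tm :: "(vname \<times> ty \<Rightarrow> tm) \<Rightarrow> tm \<Rightarrow> tm" where
  "psubst_tm e (Var x \<sigma>) = e (x, \<sigma>)"
| "psubst_tm e (Cn c) = Cn c"
| "psubst_tm e (s \<cdot> t) = psubst_tm e s \<cdot> psubst_tm e t"

fun psubst :: "(vname \<times> ty \<Rightarrow> tm) \<Rightarrow> fm \<Rightarrow> fm" where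
  "psubst e (s \<^bold>= t) = (psubst_tm e s \<^bold>= psubst_tm e t)"
| "psubst e (St t) = St (psubst_tm e t)"
| "psubst e Bot = Bot"
| "psubst e (A \<^bold>\<longrightarrow> B) = (psubst e A \<^bold>\<longrightarrow> psubst e B)"
| "psubst e (Forall x \<sigma> A) = Forall x \<sigma> (psubst (e((x, \<sigma>) := Var x \<sigma>)) A)"
| "psubst e (BForall x t A) = BForall x (psubst_tm e t) (psubst (e((x, TNat) := Var x TNat)) A)"

definition param_terms :: "ty \<Rightarrow> tm set" where
  "param_terms \<sigma> = {t. t \<^bold>: \<sigma> \<and> (\<forall>v\<in>fvt t. param (fst v))}"

definition param_fm :: "fm \<Rightarrow> bool" where
  "param_fm A \<longleftrightarrow> wff A \<and> clean A \<and> (\<forall>v\<in>fv A. param (fst v))"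

text \<open>
  Under a quantifier the bound variable has to be kept, so a parallel substitution of parameter
  terms passes through states in which some variables are mapped to themselves.
\<close>

definition partial_psubst :: "(vname \<times> ty \<Rightarrow> tm) \<Rightarrow> bool" where
  "partial_psubst e \<longleftrightarrow> (\<forall>x \<sigma>. e (x, \<sigma>) = Var x \<sigma> \<or> e (x, \<sigma>) \<in> param_terms \<sigma>)"

definition total_psubst :: "(vname \<times> ty \<Rightarrow> tm) \<Rightarrow> bool" where
  "total_psubst e \<longleftrightarrow> (\<forall>x \<sigma>. e (x, \<sigma>) \<in> param_terms \<sigma>)"

lemma total_psubst_partial_psubst: "total_psubst e \<Longrightarrow> partial_psubst e"
  by (auto simp: total_psubst_def partial_psubst_def)

lemma partial_psubst_upd: "partial_psubst e \<Longrightarrow> partial_psubst (e((x, \<sigma>) := Var x \<sigma>))"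
  by (auto simp: partial_psubst_def)

lemma finite_fvt [simp]: "finite (fvt t)"
  by (induction t rule: fvt.induct) auto

lemma finite_fv [simp]: "finite (fv A)"
  by (induction A rule: fv.induct) auto

lemma psubst_tm_cong: "(\<And>v. v \<in> fvt t \<Longrightarrow> e v = e' v) \<Longrightarrow> psubst_tm e t = psubst_tm e' t"
  by (induction t rule: fvt.induct) auto

lemma psubst_cong: "(\<And>v. v \<in> fv A \<Longrightarrow> e v = e' v) \<Longrightarrow> psubst e A = psubst e' A"
proof (induction A arbitrary: e e' rule: fv.induct)
  case (5 x \<sigma> A)
  have "psubst (e((x, \<sigma>) := Var x \<sigma>)) A = psubst (e'((x, \<sigma>) := Var x \<sigma>)) A"
    by (rule "5.IH") (use 5 in auto)
  then show ?case by simp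
next
  case (6 x t A)
  have "psubst (e((x, TNat) := Var x TNat)) A = psubst (e'((x, TNat) := Var x TNat)) A"
    by (rule "6.IH") (use 6 in auto)
  moreover have "psubst_tm e t = psubst_tm e' t" by (rule psubst_tm_cong) (use 6 in auto)
  ultimately show ?case by simp
next
  case (4 A B)
  have "psubst e A = psubst e' A" "psubst e B = psubst e' B"
    by (rule "4.IH"; use 4 in auto)+
  then show ?case by simp
next
  case (1 s t)
  then show ?case using psubst_tm_cong[of s e e'] psubst_tm_cong[of t e e'] by simp
next
  case (2 t)
  then show ?case using psubst_tm_cong[of t e e'] by simp
qed simp

lemma psubst_tm_id: "psubst_tm (\<lambda>(x, \<sigma>). Var x \<sigma>) t = t"
  by (induction t rule: fvt.induct) auto

lemma psubst_id: "psubst (\<lambda>(x, \<sigma>). Var x \<sigma>) A = A"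
proof (induction A rule: fv.induct)
  case (5 x \<sigma> A)
  have "(\<lambda>(x, \<sigma>). Var x \<sigma>)((x, \<sigma>) := Var x \<sigma>) = (\<lambda>(x, \<sigma>). Var x \<sigma>)" by auto
  with 5 show ?case by simp
next
  case (6 x t A)
  have "(\<lambda>(x, \<sigma>). Var x \<sigma>)((x, TNat) := Var x TNat) = (\<lambda>(x, \<sigma>). Var x \<sigma>)" by auto
  with 6 show ?case by (simp add: psubst_tm_id)
qed (auto simp: psubst_tm_id)

lemma subst_tm_fresh: "(x, \<sigma>) \<notin> fvt t \<Longrightarrow> subst_tm x \<sigma> u t = t"
  by (induction t rule: fvt.induct) auto

lemma subst_psubst_tm:
  "e (x, \<sigma>) = Var x \<sigma> \<Longrightarrow> (\<And>v. v \<noteq> (x, \<sigma>) \<Longrightarrow> (x, \<sigma>) \<notin> fvt (e v)) \<Longrightarrow>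
   subst_tm x \<sigma> u (psubst_tm e t) = psubst_tm (e((x, \<sigma>) := u)) t"
  by (induction t rule: fvt.induct) (auto simp: subst_tm_fresh)

text \<open>
  A single substitution after a parallel one that keeps \<open>x\<close> merges into it.  The second premise
  says that no other variable has been replaced by a term in which \<open>x\<close> occurs.
\<close>

lemma subst_psubst:
  "e (x, \<sigma>) = Var x \<sigma> \<Longrightarrow> (\<And>v. v \<noteq> (x, \<sigma>) \<Longrightarrow> (x, \<sigma>) \<notin> fvt (e v)) \<Longrightarrow>
   subst x \<sigma> u (psubst e A) = psubst (e((x, \<sigma>) := u)) A"
proof (induction A arbitrary: e rule: fv.induct)
  case (5 y \<tau> A)
  show ?case
  proof (cases "x = y \<and> \<sigma> = \<tau>")
    case False
    have "subst x \<sigma> u (psubst (e((y, \<tau>) := Var y \<tau>)) A)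
        = psubst ((e((y, \<tau>) := Var y \<tau>))((x, \<sigma>) := u)) A"
      by (rule "5.IH") (use 5 False in auto)
    also have "(e((y, \<tau>) := Var y \<tau>))((x, \<sigma>) := u) = (e((x, \<sigma>) := u))((y, \<tau>) := Var y \<tau>)"
      using False by (intro fun_upd_twist) auto
    finally have "subst x \<sigma> u (psubst e (Forall y \<tau> A))
        = Forall y \<tau> (psubst ((e((x, \<sigma>) := u))((y, \<tau>) := Var y \<tau>)) A)"
      using False by (simp only: psubst.simps subst.simps if_False)
    then show ?thesis by (simp only: psubst.simps)
  next
    case True
    then show ?thesis by (simp only: psubst.simps subst.simps if_True fun_upd_upd simp_thms)
  qed
next
  case (6 y t A)
  have t: "subst_tm x \<sigma> u (psubst_tm e t) = psubst_tm (e((x, \<sigma>) := u)) t"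
    by (rule subst_psubst_tm) (use 6 in auto)
  show ?case
  proof (cases "x = y \<and> \<sigma> = TNat")
    case True
    then show ?thesis using t
      by (simp only: psubst.simps subst.simps if_True fun_upd_upd simp_thms)
  next
    case False
    have "subst x \<sigma> u (psubst (e((y, TNat) := Var y TNat)) A)
        = psubst ((e((y, TNat) := Var y TNat))((x, \<sigma>) := u)) A"
      by (rule "6.IH") (use 6 False in auto)
    also have "(e((y, TNat) := Var y TNat))((x, \<sigma>) := u) = (e((x, \<sigma>) := u))((y, TNat) := Var y TNat)"
      using False by (intro fun_upd_twist) auto
    finally have "subst x \<sigma> u (psubst e (BForall y t A))
        = BForall y (psubst_tm (e((x, \<sigma>) := u)) t) (psubst ((e((x, \<sigma>) := u))((y, TNat) := Var y TNat)) A)"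
      using False t by (simp only: psubst.simps subst.simps if_False)
    then show ?thesis by (simp only: psubst.simps)
  qed
next
  case (1 s t)
  then have "\<And>t. subst_tm x \<sigma> u (psubst_tm e t) = psubst_tm (e((x, \<sigma>) := u)) t"
    by (intro subst_psubst_tm)
  then show ?case by (simp only: psubst.simps subst.simps)
next
  case (2 t)
  then have "\<And>t. subst_tm x \<sigma> u (psubst_tm e t) = psubst_tm (e((x, \<sigma>) := u)) t"
    by (intro subst_psubst_tm)
  then show ?case by (simp only: psubst.simps subst.simps)
next
  case (4 A B)
  then show ?case by (metis psubst.simps(4) subst.simps(4))
qed simp

lemma clean_psubst [simp]: "clean (psubst e A) = clean A"
  by (induction A arbitrary: e rule: fv.induct) auto

lemma fvt_psubst_tm: "fvt (psubst_tm e t) = (\<Union>v\<in>fvt t. fvt (e v))"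
  by (induction t rule: fvt.induct) auto

lemma fv_psubst: "fv (psubst e A) \<subseteq> (\<Union>v\<in>fv A. fvt (e v))"
proof (induction A arbitrary: e rule: fv.induct)
  case (5 x \<sigma> A)
  show ?case using "5.IH"[of "e((x, \<sigma>) := Var x \<sigma>)"] by (fastforce split: if_splits)
next
  case (6 x t A)
  show ?case using "6.IH"[of "e((x, TNat) := Var x TNat)"] by (fastforce simp: fvt_psubst_tm split: if_splits)
next
  case (4 A B)
  show ?case using "4.IH"(1)[of e] "4.IH"(2)[of e] by auto
qed (auto simp: fvt_psubst_tm)

lemma psubst_tm_has_ty: "wt t \<Longrightarrow> (\<And>x \<sigma>. e (x, \<sigma>) \<^bold>: \<sigma>) \<Longrightarrow> psubst_tm e t \<^bold>: ty_of t"
proof (induction t rule: fvt.induct)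
  case (3 s t)
  then obtain \<tau> where "ty_of s = ty_of t \<Rrightarrow> \<tau>" by auto
  with 3 show ?case by (auto simp: has_ty_def)
qed (auto simp: has_ty_def)

lemma partial_psubst_ty: "partial_psubst e \<Longrightarrow> e (x, \<sigma>) \<^bold>: \<sigma>"
  unfolding partial_psubst_def param_terms_def has_ty_def
  by (drule spec[of _ x], drule spec[of _ \<sigma>]) auto

lemma psubst_tm_partial_psubst_ty: "t \<^bold>: \<tau> \<Longrightarrow> partial_psubst e \<Longrightarrow> psubst_tm e t \<^bold>: \<tau>"
  using psubst_tm_has_ty[of t e] partial_psubst_ty[of e] by (auto simp: has_ty_def)

lemma wff_psubst: "wff A \<Longrightarrow> clean A \<Longrightarrow> partial_psubst e \<Longrightarrow> wff (psubst e A)"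
proof (induction A arbitrary: e rule: fv.induct)
  case (6 x t A)
  have "(x, TNat) \<notin> fvt (psubst_tm e t)"
  proof
    assume "(x, TNat) \<in> fvt (psubst_tm e t)"
    then obtain y \<tau> where y: "(y, \<tau>) \<in> fvt t" "(x, TNat) \<in> fvt (e (y, \<tau>))"
      by (auto simp: fvt_psubst_tm)
    have "e (y, \<tau>) = Var y \<tau> \<or> e (y, \<tau>) \<in> param_terms \<tau>" using 6 by (simp add: partial_psubst_def)
    then show False using y 6 by (auto simp: param_terms_def)
  qed
  with 6 show ?case by (auto intro: psubst_tm_partial_psubst_ty partial_psubst_upd)
qed (auto intro: psubst_tm_partial_psubst_ty partial_psubst_upd psubst_tm_has_ty[unfolded has_ty_def, THEN conjunct1] simp: partial_psubst_ty[unfolded has_ty_def])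

lemma psubst_tm_param_terms: "t \<^bold>: \<sigma> \<Longrightarrow> total_psubst e \<Longrightarrow> psubst_tm e t \<in> param_terms \<sigma>"
  using psubst_tm_partial_psubst_ty[OF _ total_psubst_partial_psubst, of t \<sigma> e]
  by (fastforce simp: param_terms_def total_psubst_def fvt_psubst_tm)

lemma param_fm_psubst: "wff A \<Longrightarrow> clean A \<Longrightarrow> total_psubst e \<Longrightarrow> param_fm (psubst e A)"
  using fv_psubst[of e A] by (fastforce simp: param_fm_def wff_psubst total_psubst_partial_psubst total_psubst_def param_terms_def)

lemma free_for_param_term: "clean A \<Longrightarrow> u \<in> param_terms \<sigma> \<Longrightarrow> free_for x \<tau> u A"
  by (induction A rule: fv.induct) (auto simp: param_terms_def)

lemma subst_tm_back:
  "(c, \<sigma>) \<notin> fvt t \<Longrightarrow> subst_tm c \<sigma> (Var x \<sigma>) (subst_tm x \<sigma> (Var c \<sigma>) t) = t"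
  by (induction t rule: fvt.induct) auto

lemma subst_fresh: "(x, \<sigma>) \<notin> fv A \<Longrightarrow> subst x \<sigma> u A = A"
  by (induction A rule: fv.induct) (auto simp: subst_tm_fresh)

lemma fvt_subst_tm: "fvt (subst_tm x \<sigma> u t) \<subseteq> (fvt t - {(x, \<sigma>)}) \<union> fvt u"
  by (induction t rule: fvt.induct) auto

text \<open>
  This undoes the choice of a witness: from \<open>A(c)\<close> for a new parameter \<open>c\<close> one gets back to
  \<open>A(x)\<close>.  Well-formedness excludes bounded quantifiers whose variable occurs in their own bound;
  there \<open>c\<close> would occur in the bound and block the substitution.
\<close>

lemma subst_back:
  "wff A \<Longrightarrow> clean A \<Longrightarrow> param c \<Longrightarrow> (c, \<sigma>) \<notin> fv A \<Longrightarrow>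
   subst c \<sigma> (Var x \<sigma>) (subst x \<sigma> (Var c \<sigma>) A) = A \<and>
   free_for c \<sigma> (Var x \<sigma>) (subst x \<sigma> (Var c \<sigma>) A)"
proof (induction A rule: fv.induct)
  case (5 y \<tau> A)
  then have c: "(c, \<sigma>) \<noteq> (y, \<tau>)" "(c, \<sigma>) \<notin> fv A" by auto
  show ?case
  proof (cases "x = y \<and> \<sigma> = \<tau>")
    case True
    with c show ?thesis by (auto simp: subst_fresh)
  next
    case False
    moreover have "subst c \<sigma> (Var x \<sigma>) (subst x \<sigma> (Var c \<sigma>) A) = A \<and>
        free_for c \<sigma> (Var x \<sigma>) (subst x \<sigma> (Var c \<sigma>) A)"
      using "5.IH" "5.prems" c by simp
    ultimately show ?thesis using c by auto
  qed
next
  case (6 y t A)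
  then have c: "(c, \<sigma>) \<noteq> (y, TNat)" "(c, \<sigma>) \<notin> fv A" "(c, \<sigma>) \<notin> fvt t" by auto
  have t: "subst_tm c \<sigma> (Var x \<sigma>) (subst_tm x \<sigma> (Var c \<sigma>) t) = t"
    using c by (simp add: subst_tm_back)
  show ?case
  proof (cases "x = y \<and> \<sigma> = TNat")
    case True
    with "6.prems" c t show ?thesis by (auto simp: subst_fresh subst_tm_fresh)
  next
    case False
    moreover have "subst c \<sigma> (Var x \<sigma>) (subst x \<sigma> (Var c \<sigma>) A) = A \<and>
        free_for c \<sigma> (Var x \<sigma>) (subst x \<sigma> (Var c \<sigma>) A)"
      using "6.IH" "6.prems" c by simp
    ultimately show ?thesis using c t by auto
  qed
qed (auto simp: subst_tm_back)

text \<open>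
  The free variables of theorems are implicitly universal.  They are instantiated one after the
  other, which amounts to parallel substitution because the terms inserted contain parameters
  only, and these do not occur in \<open>A\<close>.
\<close>

lemma nd_generalize:
  assumes "nd T {} A" "partial_psubst e" "clean A" "\<forall>v\<in>fv A. \<not> param (fst v)"
  shows "nd T {} (psubst e A)"
proof -
  have *: "nd T {} (psubst (\<lambda>v. if v \<in> V then e v else Var (fst v) (snd v)) A)" if "finite V" for V
    using that
  proof induction
    case empty
    have "(\<lambda>v. Var (fst v) (snd v)) = (\<lambda>(x, \<sigma>). Var x \<sigma>)" by auto
    with assms(1) show ?case by (simp add: psubst_id)
  next
    case (insert v V)
    obtain x \<sigma> where v: "v = (x, \<sigma>)" by force
    define e' where "e' = (\<lambda>v. if v \<in> V then e v else Var (fst v) (snd v))"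
    have e': "nd T {} (psubst e' A)" using insert unfolding e'_def by simp
    have up: "(\<lambda>w. if w \<in> insert v V then e w else Var (fst w) (snd w)) = e'((x, \<sigma>) := e (x, \<sigma>))"
      by (auto simp: e'_def v)
    show ?case
    proof (cases "e (x, \<sigma>) = Var x \<sigma> \<or> (x, \<sigma>) \<notin> fv A")
      case True
      then have "psubst (e'((x, \<sigma>) := e (x, \<sigma>))) A = psubst e' A"
        using insert v by (intro psubst_cong) (auto simp: e'_def)
      then show ?thesis unfolding up using e' by simp
    next
      case False
      then have px: "e (x, \<sigma>) \<in> param_terms \<sigma>" and npx: "\<not> param x"
        using assms by (auto simp: partial_psubst_def)
      have "nd T {} (subst x \<sigma> (e (x, \<sigma>)) (psubst e' A))"
        by (rule nd.allE[OF nd.allI[OF e']])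
          (use px assms free_for_param_term in \<open>auto simp: param_terms_def\<close>)
      also have "subst x \<sigma> (e (x, \<sigma>)) (psubst e' A) = psubst (e'((x, \<sigma>) := e (x, \<sigma>))) A"
      proof (rule subst_psubst)
        show "e' (x, \<sigma>) = Var x \<sigma>" using insert v by (simp add: e'_def)
        fix w assume w: "w \<noteq> (x, \<sigma>)"
        obtain y \<tau> where y: "w = (y, \<tau>)" by force
        have "e (y, \<tau>) = Var y \<tau> \<or> e (y, \<tau>) \<in> param_terms \<tau>" using assms by (simp add: partial_psubst_def)
        then show "(x, \<sigma>) \<notin> fvt (e' w)"
          using w npx y by (auto simp: e'_def param_terms_def)
      qed
      finally show ?thesis unfolding up .
    qed
  qed
  have "psubst (\<lambda>v. if v \<in> fv A then e v else Var (fst v) (snd v)) A = psubst e A"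
    by (rule psubst_cong) simp
  with *[of "fv A"] show ?thesis by simp
qed

section \<open>Structures\<close>

text \<open>
  Application is an arbitrary operation, so that terms can serve as elements, and type-0 equality
  is an arbitrary relation, since in the term model it will be provable equality.
\<close>

record 'a struct =
  Dom :: "ty \<Rightarrow> 'a set"
  Ap :: "'a \<Rightarrow> 'a \<Rightarrow> 'a"
  Con :: "cnst \<Rightarrow> 'a"
  EqR :: "'a \<Rightarrow> 'a \<Rightarrow> bool"
  StR :: "'a \<Rightarrow> bool"

fun val :: "'a struct \<Rightarrow> (vname \<times> ty \<Rightarrow> 'a) \<Rightarrow> tm \<Rightarrow> 'a" where
  "val M e (Var x \<sigma>) = e (x, \<sigma>)"
| "val M e (Cn c) = Con M c"
| "val M e (s \<cdot> t) = Ap M (val M e s) (val M e t)"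

text \<open>
  The value of the formula \<open>x < y\<close>, which the bounded quantifier refers to.
\<close>

definition mlt :: "'a struct \<Rightarrow> 'a \<Rightarrow> 'a \<Rightarrow> bool" where
  "mlt M a b = EqR M
     (val M (\<lambda>v. if fst v = ''x'' then a else b) (monus (suc (Var ''x'' TNat)) (Var ''y'' TNat)))
     (Con M Zero)"

fun sat :: "'a struct \<Rightarrow> (vname \<times> ty \<Rightarrow> 'a) \<Rightarrow> fm \<Rightarrow> bool" where
  "sat M e (s \<^bold>= t) = EqR M (val M e s) (val M e t)"
| "sat M e (St t) = StR M (val M e t)"
| "sat M e Bot = False"
| "sat M e (A \<^bold>\<longrightarrow> B) = (sat M e A \<longrightarrow> sat M e B)"
| "sat M e (Forall x \<sigma> A) = (\<forall>a\<in>Dom M \<sigma>. sat M (e((x, \<sigma>) := a)) A)"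
| "sat M e (BForall x t A) =
     (\<forall>a\<in>Dom M TNat. mlt M a (val M e t) \<longrightarrow> sat M (e((x, TNat) := a)) A)"

definition env :: "'a struct \<Rightarrow> (vname \<times> ty \<Rightarrow> 'a) \<Rightarrow> bool" where
  "env M e \<longleftrightarrow> (\<forall>x \<sigma>. e (x, \<sigma>) \<in> Dom M \<sigma>)"

text \<open>
  Domains of different types are disjoint, so that the type of an element, and hence its
  equivalence class under extensional equality, is determined by the element.
\<close>

definition typed_struct :: "'a struct \<Rightarrow> bool" where
  "typed_struct M \<longleftrightarrow>
     (\<forall>\<sigma> \<tau>. \<forall>f\<in>Dom M (\<sigma> \<Rrightarrow> \<tau>). \<forall>a\<in>Dom M \<sigma>. Ap M f a \<in> Dom M \<tau>) \<and>
     (\<forall>c. Con M c \<in> Dom M (ty_cn c)) \<and>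
     (\<forall>\<sigma> \<tau>. \<forall>a\<in>Dom M \<sigma>. a \<in> Dom M \<tau> \<longrightarrow> \<sigma> = \<tau>)"

definition no_params :: "fm \<Rightarrow> bool" where
  "no_params A \<longleftrightarrow> clean A \<and> (\<forall>v\<in>fv A. \<not> param (fst v))"

text \<open>
  Only axioms in which no parameter occurs are asked for.  From these the calculus derives all
  substitution instances with parameter terms, which is what makes them true in the term model.
\<close>

definition models :: "'a struct \<Rightarrow> fm set \<Rightarrow> bool" where
  "models M T \<longleftrightarrow> (\<forall>A\<in>T. \<forall>e. wff A \<longrightarrow> no_params A \<longrightarrow> env M e \<longrightarrow> sat M e A)"

lemma env_upd [simp]: "env M e \<Longrightarrow> a \<in> Dom M \<sigma> \<Longrightarrow> env M (e((x, \<sigma>) := a))"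
  by (auto simp: env_def)

section \<open>Completeness by a Henkin construction\<close>

definition new_param :: "fm set \<Rightarrow> vname" where
  "new_param \<Gamma> = (SOME c. param c \<and> (\<forall>B\<in>\<Gamma>. \<forall>\<sigma>. (c, \<sigma>) \<notin> fv B))"

lemma new_param:
  assumes "finite \<Gamma>"
  shows "param (new_param \<Gamma>)" "B \<in> \<Gamma> \<Longrightarrow> (new_param \<Gamma>, \<sigma>) \<notin> fv B"
proof -
  have "infinite (range (\<lambda>n. replicate (Suc n) (CHR ''#'')))"
    by (auto simp: inj_def dest!: finite_imageD dest: arg_cong[of _ _ length])
  moreover have "range (\<lambda>n. replicate (Suc n) (CHR ''#'')) \<subseteq> {c. param c}" by auto
  ultimately have "infinite {c. param c}" using finite_subset by blast
  moreover have "finite (fst ` (\<Union>B\<in>\<Gamma>. fv B))" using assms by auto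
  ultimately have "\<exists>c. c \<in> {c. param c} - fst ` (\<Union>B\<in>\<Gamma>. fv B)"
    by (metis Diff_infinite_finite ex_in_conv finite.emptyI)
  then have "\<exists>c. param c \<and> (\<forall>B\<in>\<Gamma>. \<forall>\<sigma>. (c, \<sigma>) \<notin> fv B)" by force
  from someI_ex[OF this] show "param (new_param \<Gamma>)" "B \<in> \<Gamma> \<Longrightarrow> (new_param \<Gamma>, \<sigma>) \<notin> fv B"
    unfolding new_param_def by auto
qed

lemma wff_lt [simp]: "wff (s \<^bold>< t) \<longleftrightarrow> s \<^bold>: TNat \<and> t \<^bold>: TNat"
  by (auto simp: lt_def le_def monus_def pred_def has_ty_def split: ty.splits)

text \<open>
  A finite consistent set of parameter formulas is extended in stages that decide one formula
  after the other.  All stages are finite, so new parameters never run out.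
\<close>

locale henkin =
  fixes T :: "fm set" and \<Gamma>\<^sub>0 :: "fm set"
  assumes finite_start: "finite \<Gamma>\<^sub>0" and param_fm_start: "\<forall>B\<in>\<Gamma>\<^sub>0. param_fm B"
    and con_start: "\<not> nd T \<Gamma>\<^sub>0 Bot"
begin

fun witness :: "fm set \<Rightarrow> fm \<Rightarrow> fm set" where
  "witness \<Gamma> (Forall x \<sigma> B) = {\<^bold>\<not> subst x \<sigma> (Var (new_param (insert B \<Gamma>)) \<sigma>) B}"
| "witness \<Gamma> _ = {}"

definition extend :: "fm set \<Rightarrow> fm \<Rightarrow> fm set" where
  "extend \<Gamma> A = (if \<not> param_fm A then \<Gamma> else if \<not> nd T (insert A \<Gamma>) Bot then insert A \<Gamma>
     else insert (\<^bold>\<not> A) (witness \<Gamma> A \<union> \<Gamma>))"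

fun stage :: "nat \<Rightarrow> fm set" where
  "stage 0 = \<Gamma>\<^sub>0"
| "stage (Suc n) = extend (stage n) (from_nat n)"

lemma subst_as_psubst: "subst x \<sigma> u A = psubst ((\<lambda>(x, \<sigma>). Var x \<sigma>)((x, \<sigma>) := u)) A"
proof -
  have "subst x \<sigma> u (psubst (\<lambda>(x, \<sigma>). Var x \<sigma>) A) = psubst ((\<lambda>(x, \<sigma>). Var x \<sigma>)((x, \<sigma>) := u)) A"
    by (rule subst_psubst) auto
  then show ?thesis by (simp only: psubst_id)
qed

lemma param_fm_subst:
  assumes "param_fm (Forall x \<sigma> B)" "u \<in> param_terms \<sigma>"
  shows "param_fm (subst x \<sigma> u B)"
proof -
  let ?e = "(\<lambda>(x, \<sigma>). Var x \<sigma>)((x, \<sigma>) := u)"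
  have "partial_psubst ?e" using assms by (auto simp: partial_psubst_def)
  then have "wff (psubst ?e B)" using assms by (intro wff_psubst) (auto simp: param_fm_def)
  moreover have "param (fst v)" if "v \<in> fv (psubst ?e B)" for v
  proof -
    from subsetD[OF fv_psubst that] obtain w where "w \<in> fv B" "v \<in> fvt (?e w)"
      by (elim UN_E)
    show ?thesis
    proof (cases "w = (x, \<sigma>)")
      case True
      then show ?thesis using assms \<open>v \<in> fvt (?e w)\<close> by (simp add: param_terms_def)
    next
      case False
      obtain y \<tau> where "w = (y, \<tau>)" by force
      then have "v = w" using False \<open>v \<in> fvt (?e w)\<close> by (simp split: if_splits)
      then show ?thesis using assms False \<open>w \<in> fv B\<close> by (simp add: param_fm_def)
    qed
  qed
  ultimately show ?thesis using assms unfolding subst_as_psubst by (simp add: param_fm_def)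
qed

lemma var_param_term: "param c \<Longrightarrow> Var c \<sigma> \<in> param_terms \<sigma>"
  by (simp add: param_terms_def has_ty_def)

lemma witness_cases:
  obtains "witness \<Gamma> A = {}" | x \<sigma> B where "A = Forall x \<sigma> B"
  by (cases A) auto

lemma extend_finite_param_fm:
  assumes "finite \<Gamma>" "\<forall>B\<in>\<Gamma>. param_fm B"
  shows "finite (extend \<Gamma> A) \<and> (\<forall>B\<in>extend \<Gamma> A. param_fm B)"
proof (cases "param_fm A")
  case True
  have "finite (witness \<Gamma> A) \<and> (\<forall>B\<in>witness \<Gamma> A. param_fm B)"
  proof (rule witness_cases[of \<Gamma> A])
    fix x \<sigma> B assume A: "A = Forall x \<sigma> B"
    have "param_fm (subst x \<sigma> (Var (new_param (insert B \<Gamma>)) \<sigma>) B)"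
      using True A assms new_param(1)[of "insert B \<Gamma>"] by (intro param_fm_subst var_param_term) auto
    then show ?thesis using A by (auto simp: param_fm_def)
  qed auto
  moreover have "param_fm (\<^bold>\<not> A)" using True by (simp add: param_fm_def)
  ultimately show ?thesis using assms True by (auto simp: extend_def)
qed (use assms in \<open>simp add: extend_def\<close>)

lemma nd_cut: "nd T (insert A \<Gamma>) B \<Longrightarrow> wff A \<Longrightarrow> nd T \<Gamma> A \<Longrightarrow> nd T \<Gamma> B"
  by (blast intro: nd.impI nd.impE)

text \<open>
  The only delicate case is a refuted \<open>\<forall>x B\<close>: if the negated instance \<open>\<not> B(c)\<close> at a new
  parameter \<open>c\<close> led to a contradiction, then \<open>B(c)\<close>, hence \<open>\<forall>c B(c)\<close>, hence \<open>\<forall>x B\<close> would be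
  derivable, against the refutation.
\<close>

lemma extend_con:
  assumes fin: "finite \<Gamma>" and p: "\<forall>B\<in>\<Gamma>. param_fm B" and con: "\<not> nd T \<Gamma> Bot"
  shows "\<not> nd T (extend \<Gamma> A) Bot"
proof (cases "param_fm A \<and> nd T (insert A \<Gamma>) Bot")
  case True
  then have wA: "wff A" and nA: "nd T \<Gamma> (\<^bold>\<not> A)" by (auto simp: param_fm_def intro: nd.impI)
  have con': "\<not> nd T (insert (\<^bold>\<not> A) \<Gamma>) Bot"
    using con nd_cut[OF _ _ nA] wA by auto
  show ?thesis
  proof (rule witness_cases[of \<Gamma> A])
    assume "witness \<Gamma> A = {}"
    then show ?thesis using True con' by (simp add: extend_def)
  next
    fix x \<sigma> B assume A: "A = Forall x \<sigma> B"
    define c where "c = new_param (insert B \<Gamma>)"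
    have c: "param c" "(c, \<sigma>) \<notin> fv B" "\<And>C. C \<in> \<Gamma> \<Longrightarrow> (c, \<sigma>) \<notin> fv C"
      using new_param[of "insert B \<Gamma>"] fin by (auto simp: c_def)
    let ?Bc = "subst x \<sigma> (Var c \<sigma>) B"
    have pBc: "param_fm ?Bc" using True A c var_param_term by (auto intro: param_fm_subst)
    have B: "wff B" "clean B" "\<not> param x" using True A by (auto simp: param_fm_def)
    show ?thesis
    proof
      assume "nd T (extend \<Gamma> A) Bot"
      then have "nd T (insert (\<^bold>\<not> ?Bc) (insert (\<^bold>\<not> A) \<Gamma>)) Bot"
        using True A by (simp add: extend_def c_def insert_commute)
      then have "nd T (insert (\<^bold>\<not> A) \<Gamma>) ?Bc" using pBc by (auto simp: param_fm_def intro: nd.contr)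
      then have 1: "nd T \<Gamma> ?Bc" using nd_cut[OF _ _ nA] wA by auto
      have "nd T \<Gamma> (Forall c \<sigma> ?Bc)" by (rule nd.allI[OF 1]) (use c in auto)
      then have "nd T \<Gamma> (subst c \<sigma> (Var x \<sigma>) ?Bc)"
        by (rule nd.allE) (use subst_back[OF B(1,2) c(1,2)] in \<open>auto simp: has_ty_def\<close>)
      then have "nd T \<Gamma> B" using subst_back[OF B(1,2) c(1,2)] by simp
      then have "nd T \<Gamma> A" unfolding A
        by (rule nd.allI) (use p B in \<open>force simp: param_fm_def\<close>)
      then show False using nA con nd.impE by blast
    qed
  qed
qed (use con in \<open>auto simp: extend_def\<close>)

lemma stage_inv: "finite (stage n) \<and> (\<forall>B\<in>stage n. param_fm B) \<and> \<not> nd T (stage n) Bot"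
proof (induction n)
  case 0
  show ?case using finite_start param_fm_start con_start by simp
next
  case (Suc n)
  then show ?case using extend_finite_param_fm[of "stage n" "from_nat n"] extend_con[of "stage n" "from_nat n"]
    by simp
qed

lemma stage_mono: "m \<le> n \<Longrightarrow> stage m \<subseteq> stage n"
  by (rule lift_Suc_mono_le[of stage]) (auto simp: extend_def)

text \<open>
  Truth in the limit.  It is defined by derivability from finite stages rather than from their
  union, because every parameter occurs free in the union and \<open>nd.allI\<close> would be useless there.
\<close>

definition tr :: "fm \<Rightarrow> bool" where
  "tr A \<longleftrightarrow> (\<exists>n. nd T (stage n) A)"

lemma tr_hyp: "A \<in> stage n \<Longrightarrow> tr A"
  using stage_inv[of n] by (auto simp: tr_def param_fm_def intro: nd.hyp)

lemma tr_mp: "tr (A \<^bold>\<longrightarrow> B) \<Longrightarrow> tr A \<Longrightarrow> tr B"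
proof -
  assume "tr (A \<^bold>\<longrightarrow> B)" "tr A"
  then obtain m n where "nd T (stage m) (A \<^bold>\<longrightarrow> B)" "nd T (stage n) A" by (auto simp: tr_def)
  then have "nd T (stage (max m n)) (A \<^bold>\<longrightarrow> B)" "nd T (stage (max m n)) A"
    by (auto elim!: nd.weaken intro!: stage_mono)
  then show "tr B" unfolding tr_def by (blast intro: nd.impE)
qed

lemma tr_nd: "nd T {} A \<Longrightarrow> tr A"
  by (auto simp: tr_def intro: nd.weaken)

lemma tr_Bot [simp]: "\<not> tr Bot"
  using stage_inv by (auto simp: tr_def)

text \<open>
  The stage reached after treating the formula with the number of \<open>A\<close> contains \<open>A\<close> or its negation
  together with a witness.
\<close>

lemma tr_decide: "param_fm A \<Longrightarrow> tr A \<or> tr (\<^bold>\<not> A) \<and> (\<forall>B\<in>witness (stage (to_nat A)) A. tr B)"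
  using tr_hyp[of _ "Suc (to_nat A)"] by (cases "nd T (insert A (stage (to_nat A))) Bot") (auto simp: extend_def)

lemma tr_Imp:
  assumes "param_fm (A \<^bold>\<longrightarrow> B)"
  shows "tr (A \<^bold>\<longrightarrow> B) \<longleftrightarrow> (tr A \<longrightarrow> tr B)"
proof
  assume *: "tr A \<longrightarrow> tr B"
  have p: "param_fm A" "wff A" "wff B" using assms by (auto simp: param_fm_def)
  consider "tr B" | "tr (\<^bold>\<not> A)" using * tr_decide[OF p(1)] by blast
  then show "tr (A \<^bold>\<longrightarrow> B)"
  proof cases
    case 1
    then obtain n where "nd T (stage n) B" by (auto simp: tr_def)
    then show ?thesis unfolding tr_def using p by (blast intro: nd.impI nd.weaken)
  next
    case 2
    then obtain n where n: "nd T (stage n) (\<^bold>\<not> A)" by (auto simp: tr_def)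
    have "nd T (insert (\<^bold>\<not> B) (insert A (stage n))) Bot"
      by (rule nd.impE[of _ _ A]) (auto intro: nd.weaken[OF n] nd.hyp p)
    then show ?thesis unfolding tr_def using p by (blast intro: nd.impI nd.contr)
  qed
qed (use tr_mp in blast)

lemma tr_Forall:
  assumes "param_fm (Forall x \<sigma> A)"
  shows "tr (Forall x \<sigma> A) \<longleftrightarrow> (\<forall>t\<in>param_terms \<sigma>. tr (subst x \<sigma> t A))"
proof
  assume "tr (Forall x \<sigma> A)"
  then show "\<forall>t\<in>param_terms \<sigma>. tr (subst x \<sigma> t A)"
    using assms free_for_param_term unfolding tr_def
    by (auto simp: param_fm_def param_terms_def intro!: nd.allE)
next
  assume *: "\<forall>t\<in>param_terms \<sigma>. tr (subst x \<sigma> t A)"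
  show "tr (Forall x \<sigma> A)"
  proof (rule ccontr)
    let ?S = "stage (to_nat (Forall x \<sigma> A))"
    let ?c = "new_param (insert A ?S)"
    assume "\<not> tr (Forall x \<sigma> A)"
    then have "tr (\<^bold>\<not> subst x \<sigma> (Var ?c \<sigma>) A)" using tr_decide[OF assms] by auto
    moreover have "Var ?c \<sigma> \<in> param_terms \<sigma>" using stage_inv new_param(1) by (simp add: var_param_term)
    ultimately show False using * tr_mp tr_Bot by blast
  qed
qed

text \<open>
  The term model: its elements of type \<open>\<sigma>\<close> are the terms of type \<open>\<sigma>\<close> whose variables are parameters.
\<close>

definition M :: "tm struct" where
  "M = \<lparr>Dom = param_terms, Ap = App, Con = Cn, EqR = (\<lambda>s t. tr (s \<^bold>= t)), StR = (\<lambda>t. tr (St t))\<rparr>"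

lemma M_simps [simp]: "Dom M = param_terms" "Ap M = App" "Con M = Cn"
  "EqR M s t = tr (s \<^bold>= t)" "StR M t = tr (St t)"
  by (auto simp: M_def)

lemma val_M: "val M e t = psubst_tm e t"
  by (induction t rule: fvt.induct) auto

lemma mlt_M: "mlt M s t \<longleftrightarrow> tr (s \<^bold>< t)"
  by (simp add: mlt_def lt_def le_def monus_def pred_def)

lemma typed_M: "typed_struct M"
  by (auto simp: typed_struct_def param_terms_def has_ty_def)

lemma env_M: "env M e \<longleftrightarrow> total_psubst e"
  by (simp add: env_def total_psubst_def)

lemma subst_psubst_total_psubst:
  assumes "total_psubst e" "\<not> param x"
  shows "subst x \<sigma> u (psubst (e((x, \<sigma>) := Var x \<sigma>)) A) = psubst (e((x, \<sigma>) := u)) A"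
proof -
  have "(x, \<sigma>) \<notin> fvt (e v)" for v using assms by (cases v) (force simp: total_psubst_def param_terms_def)
  then show ?thesis using subst_psubst[of "e((x, \<sigma>) := Var x \<sigma>)" x \<sigma> u A] by simp
qed

text \<open>
  Satisfaction in the term model is provability in the limit of the formula with its
  variables replaced.  The bounded quantifier is reduced to the unbounded one by the
  two rules that define it.
\<close>

lemma truth: "wff A \<Longrightarrow> clean A \<Longrightarrow> total_psubst e \<Longrightarrow> sat M e A \<longleftrightarrow> tr (psubst e A)"
proof (induction A arbitrary: e rule: fv.induct)
  case (4 A B)
  then show ?case using tr_Imp[of "psubst e A" "psubst e B"] param_fm_psubst[of "A \<^bold>\<longrightarrow> B" e] by simp
next
  case (5 x \<sigma> A)
  have "total_psubst (e((x, \<sigma>) := t))" if "t \<in> param_terms \<sigma>" for t using 5 that by (simp add: total_psubst_def)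
  then have "sat M e (Forall x \<sigma> A) \<longleftrightarrow> (\<forall>t\<in>param_terms \<sigma>. tr (psubst (e((x, \<sigma>) := t)) A))"
    using 5 by (simp del: fun_upd_apply)
  also have "\<dots> \<longleftrightarrow> (\<forall>t\<in>param_terms \<sigma>. tr (subst x \<sigma> t (psubst (e((x, \<sigma>) := Var x \<sigma>)) A)))"
    using 5 by (simp add: subst_psubst_total_psubst del: fun_upd_apply)
  also have "\<dots> \<longleftrightarrow> tr (psubst e (Forall x \<sigma> A))"
    using tr_Forall[of x \<sigma> "psubst (e((x, \<sigma>) := Var x \<sigma>)) A"] param_fm_psubst[of "Forall x \<sigma> A" e] 5 by simp
  finally show ?case .
next
  case (6 x t A)
  let ?A = "psubst (e((x, TNat) := Var x TNat)) A"
  let ?C = "Forall x TNat (Var x TNat \<^bold>< psubst_tm e t \<^bold>\<longrightarrow> ?A)"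
  have p: "total_psubst (e((x, TNat) := u))" if "u \<in> param_terms TNat" for u using 6 that by (simp add: total_psubst_def)
  have t: "psubst_tm e t \<in> param_terms TNat" using 6 by (intro psubst_tm_param_terms) auto
  then have x: "(x, TNat) \<notin> fvt (psubst_tm e t)" using 6 by (auto simp: param_terms_def)
  have wA: "wff ?A" using 6 by (intro wff_psubst partial_psubst_upd total_psubst_partial_psubst) auto
  have pA: "param_fm (psubst e (BForall x t A))" using 6 by (intro param_fm_psubst) auto
  have "fv (Var x TNat \<^bold>< psubst_tm e t) = {(x, TNat)} \<union> fvt (psubst_tm e t)" "clean (Var x TNat \<^bold>< psubst_tm e t)"
    by (simp_all add: lt_def le_def monus_def pred_def)
  then have pC: "param_fm ?C" using pA wA t
    by (auto simp: param_fm_def param_terms_def has_ty_def wff_lt[unfolded has_ty_def])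
  have sub: "subst x TNat u (Var x TNat \<^bold>< psubst_tm e t \<^bold>\<longrightarrow> ?A)
      = (u \<^bold>< psubst_tm e t \<^bold>\<longrightarrow> psubst (e((x, TNat) := u)) A)" if "u \<in> param_terms TNat" for u
    using 6 x by (simp add: subst_psubst_total_psubst lt_def le_def monus_def pred_def subst_tm_fresh del: fun_upd_apply)
  have "sat M e (BForall x t A) \<longleftrightarrow>
      (\<forall>u\<in>param_terms TNat. tr (u \<^bold>< psubst_tm e t) \<longrightarrow> tr (psubst (e((x, TNat) := u)) A))"
    using 6 p by (simp add: mlt_M val_M del: fun_upd_apply)
  also have "\<dots> \<longleftrightarrow> (\<forall>u\<in>param_terms TNat. tr (u \<^bold>< psubst_tm e t \<^bold>\<longrightarrow> psubst (e((x, TNat) := u)) A))"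
    using param_fm_subst[OF pC] by (intro ball_cong refl) (simp only: sub tr_Imp)
  also have "\<dots> \<longleftrightarrow> (\<forall>u\<in>param_terms TNat. tr (subst x TNat u (Var x TNat \<^bold>< psubst_tm e t \<^bold>\<longrightarrow> ?A)))"
    by (simp only: sub cong: ball_cong)
  also have "\<dots> \<longleftrightarrow> tr ?C" using tr_Forall[OF pC] by simp
  also have "\<dots> \<longleftrightarrow> tr (BForall x (psubst_tm e t) ?A)"
    unfolding tr_def using x by (blast intro: nd.ballI nd.ballE)
  finally show ?case by simp
qed (auto simp: val_M)

lemma models_M: "models M T"
  unfolding models_def no_params_def
  by (auto simp: env_M truth intro!: tr_nd nd_generalize total_psubst_partial_psubst intro: nd.ax)

end

theorem completeness:
  assumes G: "wff G" "clean G" "fv G = {}"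
    and valid: "\<And>M e. typed_struct (M :: tm struct) \<Longrightarrow> models M T \<Longrightarrow> env M e \<Longrightarrow> sat M e G"
  shows "T \<turnstile> G"
proof (rule ccontr)
  assume no: "\<not> T \<turnstile> G"
  interpret henkin T "{\<^bold>\<not> G}"
    using no G by unfold_locales (auto simp: provable_def param_fm_def intro: nd.contr)
  \<comment> \<open>any environment will do, as \<open>G\<close> is closed\<close>
  define e :: "vname \<times> ty \<Rightarrow> tm" where "e = (\<lambda>v. Var ''#'' (snd v))"
  have e: "total_psubst e" by (auto simp: total_psubst_def e_def param_terms_def has_ty_def)
  have "psubst e G = psubst (\<lambda>(x, \<sigma>). Var x \<sigma>) G" using G by (intro psubst_cong) auto
  then have "tr G"
    using valid[of M e] e truth[of G e] typed_M models_M G by (simp add: env_M psubst_id)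
  moreover have "tr (\<^bold>\<not> G)" by (rule tr_hyp[of _ 0]) simp
  ultimately show False using tr_mp tr_Bot by blast
qed

section \<open>Extensional structures\<close>

lemma length_le_nlen: "(x, \<sigma>) \<in> fvt t \<Longrightarrow> length x \<le> nlen t"
  by (induction t rule: fvt.induct) auto

lemma fresh_notin [simp]: "(fresh s t, \<sigma>) \<notin> fvt s" "(fresh s t, \<sigma>) \<notin> fvt t"
  using length_le_nlen[of "fresh s t"] by (fastforce simp: fresh_def)+

lemma param_fresh [simp]: "\<not> param (fresh s t)"
  by (simp add: fresh_def)

lemma has_ty_simps [simp]:
  "Var x \<sigma> \<^bold>: \<tau> \<longleftrightarrow> \<sigma> = \<tau>" "Cn c \<^bold>: \<tau> \<longleftrightarrow> ty_cn c = \<tau>"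
  by (auto simp: has_ty_def)

lemma has_ty_App [simp]: "s \<cdot> t \<^bold>: \<tau> \<longleftrightarrow> (s \<^bold>: ty_of t \<Rrightarrow> \<tau> \<and> wt t)"
  by (auto simp: has_ty_def)

lemma val_cong: "(\<And>v. v \<in> fvt t \<Longrightarrow> e v = e' v) \<Longrightarrow> val M e t = val M e' t"
  by (induction t rule: fvt.induct) auto

lemma val_upd [simp]: "(x, \<sigma>) \<notin> fvt t \<Longrightarrow> val M (e((x, \<sigma>) := a)) t = val M e t"
  by (rule val_cong) auto

lemma sat_lt [simp]: "sat M e (s \<^bold>< t) \<longleftrightarrow> mlt M (val M e s) (val M e t)"
  by (simp add: mlt_def lt_def le_def monus_def pred_def)

lemma lt_simps [simp]: "fv (s \<^bold>< t) = fvt s \<union> fvt t" "clean (s \<^bold>< t)"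
  by (auto simp: lt_def le_def monus_def pred_def)

text \<open>
  The relation that \<open>eqf\<close> defines in a structure.
\<close>

fun EQ :: "'a struct \<Rightarrow> ty \<Rightarrow> 'a \<Rightarrow> 'a \<Rightarrow> bool" where
  "EQ M TNat a b = EqR M a b"
| "EQ M (\<sigma> \<Rrightarrow> \<tau>) f g = (\<forall>a\<in>Dom M \<sigma>. EQ M \<tau> (Ap M f a) (Ap M g a))"
| "EQ M (TSeq \<sigma>) s t =
     (EqR M (Ap M (Con M (Len \<sigma>)) s) (Ap M (Con M (Len \<sigma>)) t) \<and>
      (\<forall>i\<in>Dom M TNat. mlt M i (Ap M (Con M (Len \<sigma>)) s) \<longrightarrow>
         EQ M \<sigma> (Ap M (Ap M (Con M (Nth \<sigma>)) s) i) (Ap M (Ap M (Con M (Nth \<sigma>)) t) i)))"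

lemma sat_eqf [simp]: "sat M e (eqf \<sigma> s t) \<longleftrightarrow> EQ M \<sigma> (val M e s) (val M e t)"
  by (induction \<sigma> s t arbitrary: e rule: eqf.induct) (simp_all add: Let_def)

lemma wff_eqf [simp]: "s \<^bold>: \<sigma> \<Longrightarrow> t \<^bold>: \<sigma> \<Longrightarrow> wff (eqf \<sigma> s t)"
  by (induction \<sigma> s t rule: eqf.induct) (auto simp: Let_def has_ty_def)

lemma clean_eqf [simp]: "clean (eqf \<sigma> s t)"
  by (induction \<sigma> s t rule: eqf.induct) (auto simp: Let_def)

lemma fv_eqf [simp]: "fv (eqf \<sigma> s t) = fvt s \<union> fvt t"
proof (induction \<sigma> s t rule: eqf.induct)
  case (2 \<sigma> \<tau> s t)
  then show ?case using fresh_notin[of s t] by (auto simp: Let_def)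
next
  case (3 \<sigma> s t)
  then show ?case using fresh_notin[of "s" "t"] by (auto simp: Let_def)
qed simp

lemma modelsD: "models M T \<Longrightarrow> A \<in> T \<Longrightarrow> wff A \<Longrightarrow> no_params A \<Longrightarrow> env M e \<Longrightarrow> sat M e A"
  by (auto simp: models_def)

text \<open>
  The equality and extensionality axioms make \<open>EQ\<close> a congruence, and the first axiom on standardness
  makes it compatible with \<open>EQ\<close>; thus one can pass to the quotient.
\<close>

locale epra_model =
  fixes M :: "'a struct" and T :: "fm set"
  assumes typed: "typed_struct M" and models: "models M T"
    and epra_sub: "epra \<subseteq> T" and st_sub: "st_basic \<subseteq> T"
begin

lemma Ap_Dom: "f \<in> Dom M (\<sigma> \<Rrightarrow> \<tau>) \<Longrightarrow> a \<in> Dom M \<sigma> \<Longrightarrow> Ap M f a \<in> Dom M \<tau>"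
  and Con_Dom [simp]: "Con M c \<in> Dom M (ty_cn c)"
  and Dom_unique: "a \<in> Dom M \<sigma> \<Longrightarrow> a \<in> Dom M \<tau> \<Longrightarrow> \<sigma> = \<tau>"
  using typed unfolding typed_struct_def by blast+

lemma Dom_nonempty: "\<exists>a. a \<in> Dom M \<sigma>"
proof (induction \<sigma>)
  case TNat
  show ?case using Con_Dom[of Zero] by auto
next
  case (TFun \<sigma> \<tau>)
  then show ?case using Ap_Dom[OF Con_Dom[of "CK \<tau> \<sigma>", unfolded ty_cn.simps]] by blast
next
  case (TSeq \<sigma>)
  then obtain a where "a \<in> Dom M \<sigma>" by blast
  then have "Ap M (Con M (CK \<sigma> TNat)) a \<in> Dom M (TNat \<Rrightarrow> \<sigma>)"
    using Ap_Dom[OF Con_Dom[of "CK \<sigma> TNat", unfolded ty_cn.simps]] by blast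
  then show ?case
    using Ap_Dom[OF Ap_Dom[OF Con_Dom[of "Tab \<sigma>", unfolded ty_cn.simps]] Con_Dom[of Zero, unfolded ty_cn.simps]]
    by blast
qed

definition dflt :: "vname \<times> ty \<Rightarrow> 'a" where
  "dflt v = (SOME a. a \<in> Dom M (snd v))"

lemma env_dflt [simp]: "env M dflt"
  using someI_ex[OF Dom_nonempty] by (auto simp: env_def dflt_def)

lemma val_Dom': "wt t \<Longrightarrow> (\<And>x \<sigma>. (x, \<sigma>) \<in> fvt t \<Longrightarrow> e (x, \<sigma>) \<in> Dom M \<sigma>) \<Longrightarrow> val M e t \<in> Dom M (ty_of t)"
proof (induction t rule: fvt.induct)
  case (3 s t)
  then obtain \<tau> where "ty_of s = ty_of t \<Rrightarrow> \<tau>" by auto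
  with 3 show ?case by (auto intro: Ap_Dom)
qed auto

lemma ax_sat: "A \<in> epra \<union> st_basic \<Longrightarrow> wff A \<Longrightarrow> no_params A \<Longrightarrow> env M e \<Longrightarrow> sat M e A"
  using epra_sub st_sub by (intro modelsD[OF models]) auto

lemma EQ_TNat:
  assumes "a \<in> Dom M TNat" "b \<in> Dom M TNat" "c \<in> Dom M TNat"
  shows "EqR M a a" "EqR M a b \<Longrightarrow> EqR M b a" "EqR M a b \<Longrightarrow> EqR M b c \<Longrightarrow> EqR M a c"
proof -
  let ?e = "dflt((''x'', TNat) := a, (''y'', TNat) := b, (''z'', TNat) := c)"
  let ?x = "Var ''x'' TNat" and ?y = "Var ''y'' TNat" and ?z = "Var ''z'' TNat"
  have e: "env M ?e" using assms by simp
  show "EqR M a a"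
    using ax_sat[of "?x \<^bold>= ?x", OF _ _ _ e] by (auto simp: epra.eq_refl no_params_def)
  show "EqR M a b \<Longrightarrow> EqR M b a"
    using ax_sat[of "?x \<^bold>= ?y \<^bold>\<longrightarrow> ?y \<^bold>= ?x", OF _ _ _ e] by (auto simp: epra.eq_sym no_params_def)
  show "EqR M a b \<Longrightarrow> EqR M b c \<Longrightarrow> EqR M a c"
    using ax_sat[of "?x \<^bold>= ?y \<^bold>\<longrightarrow> ?y \<^bold>= ?z \<^bold>\<longrightarrow> ?x \<^bold>= ?z", OF _ _ _ e]
    by (auto simp: epra.eq_trans no_params_def)
qed

lemma EQ_cong_arg:
  assumes "f \<in> Dom M (\<rho> \<Rrightarrow> \<tau>)" "a \<in> Dom M \<rho>" "b \<in> Dom M \<rho>" "EQ M \<rho> a b"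
  shows "EQ M \<tau> (Ap M f a) (Ap M f b)"
proof -
  let ?e = "dflt((''x'', \<rho>) := a, (''y'', \<rho>) := b, (''f'', \<rho> \<Rrightarrow> \<tau>) := f)"
  let ?x = "Var ''x'' \<rho>" and ?y = "Var ''y'' \<rho>" and ?f = "Var ''f'' (\<rho> \<Rrightarrow> \<tau>)"
  have e: "env M ?e" using assms by simp
  show ?thesis
    using ax_sat[of "eqf \<rho> ?x ?y \<^bold>\<longrightarrow> eqf \<tau> (?f \<cdot> ?x) (?f \<cdot> ?y)", OF _ _ _ e] assms
    by (auto simp: epra.extensionality no_params_def)
qed

text \<open>
  Symmetry and transitivity of equality of sequences need this: the indices are bounded by the
  length of the first sequence only.
\<close>

lemma mlt_cong:
  assumes "i \<in> Dom M TNat" "a \<in> Dom M TNat" "b \<in> Dom M TNat" "EqR M a b" "mlt M i a"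
  shows "mlt M i b"
proof -
  let ?f = "val M (dflt((''x'', TNat) := i))
    (Cn Rec \<cdot> suc (Var ''x'' TNat) \<cdot> (Cn (CK ty1 TNat) \<cdot> pred))"
  have f: "?f \<in> Dom M ty1"
    using val_Dom'[of "Cn Rec \<cdot> suc (Var ''x'' TNat) \<cdot> (Cn (CK ty1 TNat) \<cdot> pred)" "dflt((''x'', TNat) := i)"]
      assms by (simp add: pred_def)
  have *: "mlt M i c \<longleftrightarrow> EqR M (Ap M ?f c) (Con M Zero)" for c
    by (simp add: mlt_def monus_def pred_def)
  have "EqR M (Ap M ?f b) (Ap M ?f a)"
    using EQ_cong_arg[OF f assms(3,2)] EQ_TNat(2)[OF assms(2,3,2)] assms(4) by simp
  moreover have "EqR M (Ap M ?f a) (Con M Zero)" using assms * by blast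
  moreover have "Con M Zero \<in> Dom M TNat" using Con_Dom[of Zero] by simp
  ultimately show ?thesis
    using EQ_TNat(3)[OF Ap_Dom[OF f assms(3)] Ap_Dom[OF f assms(2)]] unfolding * by blast
qed

lemma Len_Dom: "s \<in> Dom M (TSeq \<sigma>) \<Longrightarrow> Ap M (Con M (Len \<sigma>)) s \<in> Dom M TNat"
  using Ap_Dom Con_Dom[of "Len \<sigma>"] by auto

lemma Nth_Dom: "s \<in> Dom M (TSeq \<sigma>) \<Longrightarrow> i \<in> Dom M TNat \<Longrightarrow> Ap M (Ap M (Con M (Nth \<sigma>)) s) i \<in> Dom M \<sigma>"
  using Ap_Dom Con_Dom[of "Nth \<sigma>"] by (metis ty_cn.simps(8))

lemma EQ_refl: "a \<in> Dom M \<sigma> \<Longrightarrow> EQ M \<sigma> a a"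
  by (induction \<sigma> arbitrary: a) (auto simp: Nth_Dom intro: Len_Dom EQ_TNat(1) Ap_Dom)

lemma EQ_sym: "a \<in> Dom M \<sigma> \<Longrightarrow> b \<in> Dom M \<sigma> \<Longrightarrow> EQ M \<sigma> a b \<Longrightarrow> EQ M \<sigma> b a"
proof (induction \<sigma> arbitrary: a b)
  case (TSeq \<sigma>)
  then have "EqR M (Ap M (Con M (Len \<sigma>)) b) (Ap M (Con M (Len \<sigma>)) a)"
    using EQ_TNat(2)[OF Len_Dom Len_Dom Len_Dom, OF TSeq.prems(1,2,1)] by simp
  moreover have "EQ M \<sigma> (Ap M (Ap M (Con M (Nth \<sigma>)) b) i) (Ap M (Ap M (Con M (Nth \<sigma>)) a) i)"
    if "i \<in> Dom M TNat" "mlt M i (Ap M (Con M (Len \<sigma>)) b)" for i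
  proof -
    have "mlt M i (Ap M (Con M (Len \<sigma>)) a)"
      by (rule mlt_cong[OF that(1) Len_Dom[OF TSeq.prems(2)] Len_Dom[OF TSeq.prems(1)] _ that(2)])
        (rule calculation)
    then show ?thesis
      using TSeq.IH[OF Nth_Dom[OF TSeq.prems(1) that(1)] Nth_Dom[OF TSeq.prems(2) that(1)]]
        TSeq.prems(3) that(1) by simp
  qed
  ultimately show ?case by simp
next
  case TNat
  then show ?case using EQ_TNat(2)[of a b a] by simp
next
  case (TFun \<sigma> \<tau>)
  have "EQ M \<tau> (Ap M b x) (Ap M a x)" if "x \<in> Dom M \<sigma>" for x
  proof (rule TFun.IH(2))
    show "EQ M \<tau> (Ap M a x) (Ap M b x)"
      using bspec[OF TFun.prems(3)[unfolded EQ.simps] that] by -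
  qed (rule Ap_Dom[OF _ that], rule TFun.prems)+
  then show ?case by simp
qed

lemma EQ_trans:
  "a \<in> Dom M \<sigma> \<Longrightarrow> b \<in> Dom M \<sigma> \<Longrightarrow> c \<in> Dom M \<sigma> \<Longrightarrow> EQ M \<sigma> a b \<Longrightarrow> EQ M \<sigma> b c \<Longrightarrow> EQ M \<sigma> a c"
proof (induction \<sigma> arbitrary: a b c)
  case TNat
  then show ?case using EQ_TNat(3)[of a b c] by simp
next
  case (TFun \<sigma> \<tau>)
  have "EQ M \<tau> (Ap M a x) (Ap M c x)" if "x \<in> Dom M \<sigma>" for x
  proof (rule TFun.IH(2))
    show "EQ M \<tau> (Ap M a x) (Ap M b x)" "EQ M \<tau> (Ap M b x) (Ap M c x)"
      using bspec[OF TFun.prems(4)[unfolded EQ.simps] that]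
        bspec[OF TFun.prems(5)[unfolded EQ.simps] that] by -
  qed (rule Ap_Dom[OF _ that], rule TFun.prems)+
  then show ?case by simp
next
  case (TSeq \<sigma>)
  have "EqR M (Ap M (Con M (Len \<sigma>)) a) (Ap M (Con M (Len \<sigma>)) c)"
    using TSeq.prems EQ_TNat(3)[OF Len_Dom Len_Dom Len_Dom, OF TSeq.prems(1-3)] by simp
  moreover have "EQ M \<sigma> (Ap M (Ap M (Con M (Nth \<sigma>)) a) i) (Ap M (Ap M (Con M (Nth \<sigma>)) c) i)"
    if "i \<in> Dom M TNat" "mlt M i (Ap M (Con M (Len \<sigma>)) a)" for i
  proof -
    have "mlt M i (Ap M (Con M (Len \<sigma>)) b)"
      by (rule mlt_cong[OF that(1) Len_Dom[OF TSeq.prems(1)] Len_Dom[OF TSeq.prems(2)] _ that(2)])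
        (use TSeq.prems(4) in simp)
    then show ?thesis
      using TSeq.IH[OF Nth_Dom[OF TSeq.prems(1) that(1)] Nth_Dom[OF TSeq.prems(2) that(1)]
          Nth_Dom[OF TSeq.prems(3) that(1)]] TSeq.prems(4,5)[unfolded EQ.simps] that by blast
  qed
  ultimately show ?case by simp
qed

text \<open>
  A canonical representative of the class of \<open>a\<close>; the quotient lives on representatives, so
  that its elements have the same HOL type as those of the given structure.
\<close>

definition rep :: "'a \<Rightarrow> 'a" where
  "rep a = (SOME b. \<exists>\<sigma>. a \<in> Dom M \<sigma> \<and> b \<in> Dom M \<sigma> \<and> EQ M \<sigma> a b)"

lemma rep: assumes "a \<in> Dom M \<sigma>" shows "rep a \<in> Dom M \<sigma>" "EQ M \<sigma> a (rep a)"
proof -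
  have "\<exists>b \<sigma>. a \<in> Dom M \<sigma> \<and> b \<in> Dom M \<sigma> \<and> EQ M \<sigma> a b" using assms EQ_refl by blast
  from someI_ex[OF this] obtain \<tau> where "a \<in> Dom M \<tau>" "rep a \<in> Dom M \<tau>" "EQ M \<tau> a (rep a)"
    unfolding rep_def by blast
  with assms Dom_unique show "rep a \<in> Dom M \<sigma>" "EQ M \<sigma> a (rep a)" by metis+
qed

lemma rep_eq_iff: 
  assumes "a \<in> Dom M \<sigma>" "b \<in> Dom M \<sigma>"
  shows "rep a = rep b \<longleftrightarrow> EQ M \<sigma> a b"
proof
  assume "rep a = rep b"
  then show "EQ M \<sigma> a b" using rep[of a \<sigma>] rep[of b \<sigma>] EQ_sym EQ_trans assms by metis
next
  assume *: "EQ M \<sigma> a b"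
  have "(\<exists>\<tau>. a \<in> Dom M \<tau> \<and> c \<in> Dom M \<tau> \<and> EQ M \<tau> a c) = (\<exists>\<tau>. b \<in> Dom M \<tau> \<and> c \<in> Dom M \<tau> \<and> EQ M \<tau> b c)" for c
    using assms * EQ_sym EQ_trans Dom_unique by metis
  then show "rep a = rep b" by (simp add: rep_def)
qed

lemma rep_rep: "a \<in> Dom M \<sigma> \<Longrightarrow> rep (rep a) = rep a"
  using rep rep_eq_iff EQ_sym by metis

definition quotient :: "'a struct" where
  "quotient = \<lparr>Dom = (\<lambda>\<sigma>. rep ` Dom M \<sigma>), Ap = (\<lambda>f a. rep (Ap M f a)), Con = (\<lambda>c. rep (Con M c)),
        EqR = (=), StR = StR M\<rparr>"

lemma quotient_simps [simp]: "Dom quotient \<sigma> = rep ` Dom M \<sigma>" "Ap quotient f a = rep (Ap M f a)"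
  "Con quotient c = rep (Con M c)" "EqR quotient = (=)" "StR quotient = StR M"
  by (auto simp: quotient_def)

lemma rep_Ap: 
  assumes "f \<in> Dom M (\<sigma> \<Rrightarrow> \<tau>)" "a \<in> Dom M \<sigma>"
  shows "rep (Ap M (rep f) (rep a)) = rep (Ap M f a)"
proof -
  have "EQ M \<tau> (Ap M f a) (Ap M (rep f) a)" using rep[OF assms(1)] assms by simp
  moreover have "EQ M \<tau> (Ap M (rep f) a) (Ap M (rep f) (rep a))"
    using rep assms by (intro EQ_cong_arg) auto
  ultimately have "EQ M \<tau> (Ap M f a) (Ap M (rep f) (rep a))"
    using rep assms by (blast intro: EQ_trans Ap_Dom)
  then have "rep (Ap M f a) = rep (Ap M (rep f) (rep a))"
    using rep assms by (subst rep_eq_iff) (auto intro: Ap_Dom)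
  then show ?thesis by simp
qed

lemma val_quotient:
  "wt t \<Longrightarrow> (\<And>x \<sigma>. (x, \<sigma>) \<in> fvt t \<Longrightarrow> e (x, \<sigma>) \<in> Dom M \<sigma>) \<Longrightarrow>
   val quotient (\<lambda>v. rep (e v)) t = rep (val M e t)"
proof (induction t rule: fvt.induct)
  case (3 s t)
  then obtain \<tau> where "ty_of s = ty_of t \<Rrightarrow> \<tau>" by auto
  with 3 show ?case using val_Dom'[of s e] val_Dom'[of t e] by (simp add: rep_Ap)
qed auto

lemma mlt_quotient:
  assumes "a \<in> Dom M TNat" "b \<in> Dom M TNat"
  shows "mlt quotient (rep a) (rep b) \<longleftrightarrow> mlt M a b"
proof -
  let ?t = "monus (suc (Var ''x'' TNat)) (Var ''y'' TNat)"
  let ?e = "\<lambda>v :: vname \<times> ty. if fst v = ''x'' then a else b"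
  have t: "wt ?t" "ty_of ?t = TNat" "\<And>x \<sigma>. (x, \<sigma>) \<in> fvt ?t \<Longrightarrow> ?e (x, \<sigma>) \<in> Dom M \<sigma>"
    using assms by (auto simp: monus_def pred_def)
  have "(\<lambda>v :: vname \<times> ty. if fst v = ''x'' then rep a else rep b) = (\<lambda>v. rep (?e v))" by auto
  then have "mlt quotient (rep a) (rep b) \<longleftrightarrow> rep (val M ?e ?t) = rep (Con M Zero)"
    using val_quotient[OF t(1,3)] by (simp add: mlt_def)
  also have "\<dots> \<longleftrightarrow> EQ M TNat (val M ?e ?t) (Con M Zero)"
    using val_Dom'[OF t(1,3)] t(2) Con_Dom[of Zero] by (intro rep_eq_iff) auto
  finally show ?thesis by (simp add: mlt_def)
qed

lemma StR_rep: assumes "a \<in> Dom M \<sigma>" shows "StR M (rep a) \<longleftrightarrow> StR M a"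
proof -
  have *: "StR M c" if "b \<in> Dom M \<sigma>" "c \<in> Dom M \<sigma>" "EQ M \<sigma> b c" "StR M b" for b c
  proof -
    let ?x = "Var ''x'' \<sigma>" and ?y = "Var ''y'' \<sigma>"
    have "env M (dflt((''x'', \<sigma>) := b, (''y'', \<sigma>) := c))" using that by simp
    from ax_sat[of "St ?x \<^bold>\<and> eqf \<sigma> ?x ?y \<^bold>\<longrightarrow> St ?y", OF _ _ _ this] that show ?thesis
      by (auto simp: st_basic.st_eq no_params_def)
  qed
  show ?thesis using * rep[OF assms] assms EQ_sym by blast
qed

text \<open>
  Passing to representatives is a strong homomorphism onto the quotient, hence preserves
  the satisfaction of all formulas.
\<close>

lemma sat_quotient: "wff A \<Longrightarrow> env M e \<Longrightarrow> sat quotient (\<lambda>v. rep (e v)) A \<longleftrightarrow> sat M e A"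
proof (induction A arbitrary: e rule: fv.induct)
  case (1 s t)
  have e: "\<And>x \<sigma>. e (x, \<sigma>) \<in> Dom M \<sigma>" using 1 by (simp add: env_def)
  have "val M e s \<in> Dom M TNat" "val M e t \<in> Dom M TNat"
    using val_Dom'[of s e] val_Dom'[of t e] e 1 by (auto simp: has_ty_def)
  then show ?case using 1 e by (simp add: val_quotient has_ty_def rep_eq_iff)
next
  case (2 t)
  have e: "\<And>x \<sigma>. e (x, \<sigma>) \<in> Dom M \<sigma>" using 2 by (simp add: env_def)
  have "val M e t \<in> Dom M (ty_of t)"
    using val_Dom'[of t e] e 2 by (auto simp: has_ty_def)
  then show ?case using 2 e by (simp add: val_quotient StR_rep)
next
  case (5 x \<sigma> A)
  have *: "(\<lambda>v. rep ((e((x, \<sigma>) := a)) v)) = (\<lambda>v. rep (e v))((x, \<sigma>) := rep a)" for a by auto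
  have "sat quotient ((\<lambda>v. rep (e v))((x, \<sigma>) := rep a)) A = sat M (e((x, \<sigma>) := a)) A"
    if "a \<in> Dom M \<sigma>" for a
    using "5.IH"[of "e((x, \<sigma>) := a)"] "5.prems" that unfolding * by (simp del: fun_upd_apply)
  then show ?case by simp
next
  case (6 x t A)
  have e: "\<And>x \<sigma>. e (x, \<sigma>) \<in> Dom M \<sigma>" using 6 by (simp add: env_def)
  have t: "val M e t \<in> Dom M TNat"
    using val_Dom'[of t e] e 6 by (auto simp: has_ty_def)
  have *: "(\<lambda>v. rep ((e((x, \<sigma>) := a)) v)) = (\<lambda>v. rep (e v))((x, \<sigma>) := rep a)" for a \<sigma> by auto
  have "sat quotient ((\<lambda>v. rep (e v))((x, TNat) := rep a)) A = sat M (e((x, TNat) := a)) A"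
    if "a \<in> Dom M TNat" for a
    using "6.IH"[of "e((x, TNat) := a)"] "6.prems" that unfolding * by (simp del: fun_upd_apply)
  then show ?case using 6 e t by (simp add: val_quotient has_ty_def mlt_quotient)
qed auto

lemma typed_quotient: "typed_struct quotient"
proof -
  have "Ap quotient f a \<in> Dom quotient \<tau>" if "f \<in> Dom quotient (\<sigma> \<Rrightarrow> \<tau>)" "a \<in> Dom quotient \<sigma>" for f a \<sigma> \<tau>
  proof -
    have "f \<in> Dom M (\<sigma> \<Rrightarrow> \<tau>)" "a \<in> Dom M \<sigma>" using that rep by auto
    then show ?thesis by (auto intro: Ap_Dom)
  qed
  moreover have "\<sigma> = \<tau>" if "a \<in> Dom quotient \<sigma>" "a \<in> Dom quotient \<tau>" for a \<sigma> \<tau>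
  proof -
    have "a \<in> Dom M \<sigma>" "a \<in> Dom M \<tau>" using that rep(1) by auto
    then show ?thesis by (rule Dom_unique)
  qed
  moreover have "Con quotient c \<in> Dom quotient (ty_cn c)" for c by simp
  ultimately show ?thesis unfolding typed_struct_def by blast
qed

lemma env_quotient: assumes "env quotient e" shows "env M e" "(\<lambda>v. rep (e v)) = e"
proof -
  have *: "e (x, \<sigma>) \<in> rep ` Dom M \<sigma>" for x \<sigma> using assms by (simp add: env_def)
  show "env M e" unfolding env_def
  proof (intro HOL.allI)
    fix x \<sigma> show "e (x, \<sigma>) \<in> Dom M \<sigma>" using *[of x \<sigma>] rep(1) by auto
  qed
  show "(\<lambda>v. rep (e v)) = e"
  proof
    fix v :: "vname \<times> ty"
    show "rep (e v) = e v" using *[of "fst v" "snd v"] rep_rep by auto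
  qed
qed

lemma models_quotient: "models quotient T"
  unfolding models_def using models[unfolded models_def] sat_quotient env_quotient by metis

lemma ext_quotient:
  assumes "a \<in> Dom quotient \<sigma>" "b \<in> Dom quotient \<sigma>" "EQ quotient \<sigma> a b"
  shows "a = b"
proof -
  obtain a' b' where ab: "a' \<in> Dom M \<sigma>" "b' \<in> Dom M \<sigma>" "a = rep a'" "b = rep b'" using assms by auto
  let ?x = "Var ''x'' \<sigma>" and ?y = "Var ''y'' \<sigma>"
  let ?e = "dflt((''x'', \<sigma>) := a', (''y'', \<sigma>) := b')"
  have "env M ?e" using ab by simp
  from sat_quotient[OF _ this, of "eqf \<sigma> ?x ?y"] have "EQ M \<sigma> a' b'" using assms ab by simp
  then show ?thesis using ab rep_eq_iff by blast
qed

end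

locale ext_struct =
  fixes M :: "'a struct"
  assumes ext_typed: "typed_struct M"
    and EqR [simp]: "EqR M a b \<longleftrightarrow> a = b"
    and ext: "a \<in> Dom M \<sigma> \<Longrightarrow> b \<in> Dom M \<sigma> \<Longrightarrow> EQ M \<sigma> a b \<Longrightarrow> a = b"

text \<open>
  Completeness for structures in which equality at every type is identity.
\<close>

theorem ext_completeness:
  assumes T: "epra \<subseteq> T" "st_basic \<subseteq> T"
    and G: "wff G" "clean G" "fv G = {}"
    and valid: "\<And>M e. ext_struct (M :: tm struct) \<Longrightarrow> models M T \<Longrightarrow> env M e \<Longrightarrow> sat M e G"
  shows "T \<turnstile> G"
proof (rule completeness[OF G])
  fix M :: "tm struct" and e assume "typed_struct M" "models M T" and e: "env M e"
  then interpret epra_model M T using T by unfold_locales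
  have "ext_struct quotient" using typed_quotient ext_quotient by unfold_locales auto
  moreover have "env quotient (\<lambda>v. rep (e v))" using e by (auto simp: env_def)
  ultimately show "sat M e G" using valid models_quotient sat_quotient G e by blast
qed

section \<open>Combinators and arithmetic in a model\<close>

lemma wt_lam [simp]: "wt t \<Longrightarrow> wt (lam x \<sigma> t)"
  and ty_lam [simp]: "wt t \<Longrightarrow> ty_of (lam x \<sigma> t) = \<sigma> \<Rrightarrow> ty_of t"
proof -
  have "wt t \<Longrightarrow> wt (lam x \<sigma> t) \<and> ty_of (lam x \<sigma> t) = \<sigma> \<Rrightarrow> ty_of t"
    by (induction x \<sigma> t rule: lam.induct) auto
  then show "wt t \<Longrightarrow> wt (lam x \<sigma> t)" "wt t \<Longrightarrow> ty_of (lam x \<sigma> t) = \<sigma> \<Rrightarrow> ty_of t" by auto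
qed

lemma fvt_lam [simp]: "fvt (lam x \<sigma> t) = fvt t - {(x, \<sigma>)}"
  by (induction x \<sigma> t rule: lam.induct) auto

lemma val_subst_tm: "val M e (subst_tm x \<sigma> u t) = val M (e((x, \<sigma>) := val M e u)) t"
  by (induction t rule: fvt.induct) auto

lemma sat_subst_qfree:
  "qfree A \<Longrightarrow> sat M e (subst x \<sigma> u A) \<longleftrightarrow> sat M (e((x, \<sigma>) := val M e u)) A"
  by (induction A rule: qfree.induct) (auto simp: val_subst_tm)

lemma wf_subst_tm: "wt t \<Longrightarrow> u \<^bold>: \<sigma> \<Longrightarrow> wt (subst_tm x \<sigma> u t) \<and> ty_of (subst_tm x \<sigma> u t) = ty_of t"
  by (induction t rule: fvt.induct) (auto simp: has_ty_def)

lemma wff_subst_qfree: "wff A \<Longrightarrow> qfree A \<Longrightarrow> u \<^bold>: \<sigma> \<Longrightarrow> wff (subst x \<sigma> u A)"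
  by (induction A rule: qfree.induct) (auto simp: wf_subst_tm has_ty_def)

lemma fv_subst_qfree: "qfree A \<Longrightarrow> fv (subst x \<sigma> u A) \<subseteq> fv A \<union> fvt u"
  by (induction A rule: qfree.induct) (auto dest: subsetD[OF fvt_subst_tm])

lemma clean_qfree: "qfree A \<Longrightarrow> clean A \<and> clean (subst x \<sigma> u A)"
  by (induction A rule: qfree.induct) auto

text \<open>
  Addition serves to show that the order defined by truncated subtraction is transitive, and to
  bound the entries of a finite sequence by their sum.
\<close>

definition plus_tm :: "tm \<Rightarrow> tm \<Rightarrow> tm" where
  "plus_tm s t = Cn Rec \<cdot> s \<cdot> (Cn (CK ty1 TNat) \<cdot> Cn Succ) \<cdot> t"

lemma wt_arith [simp]:
  "pred \<^bold>: ty1" 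
  "wt (monus s t) \<longleftrightarrow> s \<^bold>: TNat \<and> t \<^bold>: TNat" "s \<^bold>: TNat \<Longrightarrow> t \<^bold>: TNat \<Longrightarrow> ty_of (monus s t) = TNat"
  "wt (plus_tm s t) \<longleftrightarrow> s \<^bold>: TNat \<and> t \<^bold>: TNat" "s \<^bold>: TNat \<Longrightarrow> t \<^bold>: TNat \<Longrightarrow> ty_of (plus_tm s t) = TNat"
  "fvt pred = {}" "fvt (monus s t) = fvt s \<union> fvt t" "fvt (plus_tm s t) = fvt s \<union> fvt t"
  by (auto simp: pred_def monus_def plus_tm_def has_ty_def)

text \<open>
  From here on the axioms of the theory are used as properties of one extensional structure.
  Each of them is obtained by evaluating an instance with variables at the elements in question.
\<close>

locale omega_model = epra_model M rca0_Omega + ext_struct M for M :: "'a struct"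
begin

abbreviation ap :: "'a \<Rightarrow> 'a \<Rightarrow> 'a"  (infixl "$" 90) where "f $ a \<equiv> Ap M f a"
abbreviation "N \<equiv> Dom M TNat"
abbreviation "Z \<equiv> Con M Zero"
abbreviation "S n \<equiv> Con M Succ $ n"
abbreviation "st \<equiv> StR M"

lemma EQ_iff: "a \<in> Dom M \<sigma> \<Longrightarrow> b \<in> Dom M \<sigma> \<Longrightarrow> EQ M \<sigma> a b \<longleftrightarrow> a = b"
  using EQ_refl ext by blast

lemma fun_ext:
  assumes "f \<in> Dom M (\<sigma> \<Rrightarrow> \<tau>)" "g \<in> Dom M (\<sigma> \<Rrightarrow> \<tau>)" "\<And>a. a \<in> Dom M \<sigma> \<Longrightarrow> f $ a = g $ a"
  shows "f = g"
proof -
  have "EQ M (\<sigma> \<Rrightarrow> \<tau>) f g" using assms by (auto intro: EQ_refl Ap_Dom)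
  then show ?thesis using EQ_iff assms(1,2) by blast
qed

lemma rca_sat: "A \<in> rca0_Omega \<Longrightarrow> wff A \<Longrightarrow> no_params A \<Longrightarrow> env M e \<Longrightarrow> sat M e A"
  by (rule modelsD[OF models])

lemma val_Dom: "env M e \<Longrightarrow> wt t \<Longrightarrow> ty_of t = \<sigma> \<Longrightarrow> val M e t \<in> Dom M \<sigma>"
  using val_Dom'[of t e] by (auto simp: env_def)

lemma Con_in: "ty_cn c = \<sigma> \<Longrightarrow> Con M c \<in> Dom M \<sigma>"
  using Con_Dom[of c] by simp

lemma Z_in [simp]: "Z \<in> N" by (simp add: Con_in)

lemma ap_in [simp]:
  "f \<in> Dom M ty1 \<Longrightarrow> n \<in> N \<Longrightarrow> f $ n \<in> N"
  "\<phi> \<in> Dom M ty2 \<Longrightarrow> f \<in> Dom M ty1 \<Longrightarrow> \<phi> $ f \<in> N"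
  "\<Delta> \<in> Dom M ty21 \<Longrightarrow> \<phi> \<in> Dom M ty2 \<Longrightarrow> \<Delta> $ \<phi> \<in> Dom M ty2"
  "p \<in> Dom M (ty1 \<Rrightarrow> ty1) \<Longrightarrow> f \<in> Dom M ty1 \<Longrightarrow> p $ f \<in> Dom M ty1"
  "F \<in> Dom M ((ty1 \<Rrightarrow> ty1) \<Rrightarrow> TSeq TNat) \<Longrightarrow> p \<in> Dom M (ty1 \<Rrightarrow> ty1) \<Longrightarrow> F $ p \<in> Dom M (TSeq TNat)"
  by (auto intro: Ap_Dom)

lemma S_in [simp]: "n \<in> N \<Longrightarrow> S n \<in> N"
  by (simp add: Con_in)

lemma K_ap:
  assumes "a \<in> Dom M \<sigma>" "b \<in> Dom M \<tau>"
  shows "Con M (CK \<sigma> \<tau>) $ a $ b = a"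
proof -
  let ?x = "Var ''x'' \<sigma>" and ?y = "Var ''y'' \<tau>"
  let ?e = "dflt((''x'', \<sigma>) := a, (''y'', \<tau>) := b)"
  have e: "env M ?e" using assms by simp
  have "sat M ?e (eqf \<sigma> (Cn (CK \<sigma> \<tau>) \<cdot> ?x \<cdot> ?y) ?x)"
    by (rule ax_sat[OF _ _ _ e]) (auto intro: epra.comb_K simp: no_params_def)
  then have "EQ M \<sigma> (Con M (CK \<sigma> \<tau>) $ a $ b) a" by simp
  moreover have "Con M (CK \<sigma> \<tau>) $ a $ b \<in> Dom M \<sigma>"
    using assms by (auto intro!: Ap_Dom Con_in)
  ultimately show ?thesis using EQ_iff assms by blast
qed

lemma S_ap:
  assumes "a \<in> Dom M (\<rho> \<Rrightarrow> \<sigma> \<Rrightarrow> \<tau>)" "b \<in> Dom M (\<rho> \<Rrightarrow> \<sigma>)" "c \<in> Dom M \<rho>"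
  shows "Con M (CS \<rho> \<sigma> \<tau>) $ a $ b $ c = a $ c $ (b $ c)"
proof -
  let ?x = "Var ''x'' (\<rho> \<Rrightarrow> \<sigma> \<Rrightarrow> \<tau>)" and ?y = "Var ''y'' (\<rho> \<Rrightarrow> \<sigma>)" and ?z = "Var ''z'' \<rho>"
  let ?e = "dflt((''x'', \<rho> \<Rrightarrow> \<sigma> \<Rrightarrow> \<tau>) := a, (''y'', \<rho> \<Rrightarrow> \<sigma>) := b, (''z'', \<rho>) := c)"
  have e: "env M ?e" using assms by simp
  have "sat M ?e (eqf \<tau> (Cn (CS \<rho> \<sigma> \<tau>) \<cdot> ?x \<cdot> ?y \<cdot> ?z) (?x \<cdot> ?z \<cdot> (?y \<cdot> ?z)))"
    by (rule ax_sat[OF _ _ _ e]) (auto intro: epra.comb_S simp: no_params_def)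
  then have "EQ M \<tau> (Con M (CS \<rho> \<sigma> \<tau>) $ a $ b $ c) (a $ c $ (b $ c))" by simp
  moreover have "Con M (CS \<rho> \<sigma> \<tau>) $ a $ b $ c \<in> Dom M \<tau>" "a $ c $ (b $ c) \<in> Dom M \<tau>"
    using assms by (auto intro!: Ap_Dom[OF Ap_Dom[OF Ap_Dom[OF Con_in]]] intro: Ap_Dom)
  ultimately show ?thesis using EQ_iff by blast
qed

text \<open>
  Bracket abstraction computes the function it stands for.  All functionals needed below are
  introduced through this lemma; its use requires only the value of the body.
\<close>

lemma val_lam:
  "wt t \<Longrightarrow> env M e \<Longrightarrow> a \<in> Dom M \<sigma> \<Longrightarrow> val M e (lam x \<sigma> t) $ a = val M (e((x, \<sigma>) := a)) t"
proof (induction x \<sigma> t rule: lam.induct)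
  case (1 x \<sigma> y \<tau>)
  show ?case
  proof (cases "x = y \<and> \<sigma> = \<tau>")
    case True
    have "Con M (CS \<sigma> (\<sigma> \<Rrightarrow> \<sigma>) \<sigma>) $ Con M (CK \<sigma> (\<sigma> \<Rrightarrow> \<sigma>)) $ Con M (CK \<sigma> \<sigma>) $ a = a"
      using 1 Ap_Dom[OF Con_in[of "CK \<sigma> \<sigma>"], of \<sigma> "\<sigma> \<Rrightarrow> \<sigma>" a]
      by (subst S_ap) (auto simp: K_ap intro!: Con_in)
    with True show ?thesis by simp
  next
    case False
    moreover have "e (y, \<tau>) \<in> Dom M \<tau>" using 1 by (simp add: env_def)
    ultimately show ?thesis using 1 by (auto simp: K_ap)
  qed
next
  case (2 x \<sigma> c)
  then show ?case by (simp add: K_ap Con_in)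
next
  case (3 x \<sigma> s t)
  then obtain \<tau> where \<tau>: "ty_of s = ty_of t \<Rrightarrow> \<tau>" by auto
  have "val M e (lam x \<sigma> s) \<in> Dom M (\<sigma> \<Rrightarrow> ty_of t \<Rrightarrow> \<tau>)" "val M e (lam x \<sigma> t) \<in> Dom M (\<sigma> \<Rrightarrow> ty_of t)"
    using 3 \<tau> by (auto intro!: val_Dom)
  then show ?case using 3 \<tau> by (simp add: S_ap)
qed

lemma S_neq_Z: "n \<in> N \<Longrightarrow> S n \<noteq> Z"
proof -
  assume "n \<in> N"
  then have "sat M (dflt((''x'', TNat) := n)) (\<^bold>\<not> (suc (Var ''x'' TNat) \<^bold>= zero))"
    by (intro ax_sat) (auto intro: epra.suc_nonzero simp: no_params_def)
  then show ?thesis by simp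
qed

lemma S_inj:
  assumes "m \<in> N" "n \<in> N" "S m = S n"
  shows "m = n"
proof -
  let ?x = "Var ''x'' TNat" and ?y = "Var ''y'' TNat"
  have "sat M (dflt((''x'', TNat) := m, (''y'', TNat) := n)) (suc ?x \<^bold>= suc ?y \<^bold>\<longrightarrow> ?x \<^bold>= ?y)"
    by (rule ax_sat) (use assms in \<open>auto intro: epra.suc_inject simp: no_params_def\<close>)
  then show ?thesis using assms by simp
qed

lemma Rec_ap:
  assumes "a \<in> N" "h \<in> Dom M (TNat \<Rrightarrow> ty1)"
  shows "Con M Rec $ a $ h $ Z = a"
    "n \<in> N \<Longrightarrow> Con M Rec $ a $ h $ S n = h $ n $ (Con M Rec $ a $ h $ n)"
    "n \<in> N \<Longrightarrow> Con M Rec $ a $ h $ n \<in> N"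
    "Con M Rec $ a $ h \<in> Dom M ty1"
proof -
  let ?x = "Var ''x'' TNat" and ?y = "Var ''y'' TNat" and ?h = "Var ''h'' (TNat \<Rrightarrow> ty1)"
  let ?e = "dflt((''x'', TNat) := a, (''h'', TNat \<Rrightarrow> ty1) := h)"
  have "sat M ?e (Cn Rec \<cdot> ?x \<cdot> ?h \<cdot> zero \<^bold>= ?x)"
    by (rule ax_sat) (use assms in \<open>auto intro: epra.rec_zero simp: no_params_def\<close>)
  then show "Con M Rec $ a $ h $ Z = a" by simp
  show "Con M Rec $ a $ h $ S n = h $ n $ (Con M Rec $ a $ h $ n)" if "n \<in> N"
  proof -
    have "sat M (?e((''y'', TNat) := n))
        (Cn Rec \<cdot> ?x \<cdot> ?h \<cdot> suc ?y \<^bold>= ?h \<cdot> ?y \<cdot> (Cn Rec \<cdot> ?x \<cdot> ?h \<cdot> ?y))"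
      by (rule ax_sat) (use assms that in \<open>auto intro: epra.rec_suc simp: no_params_def\<close>)
    then show ?thesis by simp
  qed
  show R: "Con M Rec $ a $ h \<in> Dom M ty1" using assms by (auto intro!: Ap_Dom[OF Ap_Dom[OF Con_in]])
  show "Con M Rec $ a $ h $ n \<in> N" if "n \<in> N" using R that by simp
qed

text \<open>
  Numbers of the model may be nonstandard, so each arithmetical fact needs a quantifier-free
  induction inside the model.
\<close>

lemma nat_induct_qf:
  assumes A: "wff A" "qfree A" "\<forall>v\<in>fv A. \<not> param (fst v)" and x: "\<not> param x" and e: "env M e"
    and 0: "sat M (e((x, TNat) := Z)) A"
    and Suc: "\<And>a. a \<in> N \<Longrightarrow> sat M (e((x, TNat) := a)) A \<Longrightarrow> sat M (e((x, TNat) := S a)) A"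
    and n: "n \<in> N"
  shows "sat M (e((x, TNat) := n)) A"
proof -
  let ?B = "subst x TNat zero A \<^bold>\<longrightarrow>
         Forall x TNat (A \<^bold>\<longrightarrow> subst x TNat (suc (Var x TNat)) A) \<^bold>\<longrightarrow> Forall x TNat A"
  have "sat M e ?B"
  proof (rule ax_sat[OF _ _ _ e])
    show "wff ?B" using A by (simp add: wff_subst_qfree)
    have "\<forall>v\<in>fv (subst x TNat u A). \<not> param (fst v)" if "\<forall>v\<in>fvt u. \<not> param (fst v)" for u
      using A(3) that fv_subst_qfree[OF A(2), of x TNat u] by blast
    from this[of zero] this[of "suc (Var x TNat)"] show "no_params ?B"
      using A x by (auto simp: no_params_def clean_qfree)
  qed (use A in \<open>auto intro: epra.qf_induction\<close>)
  then show ?thesis using A 0 Suc n by (simp add: sat_subst_qfree del: fun_upd_apply) simp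
qed

definition pred_val :: 'a where "pred_val = Con M Rec $ Z $ Con M (CK TNat TNat)"
definition monus_val :: "'a \<Rightarrow> 'a \<Rightarrow> 'a" where
  "monus_val a b = Con M Rec $ a $ (Con M (CK ty1 TNat) $ pred_val) $ b"

lemma val_pred [simp]: "val M e pred = pred_val"
  by (simp add: pred_def pred_val_def)

lemma val_monus [simp]: "val M e (monus s t) = monus_val (val M e s) (val M e t)"
  by (simp add: monus_def monus_val_def)

lemma pred_val_in [simp]: "pred_val \<in> Dom M ty1"
  unfolding pred_val_def by (rule Rec_ap(4)) (auto simp: Con_in)

lemma pred_val_ap [simp]: "pred_val $ Z = Z" "n \<in> N \<Longrightarrow> pred_val $ S n = n"
proof -
  have K: "Con M (CK TNat TNat) \<in> Dom M (TNat \<Rrightarrow> ty1)" by (simp add: Con_in)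
  show "pred_val $ Z = Z" unfolding pred_val_def by (simp add: Rec_ap(1)[OF _ K])
  assume "n \<in> N"
  then show "pred_val $ S n = n" unfolding pred_val_def by (simp add: Rec_ap(2,3)[OF _ K] K_ap)
qed

lemma K_pred_val: "Con M (CK ty1 TNat) $ pred_val \<in> Dom M (TNat \<Rrightarrow> ty1)"
  by (rule Ap_Dom[OF Con_in]) auto

lemma monus_val_in [simp]: "a \<in> N \<Longrightarrow> b \<in> N \<Longrightarrow> monus_val a b \<in> N"
  unfolding monus_val_def by (rule Rec_ap(3)[OF _ K_pred_val])

lemma monus_val_rec [simp]:
  "a \<in> N \<Longrightarrow> monus_val a Z = a"
  "a \<in> N \<Longrightarrow> b \<in> N \<Longrightarrow> monus_val a (S b) = pred_val $ monus_val a b"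
  using Rec_ap(1,2,3)[OF _ K_pred_val] by (auto simp: monus_val_def K_ap)

lemma mlt_iff: "mlt M a b \<longleftrightarrow> monus_val (S a) b = Z"
  by (simp add: mlt_def)

definition plus_val :: "'a \<Rightarrow> 'a \<Rightarrow> 'a" where
  "plus_val a b = Con M Rec $ a $ (Con M (CK ty1 TNat) $ Con M Succ) $ b"

lemma val_plus [simp]: "val M e (plus_tm s t) = plus_val (val M e s) (val M e t)"
  by (simp add: plus_tm_def plus_val_def)

lemma K_Succ: "Con M (CK ty1 TNat) $ Con M Succ \<in> Dom M (TNat \<Rrightarrow> ty1)"
  by (rule Ap_Dom[OF Con_in]) (auto simp: Con_in)

lemma plus_val_in [simp]: "a \<in> N \<Longrightarrow> b \<in> N \<Longrightarrow> plus_val a b \<in> N"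
  unfolding plus_val_def by (rule Rec_ap(3)[OF _ K_Succ])

lemma plus_val_rec [simp]:
  "a \<in> N \<Longrightarrow> plus_val a Z = a"
  "a \<in> N \<Longrightarrow> b \<in> N \<Longrightarrow> plus_val a (S b) = S (plus_val a b)"
  using Rec_ap(1,2,3)[OF _ K_Succ] by (auto simp: plus_val_def K_ap Con_in)

lemma nat_cases:
  assumes "n \<in> N"
  obtains "n = Z" | m where "m \<in> N" "n = S m"
proof -
  let ?n = "Var ''n'' TNat"
  have "sat M (dflt((''n'', TNat) := n)) (\<^bold>\<not> (?n \<^bold>= zero) \<^bold>\<longrightarrow> ?n \<^bold>= suc (pred \<cdot> ?n))"
    by (rule nat_induct_qf) (use assms in \<open>auto simp: has_ty_def pred_def[symmetric] wt_arith(1)[unfolded has_ty_def]\<close>)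
  then show ?thesis using that(1) that(2)[of "pred_val $ n"] assms by auto
qed

lemma monus_val_S_S [simp]:
  assumes "a \<in> N" "b \<in> N"
  shows "monus_val (S a) (S b) = monus_val a b"
proof -
  let ?n = "Var ''n'' TNat" and ?a = "Var ''a'' TNat"
  have "sat M (dflt((''a'', TNat) := a, (''n'', TNat) := b)) (monus (suc ?a) (suc ?n) \<^bold>= monus ?a ?n)"
    by (rule nat_induct_qf) (use assms in \<open>auto simp: has_ty_def\<close>)
  then show ?thesis by simp
qed

text \<open>
  Without this equation the two ways of evaluating \<open>monus_val (S a) (S b)\<close> would lead to
  different normal forms.
\<close>

lemma pred_val_monus_val [simp]: "a \<in> N \<Longrightarrow> b \<in> N \<Longrightarrow> pred_val $ monus_val (S a) b = monus_val a b"
  using monus_val_S_S[of a b] by (simp del: monus_val_S_S)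

lemma monus_val_Z [simp]: "b \<in> N \<Longrightarrow> monus_val Z b = Z"
proof -
  assume b: "b \<in> N"
  have "sat M (dflt((''n'', TNat) := b)) (monus zero (Var ''n'' TNat) \<^bold>= zero)"
    by (rule nat_induct_qf) (use b in \<open>auto simp: has_ty_def\<close>)
  then show ?thesis by simp
qed

lemma monus_val_self [simp]: "b \<in> N \<Longrightarrow> monus_val b b = Z" "b \<in> N \<Longrightarrow> monus_val (S b) b = S Z"
proof -
  assume b: "b \<in> N"
  have "sat M (dflt((''n'', TNat) := b)) (monus (Var ''n'' TNat) (Var ''n'' TNat) \<^bold>= zero)"
    by (rule nat_induct_qf) (use b in \<open>auto simp: has_ty_def simp del: monus_val_rec\<close>)
  then show "monus_val b b = Z" by simp
  have "sat M (dflt((''n'', TNat) := b)) (monus (suc (Var ''n'' TNat)) (Var ''n'' TNat) \<^bold>= suc zero)"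
    by (rule nat_induct_qf) (use b in \<open>auto simp: has_ty_def simp del: monus_val_rec(2)\<close>)
  then show "monus_val (S b) b = S Z" by simp
qed

lemma Z_plus_val [simp]: "b \<in> N \<Longrightarrow> plus_val Z b = b"
proof -
  assume b: "b \<in> N"
  have "sat M (dflt((''n'', TNat) := b)) (plus_tm zero (Var ''n'' TNat) \<^bold>= Var ''n'' TNat)"
    by (rule nat_induct_qf) (use b in \<open>auto simp: has_ty_def\<close>)
  then show ?thesis by simp
qed

lemma S_plus_val [simp]: "a \<in> N \<Longrightarrow> b \<in> N \<Longrightarrow> plus_val (S a) b = S (plus_val a b)"
proof -
  assume b: "a \<in> N" "b \<in> N"
  let ?n = "Var ''n'' TNat" and ?a = "Var ''a'' TNat"
  have "sat M (dflt((''a'', TNat) := a, (''n'', TNat) := b)) (plus_tm (suc ?a) ?n \<^bold>= suc (plus_tm ?a ?n))"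
    by (rule nat_induct_qf) (use b in \<open>auto simp: has_ty_def\<close>)
  then show ?thesis by simp
qed

abbreviation LE :: "'a \<Rightarrow> 'a \<Rightarrow> bool" where "LE a b \<equiv> monus_val a b = Z"

lemma LE_plus_val: "a \<in> N \<Longrightarrow> b \<in> N \<Longrightarrow> c \<in> N \<Longrightarrow> LE a b \<Longrightarrow> LE a (plus_val b c)"
proof -
  assume b: "a \<in> N" "b \<in> N" "c \<in> N" "LE a b"
  let ?n = "Var ''n'' TNat" and ?a = "Var ''a'' TNat" and ?b = "Var ''b'' TNat"
  have "sat M (dflt((''a'', TNat) := a, (''b'', TNat) := b, (''n'', TNat) := c))
      (monus ?a (plus_tm ?b ?n) \<^bold>= zero)"
    by (rule nat_induct_qf) (use b in \<open>auto simp: has_ty_def\<close>)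
  then show ?thesis by simp
qed

lemma LE_plus_val_right: "a \<in> N \<Longrightarrow> b \<in> N \<Longrightarrow> LE b (plus_val a b)"
proof -
  assume b: "a \<in> N" "b \<in> N"
  let ?n = "Var ''n'' TNat" and ?a = "Var ''a'' TNat"
  have "sat M (dflt((''a'', TNat) := a, (''n'', TNat) := b)) (monus ?n (plus_tm ?a ?n) \<^bold>= zero)"
    by (rule nat_induct_qf) (use b in \<open>auto simp: has_ty_def simp del: monus_val_rec(2)\<close>)
  then show ?thesis by simp
qed

text \<open>
  The order is expressed by a sum; transitivity and the case distinction \<open>mlt_S\<close> below
  follow from this, whereas a direct induction for transitivity would need a case distinction
  on \<open>b \<le> c + 1\<close> first.
\<close>

lemma LE_imp_plus_val: "a \<in> N \<Longrightarrow> b \<in> N \<Longrightarrow> LE a b \<Longrightarrow> plus_val a (monus_val b a) = b"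
proof -
  assume b: "a \<in> N" "b \<in> N" "LE a b"
  let ?n = "Var ''n'' TNat" and ?b = "Var ''b'' TNat"
  have step: "plus_val (S n) (monus_val b (S n)) = b" if n: "n \<in> N" "LE n b \<longrightarrow> plus_val n (monus_val b n) = b" "LE (S n) b" for n
  proof -
    have "LE n b" using pred_val_monus_val[of n b] n b by (simp del: pred_val_monus_val)
    then have nb: "plus_val n (monus_val b n) = b" using n b by simp
    show ?thesis
    proof (rule nat_cases[of "monus_val b n"])
      assume "monus_val b n = Z"
      then have "n = b" using nb n by simp
      then show ?thesis using n b S_neq_Z[of Z] by simp
    qed (use n b nb in \<open>auto\<close>)
  qed
  have "sat M (dflt((''b'', TNat) := b, (''n'', TNat) := a))
      (monus ?n ?b \<^bold>= zero \<^bold>\<longrightarrow> plus_tm ?n (monus ?b ?n) \<^bold>= ?b)"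
    by (rule nat_induct_qf) (use b step in \<open>auto simp: has_ty_def simp del: monus_val_rec(2) S_plus_val\<close>)
  then show ?thesis using b by simp
qed

lemma LE_trans: "a \<in> N \<Longrightarrow> b \<in> N \<Longrightarrow> c \<in> N \<Longrightarrow> LE a b \<Longrightarrow> LE b c \<Longrightarrow> LE a c"
  using LE_plus_val[of a b "monus_val c b"] LE_imp_plus_val[of b c] by simp

lemma mlt_S: "a \<in> N \<Longrightarrow> b \<in> N \<Longrightarrow> mlt M a (S b) \<Longrightarrow> a = b \<or> mlt M a b"
proof -
  assume a: "a \<in> N" "b \<in> N" "mlt M a (S b)"
  then have p: "plus_val a (monus_val b a) = b" by (intro LE_imp_plus_val) (auto simp: mlt_iff)
  show ?thesis
  proof (rule nat_cases[of "monus_val b a"])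
    fix m assume m: "m \<in> N" "monus_val b a = S m"
    then have "b = plus_val (S a) m" using p a by simp
    then show ?thesis using LE_plus_val[of "S a" "S a" m] a m by (simp add: mlt_iff)
  qed (use a p in auto)
qed

end

section \<open>Standard functionals\<close>

declare lam.simps [simp del]

text \<open>
  \<open>clip f\<close> is the 0/1-sequence \<open>min(f, 1)\<close>, and \<open>excess f\<close> marks the places where \<open>f\<close>
  exceeds 1.  The functional \<open>switch \<phi> f\<close> maps \<open>c\<close> to the value of \<open>\<phi>\<close> at the sequence which agrees
  with \<open>clip f\<close> where \<open>c\<close> is 0 and with \<open>f\<close> elsewhere; it takes the value \<open>\<phi>(clip f)\<close> at the
  zero sequence and \<open>\<phi>(f)\<close> at \<open>excess f\<close>.
\<close>

definition clip_tm :: tm where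
  "clip_tm = lam ''f'' ty1 (lam ''n'' TNat (cond (vf \<cdot> Var ''n'' TNat) zero (suc zero)))"

definition excess_tm :: tm where
  "excess_tm = lam ''f'' ty1 (lam ''n'' TNat
     (cond (monus (vf \<cdot> Var ''n'' TNat) (suc zero)) zero (suc zero)))"

definition switch_tm :: tm where
  "switch_tm = lam ''phi'' ty2 (lam ''f'' ty1 (lam ''c'' ty1 (vphi \<cdot> lam ''n'' TNat
     (cond (Var ''c'' ty1 \<cdot> Var ''n'' TNat) (clip_tm \<cdot> vf \<cdot> Var ''n'' TNat) (vf \<cdot> Var ''n'' TNat)))))"

abbreviation "tyP \<equiv> ty1 \<Rrightarrow> ty1"

text \<open>
  \<open>HAC\<^sub>i\<^sub>n\<^sub>t\<close> and transfer quantify over a single variable, so \<open>\<phi>\<close>, \<open>f\<close>, \<open>g\<close> are coded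
  by one functional \<open>p\<close>: \<open>p h 0 = \<phi>(h)\<close>, and \<open>p h 1 = f(h(0))\<close>, \<open>p h 2 = g(h(0))\<close>.  The sequences
  are recovered by letting \<open>h\<close> be constant.
\<close>

definition triple_tm :: tm where
  "triple_tm = lam ''phi'' ty2 (lam ''f'' ty1 (lam ''g'' ty1 (lam ''h'' ty1 (lam ''n'' TNat
     (cond (Var ''n'' TNat) (vphi \<cdot> Var ''h'' ty1)
       (cond (pred \<cdot> Var ''n'' TNat) (vf \<cdot> (Var ''h'' ty1 \<cdot> zero)) (vg \<cdot> (Var ''h'' ty1 \<cdot> zero))))))))"

definition proj1_tm :: tm where
  "proj1_tm = lam ''p'' tyP (lam ''h'' ty1 (Var ''p'' tyP \<cdot> Var ''h'' ty1 \<cdot> zero))"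
definition proj2_tm :: tm where
  "proj2_tm = lam ''p'' tyP (lam ''n'' TNat
     (Var ''p'' tyP \<cdot> (Cn (CK TNat TNat) \<cdot> Var ''n'' TNat) \<cdot> suc zero))"
definition proj3_tm :: tm where
  "proj3_tm = lam ''p'' tyP (lam ''n'' TNat
     (Var ''p'' tyP \<cdot> (Cn (CK TNat TNat) \<cdot> Var ''n'' TNat) \<cdot> suc (suc zero)))"

text \<open>
  As an upper bound of the entries of a finite sequence one can take their sum.
\<close>

definition bound_step_tm :: tm where
  "bound_step_tm = lam ''s'' (TSeq TNat) (lam ''n'' TNat (lam ''r'' TNat
     (plus_tm (Cn (Nth TNat) \<cdot> Var ''s'' (TSeq TNat) \<cdot> Var ''n'' TNat) (Var ''r'' TNat))))"
definition bound_tm :: tm where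
  "bound_tm = lam ''s'' (TSeq TNat) (Cn Rec \<cdot> zero \<cdot> (bound_step_tm \<cdot> Var ''s'' (TSeq TNat))
     \<cdot> (Cn (Len TNat) \<cdot> Var ''s'' (TSeq TNat)))"

text \<open>
  \<open>F\<close> is the functional supplied by \<open>HAC\<^sub>i\<^sub>n\<^sub>t\<close>, whose value at a code is a finite list of candidates.
  It is asked about \<open>clip f\<close>, which is a 0/1-sequence for every \<open>f\<close>; the third component of
  the code is arbitrary.
\<close>

definition modulus_tm :: tm where
  "modulus_tm = lam ''F'' (tyP \<Rrightarrow> TSeq TNat) (lam ''phi'' ty2 (lam ''f'' ty1
     (bound_tm \<cdot> (Var ''F'' (tyP \<Rrightarrow> TSeq TNat) \<cdot> (triple_tm \<cdot> vphi \<cdot> (clip_tm \<cdot> vf) \<cdot> (clip_tm \<cdot> vf))))))"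

lemma wt_cond [simp]:
  "wt (cond c a b) \<longleftrightarrow> c \<^bold>: TNat \<and> a \<^bold>: TNat \<and> b \<^bold>: TNat"
  "c \<^bold>: TNat \<Longrightarrow> a \<^bold>: TNat \<Longrightarrow> b \<^bold>: TNat \<Longrightarrow> ty_of (cond c a b) = TNat"
  "fvt (cond c a b) = fvt c \<union> fvt a \<union> fvt b"
  by (auto simp: cond_def has_ty_def)

lemma ty_pred [simp]: "wt pred" "ty_of pred = ty1"
  by (simp_all add: pred_def)

lemma closed_tms [simp]:
  "wt clip_tm" "ty_of clip_tm = ty1 \<Rrightarrow> ty1" "fvt clip_tm = {}"
  "wt excess_tm" "ty_of excess_tm = ty1 \<Rrightarrow> ty1" "fvt excess_tm = {}"
  "wt switch_tm" "ty_of switch_tm = ty2 \<Rrightarrow> ty1 \<Rrightarrow> ty2" "fvt switch_tm = {}"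
  "wt triple_tm" "ty_of triple_tm = ty2 \<Rrightarrow> ty1 \<Rrightarrow> ty1 \<Rrightarrow> tyP" "fvt triple_tm = {}"
  "wt proj1_tm" "ty_of proj1_tm = tyP \<Rrightarrow> ty2" "fvt proj1_tm = {}"
  "wt proj2_tm" "ty_of proj2_tm = tyP \<Rrightarrow> ty1" "fvt proj2_tm = {}"
  "wt proj3_tm" "ty_of proj3_tm = tyP \<Rrightarrow> ty1" "fvt proj3_tm = {}"
  "wt bound_step_tm" "ty_of bound_step_tm = TSeq TNat \<Rrightarrow> TNat \<Rrightarrow> TNat \<Rrightarrow> TNat" "fvt bound_step_tm = {}"
  "wt bound_tm" "ty_of bound_tm = TSeq TNat \<Rrightarrow> TNat" "fvt bound_tm = {}"
  "wt modulus_tm" "ty_of modulus_tm = (tyP \<Rrightarrow> TSeq TNat) \<Rrightarrow> ty21" "fvt modulus_tm = {}"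
  by (auto simp: clip_tm_def excess_tm_def switch_tm_def triple_tm_def proj1_tm_def proj2_tm_def
      proj3_tm_def bound_step_tm_def bound_tm_def modulus_tm_def has_ty_def)

lemma le1_one1 [simp]:
  "fv (t \<^bold>\<le>\<^sub>1 one1) = fvt t" "clean (t \<^bold>\<le>\<^sub>1 one1)" "internal (t \<^bold>\<le>\<^sub>1 one1)"
  "t \<^bold>: ty1 \<Longrightarrow> wff (t \<^bold>\<le>\<^sub>1 one1)"
  using fresh_notin[of t one1] by (auto simp: le1_def Let_def le_def one1_def has_ty_def)

lemma eq_upto [simp]:
  "fv (eq_upto s t n) = fvt s \<union> fvt t \<union> fvt n" "clean (eq_upto s t n)"
  "internal (eq_upto s t n)" "strel (eq_upto s t n) = eq_upto s t n"
  "s \<^bold>: ty1 \<Longrightarrow> t \<^bold>: ty1 \<Longrightarrow> n \<^bold>: TNat \<Longrightarrow> wff (eq_upto s t n)"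
      apply (auto simp: eq_upto_def seg_def simp del: eqf.simps)[2]
    apply (simp_all add: eq_upto_def Let_def)[2]
  apply (auto simp: eq_upto_def seg_def has_ty_def simp del: eqf.simps intro!: wff_eqf)[1]
  done

lemma elem_simps [simp]: "z \<^bold>: \<sigma> \<Longrightarrow> s \<^bold>: TSeq \<sigma> \<Longrightarrow> wff (elem \<sigma> z s)" "clean (elem \<sigma> z s)"
  "fv (elem \<sigma> z s) = fvt z \<union> fvt s"
  using fresh_notin[of z s] by (auto simp: elem_def Let_def has_ty_def)

lemma wff_strel [simp]: "wff (strel A) \<longleftrightarrow> wff A"
  and clean_strel [simp]: "clean (strel A) \<longleftrightarrow> clean A"
  and fv_strel [simp]: "fv (strel A) = fv A"
  by (induction A rule: fv.induct) auto

lemma pad0_simps [simp]: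
  "u \<^bold>: TSeq TNat \<Longrightarrow> wt (pad0 u)" "u \<^bold>: TSeq TNat \<Longrightarrow> ty_of (pad0 u) = ty1" "fvt (pad0 u) = fvt u"
  using fresh_notin[of u u] by (auto simp: pad0_def Let_def has_ty_def)

context omega_model
begin

text \<open>
  \<open>bin f\<close> and \<open>st_bin f\<close> are the values of \<open>f \<le>\<^sub>1 1\<close> and of its relativization
  to standard arguments.  A standard \<open>f\<close> with \<open>st_bin f\<close> may have values greater than 1 at
  nonstandard arguments.
\<close>

definition bin :: "'a \<Rightarrow> bool" where "bin f \<longleftrightarrow> (\<forall>n\<in>N. LE (f $ n) (S Z))"
definition st_bin :: "'a \<Rightarrow> bool" where "st_bin f \<longleftrightarrow> (\<forall>n\<in>N. st n \<longrightarrow> LE (f $ n) (S Z))"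
definition agree :: "'a \<Rightarrow> 'a \<Rightarrow> 'a \<Rightarrow> bool" where
  "agree f g n \<longleftrightarrow> EQ M (TSeq TNat) (Con M (Tab TNat) $ f $ n) (Con M (Tab TNat) $ g $ n)"

lemma sat_le1_one1 [simp]:
  "sat M e (t \<^bold>\<le>\<^sub>1 one1) \<longleftrightarrow> bin (val M e t)"
  "sat M e (strel (t \<^bold>\<le>\<^sub>1 one1)) \<longleftrightarrow> st_bin (val M e t)"
  using fresh_notin[of t one1]
  by (auto simp: le1_def Let_def le_def one1_def bin_def st_bin_def K_ap)

lemma sat_eq_upto [simp]:
  "sat M e (eq_upto s t n) \<longleftrightarrow> agree (val M e s) (val M e t) (val M e n)"
  by (simp add: eq_upto_def seg_def agree_def del: EQ.simps eqf.simps)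

lemma Tab_len: 
  assumes "f \<in> Dom M ty1" "n \<in> N"
  shows "Con M (Len TNat) $ (Con M (Tab TNat) $ f $ n) = n"
proof -
  have "sat M (dflt((''f'', ty1) := f, (''n'', TNat) := n))
     (Cn (Len TNat) \<cdot> (Cn (Tab TNat) \<cdot> vf \<cdot> Var ''n'' TNat) \<^bold>= Var ''n'' TNat)"
    by (rule ax_sat) (use assms in \<open>auto intro: epra.seq_len simp: no_params_def\<close>)
  then show ?thesis by simp
qed

lemma Tab_nth:
  assumes "f \<in> Dom M ty1" "n \<in> N" "i \<in> N" "mlt M i n"
  shows "Con M (Nth TNat) $ (Con M (Tab TNat) $ f $ n) $ i = f $ i"
proof -
  have "sat M (dflt((''f'', ty1) := f, (''n'', TNat) := n, (''i'', TNat) := i))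
     (Var ''i'' TNat \<^bold>< Var ''n'' TNat \<^bold>\<longrightarrow>
      eqf TNat (Cn (Nth TNat) \<cdot> (Cn (Tab TNat) \<cdot> vf \<cdot> Var ''n'' TNat) \<cdot> Var ''i'' TNat) (vf \<cdot> Var ''i'' TNat))"
    by (rule ax_sat, rule UnI1, rule epra.seq_nth) (use assms in \<open>auto simp: no_params_def\<close>)
  then show ?thesis using assms by simp
qed

lemma agree_iff:
  "f \<in> Dom M ty1 \<Longrightarrow> g \<in> Dom M ty1 \<Longrightarrow> n \<in> N \<Longrightarrow> agree f g n \<longleftrightarrow> (\<forall>i\<in>N. mlt M i n \<longrightarrow> f $ i = g $ i)"
  by (simp add: agree_def Tab_len Tab_nth)

lemma st_ap: 
  assumes "f \<in> Dom M (\<sigma> \<Rrightarrow> \<tau>)" "a \<in> Dom M \<sigma>" "st f" "st a"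
  shows "st (f $ a)"
proof -
  let ?f = "Var ''f'' (\<sigma> \<Rrightarrow> \<tau>)" and ?x = "Var ''x'' \<sigma>"
  have "sat M (dflt((''f'', \<sigma> \<Rrightarrow> \<tau>) := f, (''x'', \<sigma>) := a)) (St ?f \<^bold>\<and> St ?x \<^bold>\<longrightarrow> St (?f \<cdot> ?x))"
    by (rule ax_sat) (use assms in \<open>auto intro: st_basic.st_app simp: no_params_def\<close>)
  then show ?thesis using assms by simp
qed

lemma st_closed_tm:
  assumes "wt t" "fvt t = {}" shows "st (val M e t)"
proof -
  have "sat M dflt (St t)"
    by (rule ax_sat) (use assms in \<open>auto intro: st_basic.st_closed simp: no_params_def\<close>)
  moreover have "val M e t = val M dflt t" using assms by (intro val_cong) auto
  ultimately show ?thesis by simp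
qed

lemma st_less:
  assumes "m \<in> N" "n \<in> N" "st n" "mlt M m n" shows "st m"
proof -
  let ?m = "Var ''m'' TNat" and ?n = "Var ''n'' TNat"
  have "sat M (dflt((''m'', TNat) := m, (''n'', TNat) := n)) (St ?n \<^bold>\<and> ?m \<^bold>< ?n \<^bold>\<longrightarrow> St ?m)"
    by (rule ax_sat) (use assms in \<open>auto intro: st_basic.st_below simp: no_params_def\<close>)
  then show ?thesis using assms by simp
qed

definition cond_val :: "'a \<Rightarrow> 'a \<Rightarrow> 'a \<Rightarrow> 'a" where
  "cond_val c a b = Con M Rec $ a $ (Con M (CK ty1 TNat) $ (Con M (CK TNat TNat) $ b)) $ c"

lemma val_cond [simp]: "val M e (cond c a b) = cond_val (val M e c) (val M e a) (val M e b)"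
  by (simp add: cond_def cond_val_def)

lemma cond_val [simp]:
  assumes "c \<in> N" "a \<in> N" "b \<in> N"
  shows "cond_val c a b = (if c = Z then a else b)"
proof -
  have K: "Con M (CK TNat TNat) $ b \<in> Dom M ty1" by (rule Ap_Dom[OF Con_in]) (auto simp: assms)
  have KK: "Con M (CK ty1 TNat) $ (Con M (CK TNat TNat) $ b) \<in> Dom M (TNat \<Rrightarrow> ty1)"
    by (rule Ap_Dom[OF Con_in]) (auto simp: K)
  from assms(1) show ?thesis
    by (rule nat_cases) (simp_all add: cond_val_def Rec_ap[OF _ KK] K_ap K assms S_neq_Z)
qed

text \<open>
  A closed term has the same value in all environments.  The constant \<open>cl\<close> keeps the simplifier
  from rewriting that value to itself.
\<close>

definition cl :: "tm \<Rightarrow> 'a" where "cl t = val M dflt t"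

lemma cl_lam: "cl (lam x \<sigma> t) = val M dflt (lam x \<sigma> t)"
  by (simp add: cl_def)

lemma st_cl: "wt t \<Longrightarrow> fvt t = {} \<Longrightarrow> st (cl t)"
  by (simp add: cl_def st_closed_tm)

lemma val_closed [simp]:
  "val M e clip_tm = cl clip_tm" "val M e excess_tm = cl excess_tm" "val M e switch_tm = cl switch_tm"
  "val M e triple_tm = cl triple_tm" "val M e proj1_tm = cl proj1_tm" "val M e proj2_tm = cl proj2_tm"
  "val M e proj3_tm = cl proj3_tm" "val M e bound_step_tm = cl bound_step_tm"
  "val M e bound_tm = cl bound_tm" "val M e modulus_tm = cl modulus_tm"
  unfolding cl_def by (rule val_cong, simp)+

lemma cl_in: "wt t \<Longrightarrow> ty_of t = \<sigma> \<Longrightarrow> cl t \<in> Dom M \<sigma>"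
  unfolding cl_def by (rule val_Dom) auto

lemma clip_facts:
  assumes "f \<in> Dom M ty1"
  shows "cl clip_tm $ f \<in> Dom M ty1"
    and "n \<in> N \<Longrightarrow> cl clip_tm $ f $ n = (if f $ n = Z then Z else S Z)"
    and "st f \<Longrightarrow> st (cl clip_tm $ f)"
    and "bin (cl clip_tm $ f)"
proof -
  have c: "cl clip_tm \<in> Dom M (ty1 \<Rrightarrow> ty1)" by (rule cl_in) auto
  show "cl clip_tm $ f \<in> Dom M ty1" using c assms by simp
  show *: "cl clip_tm $ f $ n = (if f $ n = Z then Z else S Z)" if "n \<in> N" for n
    using assms that unfolding clip_tm_def by (simp add: cl_lam val_lam has_ty_def)
  show "st (cl clip_tm $ f)" if "st f"
    by (rule st_ap[OF c assms st_cl that]) simp_all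
  show "bin (cl clip_tm $ f)" using * by (simp add: bin_def)
qed

lemma excess_facts:
  assumes "f \<in> Dom M ty1"
  shows "cl excess_tm $ f \<in> Dom M ty1"
    and "n \<in> N \<Longrightarrow> cl excess_tm $ f $ n = (if LE (f $ n) (S Z) then Z else S Z)"
    and "bin (cl excess_tm $ f)"
proof -
  have c: "cl excess_tm \<in> Dom M (ty1 \<Rrightarrow> ty1)" by (rule cl_in) auto
  show "cl excess_tm $ f \<in> Dom M ty1" using c assms by simp
  show *: "cl excess_tm $ f $ n = (if LE (f $ n) (S Z) then Z else S Z)" if "n \<in> N" for n
    using assms that unfolding excess_tm_def by (simp add: cl_lam val_lam has_ty_def)
  show "bin (cl excess_tm $ f)" using * by (simp add: bin_def)
qed

lemma LE_one: "n \<in> N \<Longrightarrow> LE n (S Z) \<longleftrightarrow> n = Z \<or> n = S Z"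
  by (erule nat_cases) (auto simp: S_neq_Z dest: S_inj[OF _ Z_in])

lemma switch_facts:
  assumes "\<phi> \<in> Dom M ty2" "f \<in> Dom M ty1" "c \<in> Dom M ty1"
  shows "cl switch_tm $ \<phi> $ f \<in> Dom M ty2"
    and "st \<phi> \<Longrightarrow> st f \<Longrightarrow> st (cl switch_tm $ \<phi> $ f)"
    and "h \<in> Dom M ty1 \<Longrightarrow> (\<And>n. n \<in> N \<Longrightarrow> h $ n = (if c $ n = Z then cl clip_tm $ f $ n else f $ n)) \<Longrightarrow>
       cl switch_tm $ \<phi> $ f $ c = \<phi> $ h"
proof -
  have c: "cl switch_tm \<in> Dom M (ty2 \<Rrightarrow> ty1 \<Rrightarrow> ty2)" by (rule cl_in) auto
  then have c': "cl switch_tm $ \<phi> \<in> Dom M (ty1 \<Rrightarrow> ty2)" using assms by (blast intro: Ap_Dom)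
  then show "cl switch_tm $ \<phi> $ f \<in> Dom M ty2" using assms by (blast intro: Ap_Dom)
  show "st (cl switch_tm $ \<phi> $ f)" if "st \<phi>" "st f"
    by (rule st_ap[OF c' assms(2) st_ap[OF c assms(1) st_cl that(1)] that(2)]) simp_all
  assume h: "h \<in> Dom M ty1" "\<And>n. n \<in> N \<Longrightarrow> h $ n = (if c $ n = Z then cl clip_tm $ f $ n else f $ n)"
  let ?t = "lam ''n'' TNat
     (cond (Var ''c'' ty1 \<cdot> Var ''n'' TNat) (clip_tm \<cdot> vf \<cdot> Var ''n'' TNat) (vf \<cdot> Var ''n'' TNat))"
  let ?e = "dflt((''phi'', ty2) := \<phi>, (''f'', ty1) := f, (''c'', ty1) := c)"
  have wt: "wt ?t" "ty_of ?t = ty1" by (auto simp: has_ty_def)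
  have "cl switch_tm $ \<phi> $ f $ c = \<phi> $ val M ?e ?t"
    using assms wt unfolding switch_tm_def by (simp add: cl_lam val_lam)
  also have "val M ?e ?t = h"
  proof (rule fun_ext)
    show "val M ?e ?t \<in> Dom M ty1" using wt assms by (intro val_Dom) auto
    fix n assume "n \<in> N"
    then show "val M ?e ?t $ n = h $ n" using h assms clip_facts(1) by (simp add: cl_lam val_lam has_ty_def)
  qed (rule h)
  finally show "cl switch_tm $ \<phi> $ f $ c = \<phi> $ h" .
qed

lemma const_fun:
  assumes "n \<in> N" shows "Con M (CK TNat TNat) $ n \<in> Dom M ty1"
    "m \<in> N \<Longrightarrow> Con M (CK TNat TNat) $ n $ m = n"
  using assms by (auto intro!: Ap_Dom[OF Con_in] simp: K_ap)

lemma triple_in: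
  assumes "\<phi> \<in> Dom M ty2" "f \<in> Dom M ty1" "g \<in> Dom M ty1"
  shows "cl triple_tm $ \<phi> $ f $ g \<in> Dom M tyP"
    "st \<phi> \<Longrightarrow> st f \<Longrightarrow> st g \<Longrightarrow> st (cl triple_tm $ \<phi> $ f $ g)"
proof -
  have 1: "cl triple_tm \<in> Dom M (ty2 \<Rrightarrow> ty1 \<Rrightarrow> ty1 \<Rrightarrow> tyP)" by (rule cl_in) auto
  note 2 = Ap_Dom[OF 1 assms(1)] note 3 = Ap_Dom[OF 2 assms(2)]
  show "cl triple_tm $ \<phi> $ f $ g \<in> Dom M tyP" by (rule Ap_Dom[OF 3 assms(3)])
  show "st (cl triple_tm $ \<phi> $ f $ g)" if "st \<phi>" "st f" "st g"
    by (rule st_ap[OF 3 assms(3) st_ap[OF 2 assms(2) st_ap[OF 1 assms(1) st_cl that(1)] that(2)] that(3)])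
      simp_all
qed

lemma triple_ap:
  assumes "\<phi> \<in> Dom M ty2" "f \<in> Dom M ty1" "g \<in> Dom M ty1" "h \<in> Dom M ty1" "n \<in> N"
  shows "cl triple_tm $ \<phi> $ f $ g $ h $ n =
    (if n = Z then \<phi> $ h else if pred_val $ n = Z then f $ (h $ Z) else g $ (h $ Z))"
  using assms unfolding triple_tm_def by (simp add: cl_lam val_lam has_ty_def)

lemma proj_in:
  assumes "p \<in> Dom M tyP"
  shows "cl proj1_tm $ p \<in> Dom M ty2" "cl proj2_tm $ p \<in> Dom M ty1" "cl proj3_tm $ p \<in> Dom M ty1"
    and "st p \<Longrightarrow> st (cl proj1_tm $ p)" "st p \<Longrightarrow> st (cl proj2_tm $ p)" "st p \<Longrightarrow> st (cl proj3_tm $ p)"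
proof -
  have *: "cl proj1_tm \<in> Dom M (tyP \<Rrightarrow> ty2)" "cl proj2_tm \<in> Dom M (tyP \<Rrightarrow> ty1)" "cl proj3_tm \<in> Dom M (tyP \<Rrightarrow> ty1)"
    by (rule cl_in, simp, simp)+
  then show "cl proj1_tm $ p \<in> Dom M ty2" "cl proj2_tm $ p \<in> Dom M ty1" "cl proj3_tm $ p \<in> Dom M ty1"
    using assms by (blast intro: Ap_Dom)+
  show "st (cl proj1_tm $ p)" "st (cl proj2_tm $ p)" "st (cl proj3_tm $ p)" if "st p"
    by (rule st_ap[OF *(1) assms st_cl that] st_ap[OF *(2) assms st_cl that]
      st_ap[OF *(3) assms st_cl that]; simp)+
qed

lemma proj_triple:
  assumes "\<phi> \<in> Dom M ty2" "f \<in> Dom M ty1" "g \<in> Dom M ty1"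
  defines "p \<equiv> cl triple_tm $ \<phi> $ f $ g"
  shows "cl proj1_tm $ p = \<phi>" "cl proj2_tm $ p = f" "cl proj3_tm $ p = g"
proof -
  have p: "p \<in> Dom M tyP" unfolding p_def using assms by (intro triple_in)
  have ap: "p $ h $ n = (if n = Z then \<phi> $ h else if pred_val $ n = Z then f $ (h $ Z) else g $ (h $ Z))"
    if "h \<in> Dom M ty1" "n \<in> N" for h n
    unfolding p_def using triple_ap assms that by blast
  show "cl proj1_tm $ p = \<phi>"
    by (rule fun_ext[OF proj_in(1)[OF p] assms(1)])
      (use p in \<open>simp add: proj1_tm_def cl_lam val_lam ap\<close>)
  show "cl proj2_tm $ p = f"
    by (rule fun_ext[OF proj_in(2)[OF p] assms(2)])
      (use p in \<open>simp add: proj2_tm_def cl_lam val_lam ap const_fun S_neq_Z\<close>)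
  show "cl proj3_tm $ p = g"
    by (rule fun_ext[OF proj_in(3)[OF p] assms(3)])
      (use p in \<open>simp add: proj3_tm_def cl_lam val_lam ap const_fun S_neq_Z\<close>)
qed

text \<open>
  The partial sums \<open>R\<close> dominate each entry already passed, by induction on the number of entries.
\<close>

lemma bound_facts:
  assumes "s \<in> Dom M (TSeq TNat)"
  shows "cl bound_tm $ s \<in> N" "st s \<Longrightarrow> st (cl bound_tm $ s)"
    and "i \<in> N \<Longrightarrow> mlt M i (Con M (Len TNat) $ s) \<Longrightarrow> LE (Con M (Nth TNat) $ s $ i) (cl bound_tm $ s)"
proof -
  have b: "cl bound_tm \<in> Dom M (TSeq TNat \<Rrightarrow> TNat)" by (rule cl_in) auto
  show "cl bound_tm $ s \<in> N" by (rule Ap_Dom[OF b assms])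
  show "st (cl bound_tm $ s)" if "st s"
    by (rule st_ap[OF b assms st_cl that]) simp_all
  let ?h = "cl bound_step_tm $ s"
  have "cl bound_step_tm \<in> Dom M (TSeq TNat \<Rrightarrow> TNat \<Rrightarrow> TNat \<Rrightarrow> TNat)" by (rule cl_in) auto
  then have h: "?h \<in> Dom M (TNat \<Rrightarrow> ty1)" using assms by (blast intro: Ap_Dom)
  have step: "?h $ n $ r = plus_val (Con M (Nth TNat) $ s $ n) r" if "n \<in> N" "r \<in> N" for n r
    using assms that by (simp add: bound_step_tm_def cl_lam val_lam has_ty_def)
  define R where "R = Con M Rec $ Z $ ?h"
  have R: "R \<in> Dom M ty1" "R $ Z = Z" "\<And>n. n \<in> N \<Longrightarrow> R $ S n = plus_val (Con M (Nth TNat) $ s $ n) (R $ n)"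
    unfolding R_def using Rec_ap[OF _ h] step by auto
  have bR: "cl bound_tm $ s = R $ (Con M (Len TNat) $ s)"
    using assms by (simp add: bound_tm_def cl_lam val_lam R_def has_ty_def)
  have nth: "Con M (Nth TNat) $ s $ n \<in> N" if "n \<in> N" for n using Nth_Dom assms that by blast
  assume i: "i \<in> N" "mlt M i (Con M (Len TNat) $ s)"
  let ?n = "Var ''n'' TNat" and ?i = "Var ''i'' TNat" and ?R = "Var ''R'' ty1" and ?s = "Var ''s'' (TSeq TNat)"
  have "sat M (dflt((''i'', TNat) := i, (''R'', ty1) := R, (''s'', TSeq TNat) := s,
        (''n'', TNat) := Con M (Len TNat) $ s))
      (monus (suc ?i) ?n \<^bold>= zero \<^bold>\<longrightarrow> monus (Cn (Nth TNat) \<cdot> ?s \<cdot> ?i) (?R \<cdot> ?n) \<^bold>= zero)"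
  proof (rule nat_induct_qf)
    fix n assume n: "n \<in> N" and IH: "sat M (dflt((''i'', TNat) := i, (''R'', ty1) := R, (''s'', TSeq TNat) := s,
        (''n'', TNat) := n)) (monus (suc ?i) ?n \<^bold>= zero \<^bold>\<longrightarrow> monus (Cn (Nth TNat) \<cdot> ?s \<cdot> ?i) (?R \<cdot> ?n) \<^bold>= zero)"
    have "LE (Con M (Nth TNat) $ s $ i) (R $ S n)" if "mlt M i (S n)"
      using mlt_S[OF i(1) n that]
    proof
      assume "i = n"
      then show ?thesis using R n nth by (simp add: LE_plus_val)
    next
      assume "mlt M i n"
      then have "LE (Con M (Nth TNat) $ s $ i) (R $ n)" using IH by (simp add: mlt_iff)
      then show ?thesis
        using LE_trans[OF nth[OF i(1)], of "R $ n" "R $ S n"] LE_plus_val_right R n nth by simp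
    qed
    then show "sat M (dflt((''i'', TNat) := i, (''R'', ty1) := R, (''s'', TSeq TNat) := s,
        (''n'', TNat) := S n)) (monus (suc ?i) ?n \<^bold>= zero \<^bold>\<longrightarrow> monus (Cn (Nth TNat) \<cdot> ?s \<cdot> ?i) (?R \<cdot> ?n) \<^bold>= zero)"
      by (simp add: mlt_iff)
  qed (use i assms R S_neq_Z in \<open>auto simp: has_ty_def Len_Dom\<close>)
  then show "LE (Con M (Nth TNat) $ s $ i) (cl bound_tm $ s)" using i bR by (simp add: mlt_iff)
qed

lemma sat_elem [simp]:
  "sat M e (elem \<sigma> z s) \<longleftrightarrow> (\<exists>i\<in>N. mlt M i (Con M (Len \<sigma>) $ val M e s) \<and>
     EQ M \<sigma> (val M e z) (Con M (Nth \<sigma>) $ val M e s $ i))"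
  by (simp add: elem_def Let_def)

section \<open>The principles in a model\<close>

lemma modulus_facts:
  assumes "F \<in> Dom M (tyP \<Rrightarrow> TSeq TNat)"
  shows "cl modulus_tm $ F \<in> Dom M ty21" "st F \<Longrightarrow> st (cl modulus_tm $ F)"
    and "\<phi> \<in> Dom M ty2 \<Longrightarrow> f \<in> Dom M ty1 \<Longrightarrow>
      cl modulus_tm $ F $ \<phi> $ f =
      cl bound_tm $ (F $ (cl triple_tm $ \<phi> $ (cl clip_tm $ f) $ (cl clip_tm $ f)))"
proof -
  have c: "cl modulus_tm \<in> Dom M ((tyP \<Rrightarrow> TSeq TNat) \<Rrightarrow> ty21)" by (rule cl_in) auto
  show "cl modulus_tm $ F \<in> Dom M ty21" by (rule Ap_Dom[OF c assms])
  show "st (cl modulus_tm $ F)" if "st F" by (rule st_ap[OF c assms st_cl that]) simp_all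
  show "\<phi> \<in> Dom M ty2 \<Longrightarrow> f \<in> Dom M ty1 \<Longrightarrow>
      cl modulus_tm $ F $ \<phi> $ f =
      cl bound_tm $ (F $ (cl triple_tm $ \<phi> $ (cl clip_tm $ f) $ (cl clip_tm $ f)))"
    using assms by (simp add: modulus_tm_def cl_lam val_lam has_ty_def)
qed

lemma transfer:
  assumes A: "wff A" "internal A" "clean A" "fv A \<subseteq> {(x, \<tau>)}" and x: "\<not> param x" and e: "env M e"
    and st: "\<And>a. a \<in> Dom M \<tau> \<Longrightarrow> st a \<Longrightarrow> sat M (e((x, \<tau>) := a)) A"
    and a: "a \<in> Dom M \<tau>"
  shows "sat M (e((x, \<tau>) := a)) A"
proof -
  have "sat M e (Forall_st x \<tau> A \<^bold>\<longrightarrow> Forall x \<tau> A)"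
    by (rule rca_sat) (use A x e in \<open>auto simp: rca0_Omega_def no_params_def has_ty_def intro: pf_tp.intros\<close>)
  then show ?thesis using st a by simp
qed

definition is_modulus :: "'a \<Rightarrow> bool" where
  "is_modulus \<Delta> \<longleftrightarrow> (\<forall>\<phi>\<in>Dom M ty2. \<forall>f\<in>Dom M ty1. bin f \<longrightarrow>
     (\<forall>g\<in>Dom M ty1. bin g \<longrightarrow> agree f g (\<Delta> $ \<phi> $ f) \<longrightarrow> \<phi> $ f = \<phi> $ g))"

definition is_st_modulus :: "'a \<Rightarrow> bool" where
  "is_st_modulus \<Delta> \<longleftrightarrow> (\<forall>\<phi>\<in>Dom M ty2. st \<phi> \<longrightarrow> (\<forall>f\<in>Dom M ty1. st f \<longrightarrow> st_bin f \<longrightarrow>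
     (\<forall>g\<in>Dom M ty1. st g \<longrightarrow> st_bin g \<longrightarrow> agree f g (\<Delta> $ \<phi> $ f) \<longrightarrow> \<phi> $ f = \<phi> $ g)))"

definition st_point_cont :: bool where
  "st_point_cont \<longleftrightarrow> (\<forall>\<phi>\<in>Dom M ty2. st \<phi> \<longrightarrow> (\<forall>f\<in>Dom M ty1. st f \<longrightarrow> bin f \<longrightarrow>
     (\<exists>k\<in>N. st k \<and> (\<forall>g\<in>Dom M ty1. bin g \<longrightarrow> agree f g k \<longrightarrow> \<phi> $ f = \<phi> $ g))))"

definition infinitesimal_cont :: bool where
  "infinitesimal_cont \<longleftrightarrow> (\<forall>\<phi>\<in>Dom M ty2. st \<phi> \<longrightarrow> (\<forall>f\<in>Dom M ty1. st f \<longrightarrow> bin f \<longrightarrow>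
     (\<forall>g\<in>Dom M ty1. bin g \<longrightarrow> (\<forall>n\<in>N. st n \<longrightarrow> f $ n = g $ n) \<longrightarrow> \<phi> $ f = \<phi> $ g)))"

lemma sat_MPC: "sat M e MPC \<longleftrightarrow> (\<exists>\<Delta>\<in>Dom M ty21. is_modulus \<Delta>)"
  by (auto simp add: MPC_def is_modulus_def)

lemma sat_st_MPC: "sat M e (strel MPC) \<longleftrightarrow> (\<exists>\<Delta>\<in>Dom M ty21. st \<Delta> \<and> is_st_modulus \<Delta>)"
  by (auto simp add: MPC_def is_st_modulus_def)

lemma sat_PC_star: "sat M e PC_star \<longleftrightarrow> st_point_cont"
  by (auto simp add: PC_star_def st_point_cont_def)

lemma sat_PC_frak: "sat M e PC_frak \<longleftrightarrow> infinitesimal_cont"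
  by (simp add: PC_frak_def infinitesimal_cont_def approx1_def Let_def fresh_def)

text \<open>
  Transfer is applied contrapositively: if no standard \<open>\<Delta>\<close> were a modulus, none would be.
\<close>

lemma modulus_imp_cont:
  assumes "\<Delta> \<in> Dom M ty21" "is_modulus \<Delta>"
  shows st_point_cont
proof -
  let ?e = "dflt((''Delta'', ty21) := \<Delta>)"
  let ?A = "fan_K (Var ''Delta'' ty21)"
  have A: "wff ?A" "internal ?A" "clean ?A" "fv ?A \<subseteq> {(''Delta'', ty21)}"
    by (auto simp: fan_K_def has_ty_def)
  have sat_A: "sat M (dflt((''Delta'', ty21) := \<Delta>)) ?A \<longleftrightarrow> is_modulus \<Delta>" for \<Delta>
    by (simp add: fan_K_def is_modulus_def)
  have "\<exists>\<Delta>\<in>Dom M ty21. st \<Delta> \<and> is_modulus \<Delta>"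
  proof (rule ccontr)
    assume no: "\<not> (\<exists>\<Delta>\<in>Dom M ty21. st \<Delta> \<and> is_modulus \<Delta>)"
    have "sat M (dflt((''Delta'', ty21) := \<Delta>)) (\<^bold>\<not> ?A)"
    proof (rule transfer[OF _ _ _ _ _ env_dflt])
      fix a assume "a \<in> Dom M ty21" "st a"
      then show "sat M (dflt((''Delta'', ty21) := a)) (\<^bold>\<not> ?A)"
        using no sat_A[of a]
        by (simp only: sat.simps) blast
    qed (use A assms(1) in auto)
    then show False using assms(2) sat_A[of \<Delta>] unfolding sat.simps by blast
  qed
  then obtain \<Delta> where \<Delta>: "\<Delta> \<in> Dom M ty21" "st \<Delta>" "is_modulus \<Delta>" by blast
  have "st (\<Delta> $ \<phi> $ f)" if "\<phi> \<in> Dom M ty2" "f \<in> Dom M ty1" "st \<phi>" "st f" for \<phi> f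
    by (rule st_ap[OF Ap_Dom[OF \<Delta>(1) that(1)] that(2) st_ap[OF \<Delta>(1) that(1) \<Delta>(2) that(3)] that(4)])
  then show ?thesis using \<Delta>(1,3) unfolding st_point_cont_def is_modulus_def
    by (meson ap_in(2) ap_in(3))
qed

lemma cont_imp_infinitesimal:
  assumes st_point_cont shows infinitesimal_cont
  unfolding infinitesimal_cont_def
proof (intro Set.ballI HOL.impI)
  fix \<phi> f g assume *: "\<phi> \<in> Dom M ty2" "st \<phi>" "f \<in> Dom M ty1" "st f" "bin f" "g \<in> Dom M ty1" "bin g"
    and fg: "\<forall>n\<in>N. st n \<longrightarrow> f $ n = g $ n"
  then obtain k where k: "k \<in> N" "st k" "\<forall>g\<in>Dom M ty1. bin g \<longrightarrow> agree f g k \<longrightarrow> \<phi> $ f = \<phi> $ g"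
    using assms unfolding st_point_cont_def by meson
  have "agree f g k" using * k fg st_less by (simp add: agree_iff)
  then show "\<phi> $ f = \<phi> $ g" using k * by blast
qed

lemma st_Z: "st Z" and st_K: "st (Con M c)"
  using st_closed_tm[of zero dflt] st_closed_tm[of "Cn c" dflt] by auto

text \<open>
  Suppose no standard \<open>k\<close> works at \<open>(\<phi>, f)\<close>.  A standard finite sequence of numbers has a standard
  bound, and a \<open>g\<close> that agrees with \<open>f\<close> up to the bound agrees with \<open>f\<close> up to each
  entry.  Idealization then yields a single \<open>g\<close> that agrees with \<open>f\<close> up to every standard number.
\<close>

lemma infinitesimal_imp_cont:
  assumes ic: infinitesimal_cont shows st_point_cont
proof (rule ccontr)
  assume "\<not> st_point_cont"
  then obtain \<phi> f where \<phi>: "\<phi> \<in> Dom M ty2" "st \<phi>" and f: "f \<in> Dom M ty1" "st f" "bin f"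
    and no: "\<And>k. k \<in> N \<Longrightarrow> st k \<Longrightarrow> \<exists>g\<in>Dom M ty1. bin g \<and> agree f g k \<and> \<phi> $ f \<noteq> \<phi> $ g"
    unfolding st_point_cont_def by meson
  let ?e = "dflt((''phi'', ty2) := \<phi>, (''f'', ty1) := f)"
  let ?A = "vg \<^bold>\<le>\<^sub>1 one1 \<^bold>\<and> eq_upto vf vg (Var ''k'' TNat) \<^bold>\<and> \<^bold>\<not> (vphi \<cdot> vf \<^bold>= vphi \<cdot> vg)"
  let ?s = "Var ''s'' (TSeq TNat)"
  let ?P = "Forall_st ''s'' (TSeq TNat) (Exists ''g'' ty1
           (Forall ''k'' TNat (elem TNat (Var ''k'' TNat) ?s \<^bold>\<longrightarrow> ?A)))"
  let ?C = "Exists ''g'' ty1 (Forall_st ''k'' TNat ?A)"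
  have ax: "(?P \<^bold>\<longrightarrow> ?C) \<in> idealization"
    by (rule idealization.intros) (auto simp: has_ty_def)
  have "sat M ?e (?P \<^bold>\<longrightarrow> ?C)"
  proof (rule rca_sat)
    show "(?P \<^bold>\<longrightarrow> ?C) \<in> rca0_Omega" unfolding rca0_Omega_def using ax by blast
    show "env M ?e" using \<phi> f by simp
    show "no_params (?P \<^bold>\<longrightarrow> ?C)" by (simp add: no_params_def insert_Diff_if)
    show "wff (?P \<^bold>\<longrightarrow> ?C)" by (simp add: has_ty_def)
  qed
  moreover have *: "\<exists>g\<in>Dom M ty1. \<forall>k\<in>N. (\<exists>i\<in>N. mlt M i (Con M (Len TNat) $ s) \<and>
      k = Con M (Nth TNat) $ s $ i) \<longrightarrow> bin g \<and> agree f g k \<and> \<phi> $ f \<noteq> \<phi> $ g"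
    if s: "s \<in> Dom M (TSeq TNat)" "st s" for s
  proof -
    let ?b = "cl bound_tm $ s"
    from no[OF bound_facts(1,2)] s obtain g where g: "g \<in> Dom M ty1" "bin g" "agree f g ?b" "\<phi> $ f \<noteq> \<phi> $ g"
      by blast
    have "agree f g (Con M (Nth TNat) $ s $ i)" if i: "i \<in> N" "mlt M i (Con M (Len TNat) $ s)" for i
    proof -
      have n: "Con M (Nth TNat) $ s $ i \<in> N" using Nth_Dom s i by blast
      have le: "LE (Con M (Nth TNat) $ s $ i) ?b" using bound_facts(3) s i by blast
      have "f $ j = g $ j" if "j \<in> N" "mlt M j (Con M (Nth TNat) $ s $ i)" for j
      proof -
        have "mlt M j ?b"
          using LE_trans[OF _ n bound_facts(1)[OF s(1)] _ le, of "S j"] that by (simp add: mlt_iff)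
        then show ?thesis using g f that bound_facts(1)[OF s(1)] by (simp add: agree_iff)
      qed
      then show ?thesis using f g n by (simp add: agree_iff)
    qed
    then show ?thesis using g by blast
  qed
  have "sat M ?e ?P"
    by simp (use * in blast)
  ultimately obtain g where g: "g \<in> Dom M ty1" "\<And>k. k \<in> N \<Longrightarrow> st k \<Longrightarrow> bin g \<and> agree f g k \<and> \<phi> $ f \<noteq> \<phi> $ g"
    by auto
  \<comment> \<open>agreement up to \<open>n + 1\<close> includes the place \<open>n\<close>\<close>
  have "f $ n = g $ n" if n: "n \<in> N" "st n" for n
  proof -
    have "st (S n)" by (rule st_ap[OF Con_in _ _ n(2)]) (use n st_K in auto)
    then have "agree f g (S n)" using g(2)[of "S n"] n by simp
    then show ?thesis using n f g(1) by (auto simp: agree_iff mlt_iff)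
  qed
  then show False using ic g(2)[OF Z_in st_Z] g(1) \<phi> f unfolding infinitesimal_cont_def by blast
qed

text \<open>
  The sequences \<open>f\<close> and \<open>clip f\<close> agree at the standard numbers.  Extensionality asks for agreement at
  all numbers, and transfer does not lead from the one to the other because \<open>f\<close> is a parameter.
  Instead, continuity is used: \<open>excess f\<close> vanishes at all standard numbers, so \<open>switch \<phi> f\<close> has
  the same value at \<open>excess f\<close> as at the zero sequence.
\<close>

lemma clip_cong:
  assumes ic: infinitesimal_cont and \<phi>: "\<phi> \<in> Dom M ty2" "st \<phi>" and f: "f \<in> Dom M ty1" "st f" "st_bin f"
  shows "\<phi> $ (cl clip_tm $ f) = \<phi> $ f"
proof -
  let ?G = "cl switch_tm $ \<phi> $ f" and ?z = "Con M (CK TNat TNat) $ Z" and ?d = "cl excess_tm $ f"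
  have G: "?G \<in> Dom M ty2" "st ?G" using switch_facts(1,2)[OF \<phi>(1) f(1) f(1)] \<phi> f by auto
  have 0: "?z \<in> Dom M ty1" "st ?z" "bin ?z"
    using const_fun[OF Z_in] st_ap[OF Con_in Z_in st_K st_Z, of "CK TNat TNat" ty1]
    by (auto simp: bin_def)
  have "?z $ n = ?d $ n" if "n \<in> N" "st n" for n
    using that f const_fun excess_facts(2) by (simp add: st_bin_def)
  then have "?G $ ?z = ?G $ ?d"
    using ic G 0 excess_facts[OF f(1)] unfolding infinitesimal_cont_def by blast
  moreover have "?G $ ?z = \<phi> $ (cl clip_tm $ f)"
    by (rule switch_facts(3)[OF \<phi>(1) f(1) 0(1)]) (use clip_facts f const_fun in auto)
  moreover have "?G $ ?d = \<phi> $ f"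
    by (rule switch_facts(3)[OF \<phi>(1) f(1) excess_facts(1)]) (use f LE_one in \<open>auto simp: excess_facts(2) clip_facts(2) S_neq_Z\<close>)
  ultimately show ?thesis by simp
qed

text \<open>
  One entry of the list \<open>F(p)\<close> is a correct \<open>k\<close>, and any number above it is correct as well.
\<close>

lemma cont_imp_st_modulus:
  assumes pc: st_point_cont
  shows "\<exists>\<Delta>\<in>Dom M ty21. st \<Delta> \<and> is_st_modulus \<Delta>"
proof -
  have ic: infinitesimal_cont using pc by (rule cont_imp_infinitesimal)
  let ?p = "Var ''p'' tyP" and ?k = "Var ''k'' TNat" and ?F = "Var ''F'' (tyP \<Rrightarrow> TSeq TNat)"
  let ?A = "(proj2_tm \<cdot> ?p) \<^bold>\<le>\<^sub>1 one1 \<^bold>\<longrightarrow> Forall01 ''g''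
     (eq_upto (proj2_tm \<cdot> ?p) vg ?k \<^bold>\<longrightarrow> proj1_tm \<cdot> ?p \<cdot> (proj2_tm \<cdot> ?p) \<^bold>= proj1_tm \<cdot> ?p \<cdot> vg)"
  define good where "good p k \<longleftrightarrow> (bin (cl proj2_tm $ p) \<longrightarrow> (\<forall>g\<in>Dom M ty1. bin g \<longrightarrow>
     agree (cl proj2_tm $ p) g k \<longrightarrow> cl proj1_tm $ p $ (cl proj2_tm $ p) = cl proj1_tm $ p $ g))" for p k
  let ?P = "Forall_st ''p'' tyP (Exists_st ''k'' TNat ?A)"
  let ?C = "Exists_st ''F'' (tyP \<Rrightarrow> TSeq TNat) (Forall_st ''p'' tyP (Exists ''k'' TNat
           (elem TNat ?k (?F \<cdot> ?p) \<^bold>\<and> ?A)))"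
  have "(?P \<^bold>\<longrightarrow> ?C) \<in> hac_int"
    by (rule hac_int.intros) (auto simp: has_ty_def)
  then have "(?P \<^bold>\<longrightarrow> ?C) \<in> rca0_Omega" unfolding rca0_Omega_def by blast
  then have "sat M dflt (?P \<^bold>\<longrightarrow> ?C)"
    by (rule rca_sat) (auto simp: no_params_def has_ty_def)
  moreover have "\<exists>k\<in>N. st k \<and> good p k" if p: "p \<in> Dom M tyP" "st p" for p
  proof (cases "bin (cl proj2_tm $ p)")
    case True
    with pc proj_in[OF p(1)] p(2) obtain k where "k \<in> N" "st k"
      "\<forall>g\<in>Dom M ty1. bin g \<longrightarrow> agree (cl proj2_tm $ p) g k \<longrightarrow>
         cl proj1_tm $ p $ (cl proj2_tm $ p) = cl proj1_tm $ p $ g"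
      unfolding st_point_cont_def by meson
    then show ?thesis unfolding good_def by blast
  \<comment> \<open>off the 0/1-sequences every number is good; \<open>Z\<close> is a standard one\<close>
  qed (use st_Z good_def in auto)
  then have "sat M dflt ?P" by (auto simp: good_def)
  ultimately obtain F where F: "F \<in> Dom M (tyP \<Rrightarrow> TSeq TNat)" "st F"
    and FP: "\<And>p. p \<in> Dom M tyP \<Longrightarrow> st p \<Longrightarrow> \<exists>k\<in>N. (\<exists>i\<in>N. mlt M i (Con M (Len TNat) $ (F $ p)) \<and>
        k = Con M (Nth TNat) $ (F $ p) $ i) \<and> good p k"
    unfolding good_def by auto
  let ?\<Delta> = "cl modulus_tm $ F"
  have "is_st_modulus ?\<Delta>"
    unfolding is_st_modulus_def
  proof (intro Set.ballI HOL.impI)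
    fix \<phi> f g assume \<phi>: "\<phi> \<in> Dom M ty2" "st \<phi>" and f: "f \<in> Dom M ty1" "st f" "st_bin f"
      and g: "g \<in> Dom M ty1" "st g" "st_bin g" and ag: "agree f g (?\<Delta> $ \<phi> $ f)"
    let ?f = "cl clip_tm $ f" and ?g = "cl clip_tm $ g"
    define p where "p = cl triple_tm $ \<phi> $ ?f $ ?f"
    have p: "p \<in> Dom M tyP" "st p" "cl proj1_tm $ p = \<phi>" "cl proj2_tm $ p = ?f"
      unfolding p_def using \<phi> f clip_facts triple_in proj_triple by auto
    have \<Delta>: "?\<Delta> $ \<phi> $ f = cl bound_tm $ (F $ p)"
      unfolding p_def using modulus_facts(3)[OF F(1)] \<phi> f by simp
    have Fp: "F $ p \<in> Dom M (TSeq TNat)" using F p by simp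
    from FP[OF p(1,2)] obtain i where i: "i \<in> N" "mlt M i (Con M (Len TNat) $ (F $ p))"
      and good: "good p (Con M (Nth TNat) $ (F $ p) $ i)" by blast
    let ?k = "Con M (Nth TNat) $ (F $ p) $ i"
    have k: "?k \<in> N" using Nth_Dom Fp i by blast
    have le: "LE ?k (cl bound_tm $ (F $ p))" using bound_facts(3)[OF Fp i] .
    have "?f $ j = ?g $ j" if "j \<in> N" "mlt M j ?k" for j
    proof -
      have "mlt M j (cl bound_tm $ (F $ p))"
        using LE_trans[OF _ k bound_facts(1)[OF Fp] _ le, of "S j"] that by (simp add: mlt_iff)
      then have "f $ j = g $ j" using ag f g that bound_facts(1)[OF Fp] by (simp add: \<Delta> agree_iff)
      then show ?thesis using that f g by (simp add: clip_facts)
    qed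
    then have "agree ?f ?g ?k" using f g k clip_facts(1) by (simp add: agree_iff)
    then have "\<phi> $ ?f = \<phi> $ ?g" using good p clip_facts f g unfolding good_def by auto
    then show "\<phi> $ f = \<phi> $ g" using clip_cong[OF ic] \<phi> f g by simp
  qed
  then show ?thesis using modulus_facts(1,2)[OF F(1)] F(2) by blast
qed

lemma st_val: "wt t \<Longrightarrow> env M e \<Longrightarrow> (\<And>v. v \<in> fvt t \<Longrightarrow> st (e v)) \<Longrightarrow> st (val M e t)"
proof (induction t rule: fvt.induct)
  case (3 s t)
  then obtain \<tau> where \<tau>: "ty_of s = ty_of t \<Rrightarrow> \<tau>" by auto
  have "val M e s \<in> Dom M (ty_of t \<Rrightarrow> \<tau>)" "val M e t \<in> Dom M (ty_of t)"
    using 3 \<tau> by (auto intro!: val_Dom)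
  moreover have "st (val M e s)" "st (val M e t)" using 3 by auto
  ultimately show ?case by (simp add: st_ap)
qed (auto simp: st_K)

lemma pad0_ap:
  assumes "u \<^bold>: TSeq TNat" "env M e" "i \<in> N"
  shows "val M e (pad0 u) $ i =
    (if mlt M i (Con M (Len TNat) $ val M e u) then Con M (Nth TNat) $ val M e u $ i else Z)"
proof -
  have u: "val M e u \<in> Dom M (TSeq TNat)" using assms by (auto simp: has_ty_def intro: val_Dom)
  then show ?thesis
    using assms fresh_notin[of u u] Len_Dom[OF u] Nth_Dom[OF u]
    by (simp add: pad0_def Let_def val_lam has_ty_def mlt_iff)
qed

text \<open>
  Let \<open>P\<close> be the initial segment of \<open>f\<close> of length \<open>\<Lambda>\<^sub>0(\<phi>, f)\<close>, continued by zeros.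
  The axiom says that the associate of \<open>\<phi>\<close> does not vanish at this segment, that is, the
  modulus of \<open>\<phi>\<close> at \<open>P\<close> is at most the length of the segment, and that \<open>\<phi>(P) = \<phi>(f)\<close>.  Every
  standard \<open>g\<close> that agrees with \<open>f\<close> on the segment agrees with \<open>P\<close> up to the modulus at \<open>P\<close>,
  so \<open>\<phi>(g) = \<phi>(P) = \<phi>(f)\<close>.  This statement on \<open>\<Lambda>\<^sub>0\<close> has no parameter left and can be transferred.
\<close>

lemma st_modulus_imp_modulus:
  assumes \<Upsilon>: "\<Upsilon> \<in> Dom M ty21" "st \<Upsilon>" "is_st_modulus \<Upsilon>"
  shows "is_modulus (Con M Lambda0)"
proof -
  let ?L = "Con M Lambda0"
  let ?U = "Var ''Upsilon'' ty21"
  let ?u = "seg vf (Cn Lambda0 \<cdot> vphi \<cdot> vf)"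
  let ?B = "assoc vphi (?U \<cdot> vphi) ?u \<^bold>= suc (vphi \<cdot> vf)"
  let ?A = "St (Cn Lambda0) \<^bold>\<and> Forall_st ''Upsilon'' ty21 (strel (fan_K ?U) \<^bold>\<longrightarrow>
        Forall_st ''phi'' ty2 (Forall01_st ''f'' ?B))"
  have u: "?u \<^bold>: TSeq TNat" "fvt ?u = {(''f'', ty1), (''phi'', ty2)}" by (auto simp: seg_def has_ty_def)
  have wB: "wff ?B" "fv ?B = {(''f'', ty1), (''phi'', ty2), (''Upsilon'', ty21)}" "clean ?B"
    using u by (auto simp: assoc_def has_ty_def)
  have "?A \<in> rca0_Omega" unfolding rca0_Omega_def by (blast intro: const_ax.lambda_ax)
  then have ax: "sat M dflt ?A"
  proof (rule rca_sat)
    show "wff ?A" using wB by (simp add: fan_K_def has_ty_def)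
    show "no_params ?A" using wB by (auto simp: fan_K_def no_params_def)
  qed simp
  have satK: "sat M (dflt((''Upsilon'', ty21) := \<Upsilon>)) (strel (fan_K ?U))"
    using \<Upsilon>(3) by (auto simp: fan_K_def is_st_modulus_def)
  have L: "?L \<in> Dom M ty21" by (simp add: Con_in)
  have main: "\<phi> $ f = \<phi> $ g"
    if \<phi>: "\<phi> \<in> Dom M ty2" "st \<phi>" and f: "f \<in> Dom M ty1" "st f" "bin f"
      and g: "g \<in> Dom M ty1" "st g" "bin g" and ag: "agree f g (?L $ \<phi> $ f)" for \<phi> f g
  proof -
    let ?e = "dflt((''Upsilon'', ty21) := \<Upsilon>, (''phi'', ty2) := \<phi>, (''f'', ty1) := f)"
    let ?P = "val M ?e (pad0 ?u)"
    let ?m = "?L $ \<phi> $ f"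
    have e: "env M ?e" using \<Upsilon> \<phi> f by simp
    have m: "?m \<in> N" using L \<phi> f by simp
    have vu: "val M ?e ?u = Con M (Tab TNat) $ f $ ?m" by (simp add: seg_def)
    have P: "?P \<in> Dom M ty1" using u e by (intro val_Dom) auto
    have stP: "st ?P" using u e \<phi> f \<Upsilon> by (intro st_val) auto
    have Pap: "?P $ i = (if mlt M i ?m then f $ i else Z)" if "i \<in> N" for i
      using that f m by (simp add: pad0_ap[OF u(1) e that] vu Tab_len Tab_nth del: fun_upd_apply)
    have binP: "st_bin ?P" using f Pap by (auto simp: st_bin_def bin_def)
    have "sat M ?e ?B" using ax satK \<Upsilon> \<phi> f by simp
    then have "cond_val (monus_val (\<Upsilon> $ \<phi> $ ?P) ?m) (S (\<phi> $ ?P)) Z = S (\<phi> $ f)"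
      using f m by (simp add: assoc_def vu Tab_len)
    moreover have "\<Upsilon> $ \<phi> $ ?P \<in> N" using \<Upsilon> \<phi> P by simp
    ultimately have le: "LE (\<Upsilon> $ \<phi> $ ?P) ?m" and "S (\<phi> $ ?P) = S (\<phi> $ f)"
      using \<phi> f P m S_neq_Z[of "\<phi> $ f"] by (auto split: if_splits)
    then have Pf: "\<phi> $ ?P = \<phi> $ f" using S_inj \<phi> f P by simp
    have "?P $ i = g $ i" if i: "i \<in> N" "mlt M i (\<Upsilon> $ \<phi> $ ?P)" for i
    proof -
      have "mlt M i ?m" using LE_trans[OF _ _ m _ le, of "S i"] i \<open>\<Upsilon> $ \<phi> $ ?P \<in> N\<close>
        by (simp add: mlt_iff)
      then show ?thesis using Pap i ag f g m by (simp add: agree_iff)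
    qed
    then have "agree ?P g (\<Upsilon> $ \<phi> $ ?P)" using P g \<open>\<Upsilon> $ \<phi> $ ?P \<in> N\<close> by (simp add: agree_iff)
    moreover have "st_bin g" using g by (simp add: bin_def st_bin_def)
    ultimately have "\<phi> $ ?P = \<phi> $ g"
      using \<Upsilon>(3) \<phi> P stP binP g unfolding is_st_modulus_def by blast
    then show ?thesis using Pf by simp
  qed
  \<comment> \<open>the transferred formula has the code \<open>p\<close> of \<open>\<phi>\<close>, \<open>f\<close>, \<open>g\<close> as its only variable\<close>
  let ?p = "Var ''p'' tyP"
  let ?f = "proj2_tm \<cdot> ?p" and ?g = "proj3_tm \<cdot> ?p" and ?phi = "proj1_tm \<cdot> ?p"
  let ?C = "?f \<^bold>\<le>\<^sub>1 one1 \<^bold>\<longrightarrow> ?g \<^bold>\<le>\<^sub>1 one1 \<^bold>\<longrightarrow> eq_upto ?f ?g (Cn Lambda0 \<cdot> ?phi \<cdot> ?f) \<^bold>\<longrightarrow>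
    ?phi \<cdot> ?f \<^bold>= ?phi \<cdot> ?g"
  have C: "sat M (dflt((''p'', tyP) := p)) ?C" if "p \<in> Dom M tyP" for p
  proof (rule transfer[OF _ _ _ _ _ env_dflt _ that])
    fix q assume "q \<in> Dom M tyP" "st q"
    then show "sat M (dflt((''p'', tyP) := q)) ?C" using main proj_in[of q] by simp
  qed (auto simp: has_ty_def)
  show ?thesis
    unfolding is_modulus_def
  proof (intro Set.ballI HOL.impI)
    fix \<phi> f g assume "\<phi> \<in> Dom M ty2" "f \<in> Dom M ty1" "bin f" "g \<in> Dom M ty1" "bin g" "agree f g (?L $ \<phi> $ f)"
    then show "\<phi> $ f = \<phi> $ g"
      using C[of "cl triple_tm $ \<phi> $ f $ g"] by (simp add: triple_in proj_triple)
  qed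
qed

lemma principles_equiv:
  "sat M e MPC \<longleftrightarrow> sat M e PC_star" "sat M e PC_star \<longleftrightarrow> sat M e PC_frak"
  "sat M e PC_frak \<longleftrightarrow> sat M e (strel MPC)"
proof -
  have "Con M Lambda0 \<in> Dom M ty21" by (simp add: Con_in)
  then have "sat M e (strel MPC) \<Longrightarrow> sat M e MPC" "sat M e MPC \<Longrightarrow> sat M e PC_star"
    "sat M e PC_star \<Longrightarrow> sat M e (strel MPC)"
    "sat M e PC_star \<longleftrightarrow> sat M e PC_frak"
    unfolding sat_MPC sat_st_MPC sat_PC_star sat_PC_frak
    using st_modulus_imp_modulus modulus_imp_cont cont_imp_st_modulus
      cont_imp_infinitesimal infinitesimal_imp_cont by blast+
  then show "sat M e MPC \<longleftrightarrow> sat M e PC_star" "sat M e PC_star \<longleftrightarrow> sat M e PC_frak"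
    "sat M e PC_frak \<longleftrightarrow> sat M e (strel MPC)" by blast+
qed

end

section \<open>Derivability of the equivalences\<close>

lemma principles_wf:
  "wff MPC" "clean MPC" "fv MPC = {}"
  "wff PC_star" "clean PC_star" "fv PC_star = {}"
  "wff PC_frak" "clean PC_frak" "fv PC_frak = {}"
  by (auto simp: MPC_def PC_star_def PC_frak_def approx1_def Let_def fresh_def has_ty_def)

lemma derivable_iff:
  assumes "wff A" "clean A" "fv A = {}" "wff B" "clean B" "fv B = {}"
    and "\<And>M e. omega_model (M :: tm struct) \<Longrightarrow> sat M e A \<longleftrightarrow> sat M e B"
  shows "rca0_Omega \<turnstile> A \<^bold>\<longleftrightarrow> B"
proof (rule ext_completeness)
  show sub: "epra \<subseteq> rca0_Omega" "st_basic \<subseteq> rca0_Omega"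
    by (auto simp: rca0_Omega_def rca0_omega_def)
  fix M :: "tm struct" and e assume M: "ext_struct M" "models M rca0_Omega"
  then interpret ext_struct M by simp
  have "omega_model M"
    using M sub ext_typed by (simp add: omega_model_def epra_model_def)
  then show "sat M e (A \<^bold>\<longleftrightarrow> B)" using assms by auto
qed (use assms in auto)

theorem theorem5p1:
  shows "(rca0_Omega \<turnstile> MPC \<^bold>\<longleftrightarrow> PC_star) \<and>
         (rca0_Omega \<turnstile> PC_star \<^bold>\<longleftrightarrow> PC_frak) \<and>
         (rca0_Omega \<turnstile> PC_frak \<^bold>\<longleftrightarrow> strel MPC)"
  by (intro conjI derivable_iff) (simp_all add: principles_wf omega_model.principles_equiv)

end
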